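(* Let $(X,Y)$ satisfy the partial reduced-rank multivariate generalised linear model described in the context, with true parameter $\xi_0=(\overline\eta_{01},\beta_{01},\beta_{02},\overline\eta_{02})\in\Xi^{\mathrm{res}}$ (so $\mathrm{rank}(\beta_{01})=d$), and suppose the regularity conditions (R1)--(R4) of the context hold. Let $Z_i=(X_i,Y_i)$, $i\ge 1$, be i.i.d. copies of $Z=(X,Y)$, and for $z=(x,y)$ let $m_\xi(z)=T(y)^TF(x)\xi-\psi(F(x)\xi)$ and $M_n(\xi)=\frac1n\sum_{i=1}^n m_\xi(Z_i)$. Then: (i) there exists a strong M-estimator sequence for the criterion function $M_n$ over $\Xi^{\mathrm{res}}$; (ii) any weak M-estimator sequence $\{\widehat\xi_n^{\mathrm{res}}\}$ for $M_n$ over $\Xi^{\mathrm{res}}$ converges to $\xi_0$ in probability; (iii) if $\{\widehat\xi_n^{\mathrm{res}}\}$ is a strong M-estimator sequence for $M_n$ over $\Xi^{\mathrm{res}}$, then $\sqrt n(\widehat\xi_n^{\mathrm{res}}-\xi_0)$ is asymptotically normal with mean zero and covariance matrix $$\Pi_{\xi_0(W_{\xi_0}^{-1})}\,W_{\xi_0},$$ where $$W_{\xi_0}=\left[\mathrm E\left\{F(X)^T\nabla^2\psi(F(X)\xi_0)F(X)\right\}\right]^{-1},$$ $$\Pi_{\xi_0(W_{\xi_0}^{-1})}=\nabla g(\theta_0)\left(\nabla g(\theta_0)^TW_{\xi_0}^{-1}\nabla g(\theta_0)\right)^{\dagger}\nabla g(\theta_0)^TW_{\xi_0}^{-1}$$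 for any $\theta_0\in g^{-1}(\xi_0)$.
   Context: Weak/strong M-estimators: an estimator $\widehat\xi_n=\widehat\xi_n(Z_1,\dots,Z_n)$ with values in a set $\Xi'$ satisfying $M_n(\widehat\xi_n)\ge\sup_{\xi\in\Xi'}M_n(\xi)-A_n$ is called a weak M-estimator for $M_n$ over $\Xi'$ if $A_n=o_p(1)$, and a strong M-estimator if $A_n=o_p(n^{-1})$. Exponential family: $T(y)\in\mathbb R^k$ is a vector of known real functions of $y\in\mathbb R^q$ and $h(y)\ge0$ is a known function; densities (or mass functions) are $f_\eta(y)=\exp\{\eta^TT(y)-\psi(\eta)\}h(y)$, with natural parameter space $H=\{\eta\in\mathbb R^k:\int\exp\{\eta^TT(y)\}h(y)\,dy<\infty\}$ (a sum in the discrete case). It is assumed that $H=\mathbb R^{k_1}\times H_2$ with $k=k_1+k_2$ and $H_2\subset\mathbb R^{k_2}$ open and convex, and that $\psi$ is strictly convex and infinitely differentiable on $H$, with $\nabla\psi(\eta)=\mathrm E_\eta(T(Y))^T$ and $\nabla^2\psi(\eta)=\mathrm{var}_\eta(T(Y))$ nonsingular. Model: $X\in\mathbb R^p$, and conditionally on $X=x$, $Y\in\mathbb R^q$ has density $\exp\{\eta_x^TT(y)-\psi(\eta_x)\}h(y)$. The predictor is partitioned as $x=(x_1,x_2)$, $x_1\in\mathbb R^r$, $x_2\in\mathbb R^{p-r}$, and $$\eta_x=\begin{pmatrix}\overline\eta_1+\beta_1x_1+\beta_2x_2\\ \overline\eta_2\end{pmatrix},\qquad \overline\eta_1\in\mathbb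 R^{k_1},\ \beta_1\in\mathbb R^{k_1\times r}_d,\ \beta_2\in\mathbb R^{k_1\times(p-r)},\ \overline\eta_2\in H_2,$$ where $\mathbb R^{a\times b}_d$ denotes the set of $a\times b$ real matrices of rank $d$, and $1\le d\le\min\{k_1,r\}$. Write $\beta=(\beta_1,\beta_2)\in\mathbb R^{k_1\times p}$. The parameter $\xi=(\overline\eta_1,\beta_1,\beta_2,\overline\eta_2)$ is identified with the column vector $(\overline\eta_1^T,\mathrm{vec}(\beta)^T,\overline\eta_2^T)^T$. With $$F(x)=\begin{pmatrix}(1,x^T)\otimes I_{k_1}&0\\0&I_{k_2}\end{pmatrix}$$ one has $\eta_x=F(x)\xi$. Parameter spaces (matrices identified with their vectorizations): $\Xi=\mathbb R^{k_1}\times\mathbb R^{k_1\times r}\times\mathbb R^{k_1\times(p-r)}\times H_2$, $\Xi^{\mathrm{res}}=\mathbb R^{k_1}\times\mathbb R_d^{k_1\times r}\times\mathbb R^{k_1\times(p-r)}\times H_2$, $\Theta=\mathbb R^{k_1}\times\{\mathbb R_d^{k_1\times d}\times\mathbb R_d^{d\times r}\}\times\mathbb R^{k_1\times(p-r)}\times H_2$, and $g:\Theta\to\Xi^{\mathrm{res}}$, $g(\overline\eta_1,(S,R),\beta_2,\overline\eta_2)=(\overline\eta_1,SR,\beta_2,\overline\eta_2)$. $\nabla g$ is the Jacobian matrix and $A^\dagger$ denotes a generalised inverse of $A$. Regularity conditions: (R1) for every $\xi\in\Xi$ with $\beta\ne0$ and every $c\in\mathbb R^k$, $\mathrm{pr}(F(X)\xi=c)<1$;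 and for every compact $\mathcal K\subset\Xi$: (R2) $\mathrm E\|T(Y)^TF(X)\|<\infty$ and $\mathrm E[\sup_{\xi\in\mathcal K}|\psi(F(X)\xi)|]<\infty$; (R3) $\mathrm E\|T(Y)^TF(X)\|^2<\infty$ and $\mathrm E[\sup_{\xi\in\mathcal K}\|\nabla\psi(F(X)\xi)F(X)\|^2]<\infty$; (R4) $\mathrm E[\sup_{\xi\in\mathcal K}\|F(X)^T\nabla^2\psi(F(X)\xi)F(X)\|]<\infty$. *)

theory Defs
  imports "HOL-Probability.Probability"
begin

section \<open>Convergence in probability, asymptotic normality, M-estimators\<close>

definition conv_in_prob :: "'w measure \<Rightarrow> (nat \<Rightarrow> 'w \<Rightarrow> 'a::metric_space) \<Rightarrow> 'a \<Rightarrow> bool" where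
  "conv_in_prob M V c \<longleftrightarrow>
     (\<forall>\<epsilon>>0. (\<lambda>n. measure M {\<omega> \<in> space M. dist (V n \<omega>) c > \<epsilon>}) \<longlonglongrightarrow> 0)"

definition conv_in_distr ::
    "'w measure \<Rightarrow> (nat \<Rightarrow> 'w \<Rightarrow> 'a::topological_space) \<Rightarrow> 'a measure \<Rightarrow> bool" where
  "conv_in_distr M V \<mu> \<longleftrightarrow>
     (\<forall>f :: 'a \<Rightarrow> real. continuous_on UNIV f \<and> bounded (range f) \<longrightarrow>
        (\<lambda>n. \<integral>\<omega>. f (V n \<omega>) \<partial>M) \<longlonglongrightarrow> (\<integral>v. f v \<partial>\<mu>))"

text \<open>The normal law is given by its characteristic function, since the covariance matrix may be
  singular.\<close>

definition multivariate_normal :: "(real^'n) measure \<Rightarrow> real^'n \<Rightarrow> real^'n^'n \<Rightarrow> bool" where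
  "multivariate_normal \<mu> m S \<longleftrightarrow>
     prob_space \<mu> \<and> sets \<mu> = sets borel \<and> transpose S = S \<and>
     (\<forall>t. (CLINT v|\<mu>. iexp (t \<bullet> v)) = iexp (t \<bullet> m) * of_real (exp (- (t \<bullet> (S *v t)) / 2)))"

definition asymptotically_normal ::
    "'w measure \<Rightarrow> (nat \<Rightarrow> 'w \<Rightarrow> real^'n) \<Rightarrow> real^'n \<Rightarrow> real^'n^'n \<Rightarrow> bool" where
  "asymptotically_normal M V m S \<longleftrightarrow> (\<exists>\<mu>. multivariate_normal \<mu> m S \<and> conv_in_distr M V \<mu>)"

text \<open>\<open>A\<^sub>n = o\<^sub>p(a\<^sub>n)\<close> for extended-real random variables.\<close>

definition small_o_p :: "'w measure \<Rightarrow> (nat \<Rightarrow> 'w \<Rightarrow> ereal) \<Rightarrow> (nat \<Rightarrow> real) \<Rightarrow> bool" where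
  "small_o_p M A a \<longleftrightarrow> (\<forall>n. A n \<in> borel_measurable M) \<and>
     (\<forall>\<epsilon>>0. (\<lambda>n. measure M {\<omega> \<in> space M. \<bar>A n \<omega>\<bar> > ereal (\<epsilon> * a n)}) \<longlonglongrightarrow> 0)"

definition sample :: "nat \<Rightarrow> (nat \<Rightarrow> 'w \<Rightarrow> 'z) \<Rightarrow> 'w \<Rightarrow> nat \<Rightarrow> 'z" where
  "sample n Z \<omega> = (\<lambda>i\<in>{..<n}. Z i \<omega>)"

text \<open>An estimator is a measurable function of the first \<open>n\<close> observations with values in \<open>\<Xi>'\<close>.
  The remainder \<open>A\<^sub>n\<close> is extended-real and stands on the right-hand side: the supremum of the
  criterion may be infinite for some samples (e.g. small ones), where the inequality
  \<open>M\<^sub>n(\<xi>\<^sub>n) \<ge> sup M\<^sub>n - A\<^sub>n\<close> forces \<open>A\<^sub>n = \<infinity>\<close>.  That \<open>A\<^sub>n\<close> is \<open>o\<^sub>p\<close> then requires such samples to have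
  vanishing probability.\<close>

definition M_estimator ::
    "'w measure \<Rightarrow> (nat \<Rightarrow> 'w \<Rightarrow> 'z::topological_space) \<Rightarrow>
     (nat \<Rightarrow> 'x::topological_space \<Rightarrow> (nat \<Rightarrow> 'z) \<Rightarrow> real) \<Rightarrow> 'x set \<Rightarrow> (nat \<Rightarrow> real) \<Rightarrow>
     (nat \<Rightarrow> (nat \<Rightarrow> 'z) \<Rightarrow> 'x) \<Rightarrow> bool" where
  "M_estimator M Z Mn \<Xi>' a est \<longleftrightarrow>
     (\<forall>n. est n \<in> PiM {..<n} (\<lambda>_. borel) \<rightarrow>\<^sub>M restrict_space borel \<Xi>') \<and>
     (\<exists>A. small_o_p M A a \<and>
        (\<forall>n. \<forall>\<omega>\<in>space M.
           (SUP \<xi>\<in>\<Xi>'. ereal (Mn n \<xi> (sample n Z \<omega>)))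
             \<le> ereal (Mn n (est n (sample n Z \<omega>)) (sample n Z \<omega>)) + A n \<omega>))"

definition weak_M_estimator where
  "weak_M_estimator M Z Mn \<Xi>' est \<longleftrightarrow> M_estimator M Z Mn \<Xi>' (\<lambda>n. 1) est"

definition strong_M_estimator where
  "strong_M_estimator M Z Mn \<Xi>' est \<longleftrightarrow> M_estimator M Z Mn \<Xi>' (\<lambda>n. 1 / real n) est"


section \<open>Calculus and matrices\<close>

primrec C_k_on :: "nat \<Rightarrow> ('a::real_normed_vector \<Rightarrow> real) \<Rightarrow> 'a set \<Rightarrow> bool" where
  "C_k_on 0 f S \<longleftrightarrow> continuous_on S f"
| "C_k_on (Suc n) f S \<longleftrightarrow>
     (\<forall>x\<in>S. f differentiable (at x)) \<and> (\<forall>v. C_k_on n (\<lambda>x. frechet_derivative f (at x) v) S)"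

definition strictly_convex_on :: "'a::real_vector set \<Rightarrow> ('a \<Rightarrow> real) \<Rightarrow> bool" where
  "strictly_convex_on S f \<longleftrightarrow> convex S \<and>
     (\<forall>x\<in>S. \<forall>y\<in>S. \<forall>t. x \<noteq> y \<and> 0 < t \<and> t < 1 \<longrightarrow>
        f ((1 - t) *\<^sub>R x + t *\<^sub>R y) < (1 - t) * f x + t * f y)"

definition grad :: "(real^'n \<Rightarrow> real) \<Rightarrow> real^'n \<Rightarrow> real^'n" where
  "grad f x = (\<chi> i. frechet_derivative f (at x) (axis i 1))"

definition hessian :: "(real^'n \<Rightarrow> real) \<Rightarrow> real^'n \<Rightarrow> real^'n^'n" where
  "hessian f x = jacobian (grad f) (at x)"

definition generalised_inverse :: "real^'n^'m \<Rightarrow> real^'m^'n \<Rightarrow> bool" where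
  "generalised_inverse A G \<longleftrightarrow> A ** G ** A = A"


section \<open>Parameters\<close>

text \<open>
  Since types are nonempty, the blocks that may be empty (\<open>k\<^sub>2 = 0\<close> or \<open>r = p\<close>) cannot have index
  types of their own.  The partitions are therefore given by injections between the index types:

  \<^item> \<open>\<kappa> :: 'k1 \<Rightarrow> 'k\<close> selects the first \<open>k\<^sub>1\<close> of the \<open>k\<close> natural parameters, so
    \<open>\<eta>\<^sub>1\<close> consists of the coordinates in \<open>range \<kappa>\<close> and \<open>\<eta>\<^sub>2\<close> of the remaining ones;
  \<^item> \<open>\<rho> :: 'r \<Rightarrow> 'p\<close> selects the \<open>r\<close> components of \<open>x\<close> that form \<open>x\<^sub>1\<close>, so \<open>\<beta>\<^sub>1\<close> consists of the
    columns of \<open>\<beta>\<close> in \<open>range \<rho>\<close> and \<open>\<beta>\<^sub>2\<close> of the remaining ones.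

  For instance \<open>'k = 'k1 + 'k2\<close> with \<open>\<kappa> = Inl\<close>, or \<open>'k = 'k1\<close> with \<open>\<kappa> = id\<close> when \<open>k\<^sub>2 = 0\<close>.
  A subvector of coordinates outside \<open>range \<kappa>\<close> is represented by the vector of \<open>\<real>\<^sup>k\<close> that vanishes
  on \<open>range \<kappa>\<close>.

  The column vector \<open>\<xi>\<close> has index type \<open>'k + 'k1 \<times> 'p\<close>: the \<open>Inl\<close> coordinates are
  \<open>(\<eta>\<^sub>1, \<eta>\<^sub>2)\<close>, the \<open>Inr\<close> coordinates are \<open>vec \<beta>\<close>; the order of the coordinates is immaterial.
\<close>

type_synonym ('k, 'k1, 'p) param = "real ^ ('k + 'k1 \<times> 'p)"

definition eta_bar :: "('k::finite, 'k1::finite, 'p::finite) param \<Rightarrow> real^'k" where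
  "eta_bar \<xi> = (\<chi> i. \<xi> $ Inl i)"

definition beta :: "('k::finite, 'k1::finite, 'p::finite) param \<Rightarrow> real^'p^'k1" where
  "beta \<xi> = (\<chi> a l. \<xi> $ Inr (a, l))"

definition beta1 :: "('r \<Rightarrow> 'p) \<Rightarrow> ('k::finite, 'k1::finite, 'p::finite) param \<Rightarrow> real^'r^'k1" where
  "beta1 \<rho> \<xi> = (\<chi> a j. beta \<xi> $ a $ \<rho> j)"

definition second_part :: "('k1 \<Rightarrow> 'k) \<Rightarrow> real^'k \<Rightarrow> real^'k" where
  "second_part \<kappa> \<eta> = (\<chi> i. if i \<in> range \<kappa> then 0 else \<eta> $ i)"

text \<open>\<open>\<eta>\<^sub>x\<close>: the vector \<open>\<beta> x = \<beta>\<^sub>1 x\<^sub>1 + \<beta>\<^sub>2 x\<^sub>2\<close> is added to \<open>\<eta>\<^sub>1\<close>.\<close>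

definition eta_at ::
    "('k1 \<Rightarrow> 'k) \<Rightarrow> ('k::finite, 'k1::finite, 'p::finite) param \<Rightarrow> real^'p \<Rightarrow> real^'k" where
  "eta_at \<kappa> \<xi> x =
     (\<chi> i. eta_bar \<xi> $ i + (if i \<in> range \<kappa> then (beta \<xi> *v x) $ inv \<kappa> i else 0))"

definition F_mat :: "('k1::finite \<Rightarrow> 'k::finite) \<Rightarrow> real^'p::finite \<Rightarrow> real ^ ('k + 'k1 \<times> 'p) ^ 'k" where
  "F_mat \<kappa> x = (\<chi> i c. case c of Inl i' \<Rightarrow> if i = i' then 1 else 0
                             | Inr (a, l) \<Rightarrow> if i = \<kappa> a then x $ l else 0)"

definition Xi :: "('k1 \<Rightarrow> 'k) \<Rightarrow> (real^'k) set \<Rightarrow> ('k::finite, 'k1::finite, 'p::finite) param set" where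
  "Xi \<kappa> H2 = {\<xi>. second_part \<kappa> (eta_bar \<xi>) \<in> H2}"

definition Xi_res :: "('k1 \<Rightarrow> 'k) \<Rightarrow> (real^'k) set \<Rightarrow> ('r::finite \<Rightarrow> 'p) \<Rightarrow> nat \<Rightarrow>
    ('k::finite, 'k1::finite, 'p::finite) param set" where
  "Xi_res \<kappa> H2 \<rho> d = {\<xi> \<in> Xi \<kappa> H2. rank (beta1 \<rho> \<xi>) = d}"

text \<open>
  Coordinates of \<open>\<theta>\<close>, in order: \<open>(\<eta>\<^sub>1, \<eta>\<^sub>2)\<close>, \<open>S\<close>, \<open>R\<close>, and \<open>\<beta>\<^sub>2\<close> as a \<open>k\<^sub>1 \<times> p\<close> matrix whose columns
  in \<open>range \<rho>\<close> are zero on \<open>\<Theta>\<close> and ignored by \<open>g\<close>.  These dummy coordinates only add zero columns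
  to the Jacobian \<open>D\<close> of \<open>g\<close>, and the set of matrices \<open>D (D\<^sup>T A D)\<^sup>- D\<^sup>T\<close>, with \<open>-\<close> ranging over the
  generalised inverses, does not depend on zero columns of \<open>D\<close>.
\<close>

type_synonym ('k, 'k1, 'd, 'r, 'p) theta =
  "real ^ ('k + ('k1 \<times> 'd) + ('d \<times> 'r) + ('k1 \<times> 'p))"

definition theta_eta ::
    "('k::finite, 'k1::finite, 'd::finite, 'r::finite, 'p::finite) theta \<Rightarrow> real^'k" where
  "theta_eta \<theta> = (\<chi> i. \<theta> $ Inl i)"

definition theta_S ::
    "('k::finite, 'k1::finite, 'd::finite, 'r::finite, 'p::finite) theta \<Rightarrow> real^'d^'k1" where
  "theta_S \<theta> = (\<chi> a u. \<theta> $ Inr (Inl (a, u)))"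

definition theta_R ::
    "('k::finite, 'k1::finite, 'd::finite, 'r::finite, 'p::finite) theta \<Rightarrow> real^'r^'d" where
  "theta_R \<theta> = (\<chi> u j. \<theta> $ Inr (Inr (Inl (u, j))))"

definition theta_beta2 ::
    "('k::finite, 'k1::finite, 'd::finite, 'r::finite, 'p::finite) theta \<Rightarrow> real^'p^'k1" where
  "theta_beta2 \<theta> = (\<chi> a l. \<theta> $ Inr (Inr (Inr (a, l))))"

definition Theta :: "('k1 \<Rightarrow> 'k) \<Rightarrow> (real^'k) set \<Rightarrow> ('r \<Rightarrow> 'p) \<Rightarrow>
    ('k::finite, 'k1::finite, 'd::finite, 'r::finite, 'p::finite) theta set" where
  "Theta \<kappa> H2 \<rho> = {\<theta>. second_part \<kappa> (theta_eta \<theta>) \<in> H2 \<and>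
     rank (theta_S \<theta>) = CARD('d) \<and> rank (theta_R \<theta>) = CARD('d) \<and>
     (\<forall>a. \<forall>l\<in>range \<rho>. theta_beta2 \<theta> $ a $ l = 0)}"

definition g_map :: "('r \<Rightarrow> 'p) \<Rightarrow>
    ('k::finite, 'k1::finite, 'd::finite, 'r::finite, 'p::finite) theta \<Rightarrow> ('k, 'k1, 'p) param" where
  "g_map \<rho> \<theta> = (\<chi> c. case c of
      Inl i \<Rightarrow> theta_eta \<theta> $ i
    | Inr (a, l) \<Rightarrow> if l \<in> range \<rho> then (theta_S \<theta> ** theta_R \<theta>) $ a $ inv \<rho> l
                   else theta_beta2 \<theta> $ a $ l)"

lemma F_mat_mult_param:
  fixes \<kappa> :: "'k1::finite \<Rightarrow> 'k::finite" and \<xi> :: "('k, 'k1, 'p::finite) param"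
  assumes "inj \<kappa>"
  shows "F_mat \<kappa> x *v \<xi> = eta_at \<kappa> \<xi> x"
proof (rule vec_eq_iff[THEN iffD2], rule allI)
  fix i
  have "(F_mat \<kappa> x *v \<xi>) $ i =
      (\<Sum>i'\<in>UNIV. (if i = i' then 1 else 0) * \<xi> $ Inl i') +
      (\<Sum>(a, l)\<in>UNIV. (if i = \<kappa> a then x $ l else 0) * \<xi> $ Inr (a, l))"
    unfolding matrix_vector_mult_def F_mat_def UNIV_Plus_UNIV[symmetric]
    by (subst sum.Plus) (auto intro!: sum.cong simp: case_prod_unfold)
  also have "(\<Sum>i'\<in>UNIV. (if i = i' then 1 else 0) * \<xi> $ Inl i') = eta_bar \<xi> $ i"
    by (simp add: eta_bar_def if_distrib[of "\<lambda>z. z * _"] cong: if_cong)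
  also have "(\<Sum>(a, l)\<in>UNIV. (if i = \<kappa> a then x $ l else 0) * \<xi> $ Inr (a, l)) =
      (\<Sum>a\<in>UNIV. if i = \<kappa> a then (beta \<xi> *v x) $ a else 0)"
    unfolding UNIV_Times_UNIV[symmetric] sum.cartesian_product[symmetric]
    by (intro sum.cong) (auto simp: matrix_vector_mult_def beta_def mult.commute)
  also have "\<dots> = (if i \<in> range \<kappa> then (beta \<xi> *v x) $ inv \<kappa> i else 0)"
  proof (cases "i \<in> range \<kappa>")
    case True
    then obtain a where a: "i = \<kappa> a" by auto
    then have "\<And>b. (i = \<kappa> b) = (b = a)" using assms by (auto dest: injD)
    then show ?thesis using a assms by simp
  qed (auto intro!: sum.neutral)
  finally show "(F_mat \<kappa> x *v \<xi>) $ i = eta_at \<kappa> \<xi> x $ i" by (simp add: eta_at_def)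
qed

lemma beta1_g_map:
  fixes \<theta> :: "('k::finite, 'k1::finite, 'd::finite, 'r::finite, 'p::finite) theta"
  assumes "inj \<rho>"
  shows "beta1 \<rho> (g_map \<rho> \<theta>) = theta_S \<theta> ** theta_R \<theta>"
  using assms by (simp add: vec_eq_iff beta1_def beta_def g_map_def)


section \<open>The model\<close>

text \<open>\<open>dy\<close>: Lebesgue measure, or counting measure on a countable set.\<close>

definition base_measure :: "(real^'q) measure \<Rightarrow> bool" where
  "base_measure \<nu> \<longleftrightarrow> \<nu> = lborel \<or> (\<exists>D. countable D \<and> \<nu> = distr (count_space D) borel (\<lambda>y. y))"

definition ef_density ::
    "(real^'q \<Rightarrow> real^'k) \<Rightarrow> (real^'q \<Rightarrow> real) \<Rightarrow> (real^'k \<Rightarrow> real) \<Rightarrow> real^'k \<Rightarrow> real^'q \<Rightarrow> real" where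
  "ef_density T h \<psi> \<eta> y = exp (\<eta> \<bullet> T y - \<psi> \<eta>) * h y"

definition natural_parameter_space ::
    "(real^'q) measure \<Rightarrow> (real^'q \<Rightarrow> real^'k) \<Rightarrow> (real^'q \<Rightarrow> real) \<Rightarrow> (real^'k) set" where
  "natural_parameter_space \<nu> T h = {\<eta>. (\<integral>\<^sup>+y. ennreal (exp (\<eta> \<bullet> T y) * h y) \<partial>\<nu>) < \<infinity>}"

definition covariance_matrix :: "'w measure \<Rightarrow> ('w \<Rightarrow> real^'k) \<Rightarrow> real^'k^'k" where
  "covariance_matrix P V =
     (\<chi> i j. \<integral>\<omega>. (V \<omega> $ i - integral\<^sup>L P V $ i) * (V \<omega> $ j - integral\<^sup>L P V $ j) \<partial>P)"

locale exponential_family =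
  fixes \<nu> :: "(real^'q) measure"
    and T :: "real^'q \<Rightarrow> real^'k"
    and h :: "real^'q \<Rightarrow> real"
    and \<psi> :: "real^'k \<Rightarrow> real"
    and \<kappa> :: "'k1::finite \<Rightarrow> 'k"
    and H2 :: "(real^'k) set"
  assumes base: "base_measure \<nu>"
    and T_measurable: "T \<in> borel_measurable borel"
    and h_measurable: "h \<in> borel_measurable borel"
    and h_nonneg: "\<And>y. 0 \<le> h y"
    and inj_kappa: "inj \<kappa>"
    and H2_open: "openin (top_of_set (range (second_part \<kappa>))) H2"
    and H2_convex: "convex H2"
    and natural_parameter_space_eq: "natural_parameter_space \<nu> T h = {\<eta>. second_part \<kappa> \<eta> \<in> H2}"
    and normalised: "\<And>\<eta>. \<eta> \<in> natural_parameter_space \<nu> T h \<Longrightarrow>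
          (\<integral>\<^sup>+y. ennreal (ef_density T h \<psi> \<eta> y) \<partial>\<nu>) = 1"
    and psi_strictly_convex: "strictly_convex_on (natural_parameter_space \<nu> T h) \<psi>"
    and psi_smooth: "\<And>n. C_k_on n \<psi> (natural_parameter_space \<nu> T h)"
    and T_square_integrable: "\<And>\<eta>. \<eta> \<in> natural_parameter_space \<nu> T h \<Longrightarrow>
          integrable (density \<nu> (\<lambda>y. ennreal (ef_density T h \<psi> \<eta> y))) (\<lambda>y. (norm (T y))\<^sup>2)"
    and grad_psi: "\<And>\<eta>. \<eta> \<in> natural_parameter_space \<nu> T h \<Longrightarrow>
          grad \<psi> \<eta> = integral\<^sup>L (density \<nu> (\<lambda>y. ennreal (ef_density T h \<psi> \<eta> y))) T"
    and hessian_psi: "\<And>\<eta>. \<eta> \<in> natural_parameter_space \<nu> T h \<Longrightarrow>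
          hessian \<psi> \<eta> = covariance_matrix (density \<nu> (\<lambda>y. ennreal (ef_density T h \<psi> \<eta> y))) T"
    and hessian_psi_nonsingular: "\<And>\<eta>. \<eta> \<in> natural_parameter_space \<nu> T h \<Longrightarrow>
          invertible (hessian \<psi> \<eta>)"

text \<open>That \<open>Y\<close> given \<open>X = x\<close> has density \<open>f\<close> at \<open>\<eta>\<^sub>x\<close> means that this function of \<open>(x, y)\<close> is the
  joint density of \<open>(X, Y)\<close> with respect to the product of the law of \<open>X\<close> and \<open>\<nu>\<close>.\<close>

locale partial_rr_mglm = prob_space M + exponential_family \<nu> T h \<psi> \<kappa> H2
  for M :: "'w measure"
    and \<nu> :: "(real^'q) measure"
    and T :: "real^'q \<Rightarrow> real^'k"
    and h :: "real^'q \<Rightarrow> real"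
    and \<psi> :: "real^'k \<Rightarrow> real"
    and \<kappa> :: "'k1::finite \<Rightarrow> 'k"
    and H2 :: "(real^'k) set" +
  fixes \<rho> :: "'r::finite \<Rightarrow> 'p::finite"
    and d :: nat
    and \<xi>\<^sub>0 :: "('k, 'k1, 'p) param"
    and X :: "'w \<Rightarrow> real^'p"
    and Y :: "'w \<Rightarrow> real^'q"
  assumes inj_rho: "inj \<rho>"
    and d_bounds: "1 \<le> d" "d \<le> min CARD('k1) CARD('r)"
    and true_parameter: "\<xi>\<^sub>0 \<in> Xi_res \<kappa> H2 \<rho> d"
    and X_measurable: "X \<in> borel_measurable M"
    and Y_measurable: "Y \<in> borel_measurable M"
    and conditional_density:
      "distributed M (distr M borel X \<Otimes>\<^sub>M \<nu>) (\<lambda>\<omega>. (X \<omega>, Y \<omega>))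
         (\<lambda>(x, y). ennreal (ef_density T h \<psi> (eta_at \<kappa> \<xi>\<^sub>0 x) y))"

definition R1 ::
    "'w measure \<Rightarrow> ('k1::finite \<Rightarrow> 'k) \<Rightarrow> (real^'k::finite) set \<Rightarrow> ('w \<Rightarrow> real^'p::finite) \<Rightarrow> bool" where
  "R1 M \<kappa> H2 X \<longleftrightarrow>
     (\<forall>\<xi> :: ('k, 'k1, 'p) param. \<xi> \<in> Xi \<kappa> H2 \<and> beta \<xi> \<noteq> 0 \<longrightarrow>
        (\<forall>c. measure M {\<omega> \<in> space M. F_mat \<kappa> (X \<omega>) *v \<xi> = c} < 1))"

definition R2 :: "'w measure \<Rightarrow> (real^'q \<Rightarrow> real^'k::finite) \<Rightarrow> (real^'k \<Rightarrow> real) \<Rightarrow> ('k1 \<Rightarrow> 'k) \<Rightarrow>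
    ('w \<Rightarrow> real^'p::finite) \<Rightarrow> ('w \<Rightarrow> real^'q) \<Rightarrow> ('k, 'k1::finite, 'p) param set \<Rightarrow> bool" where
  "R2 M T \<psi> \<kappa> X Y K \<longleftrightarrow>
     (\<integral>\<^sup>+\<omega>. ennreal (norm (T (Y \<omega>) v* F_mat \<kappa> (X \<omega>))) \<partial>M) < \<infinity> \<and>
     (\<integral>\<^sup>+\<omega>. (SUP \<xi>\<in>K. ennreal \<bar>\<psi> (F_mat \<kappa> (X \<omega>) *v \<xi>)\<bar>) \<partial>M) < \<infinity>"

definition R3 :: "'w measure \<Rightarrow> (real^'q \<Rightarrow> real^'k::finite) \<Rightarrow> (real^'k \<Rightarrow> real) \<Rightarrow> ('k1 \<Rightarrow> 'k) \<Rightarrow>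
    ('w \<Rightarrow> real^'p::finite) \<Rightarrow> ('w \<Rightarrow> real^'q) \<Rightarrow> ('k, 'k1::finite, 'p) param set \<Rightarrow> bool" where
  "R3 M T \<psi> \<kappa> X Y K \<longleftrightarrow>
     (\<integral>\<^sup>+\<omega>. ennreal ((norm (T (Y \<omega>) v* F_mat \<kappa> (X \<omega>)))\<^sup>2) \<partial>M) < \<infinity> \<and>
     (\<integral>\<^sup>+\<omega>. (SUP \<xi>\<in>K. ennreal ((norm (grad \<psi> (F_mat \<kappa> (X \<omega>) *v \<xi>) v* F_mat \<kappa> (X \<omega>)))\<^sup>2)) \<partial>M) < \<infinity>"

definition R4 :: "'w measure \<Rightarrow> (real^'k::finite \<Rightarrow> real) \<Rightarrow> ('k1 \<Rightarrow> 'k) \<Rightarrow>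
    ('w \<Rightarrow> real^'p::finite) \<Rightarrow> ('k, 'k1::finite, 'p) param set \<Rightarrow> bool" where
  "R4 M \<psi> \<kappa> X K \<longleftrightarrow>
     (\<integral>\<^sup>+\<omega>. (SUP \<xi>\<in>K. ennreal (norm
        (transpose (F_mat \<kappa> (X \<omega>)) ** hessian \<psi> (F_mat \<kappa> (X \<omega>) *v \<xi>) ** F_mat \<kappa> (X \<omega>)))) \<partial>M) < \<infinity>"

definition m_crit :: "(real^'q \<Rightarrow> real^'k::finite) \<Rightarrow> (real^'k \<Rightarrow> real) \<Rightarrow> ('k1 \<Rightarrow> 'k) \<Rightarrow>
    ('k, 'k1::finite, 'p::finite) param \<Rightarrow> (real^'p) \<times> (real^'q) \<Rightarrow> real" where
  "m_crit T \<psi> \<kappa> \<xi> = (\<lambda>(x, y). (T y v* F_mat \<kappa> x) \<bullet> \<xi> - \<psi> (F_mat \<kappa> x *v \<xi>))"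

definition M_crit :: "(real^'q \<Rightarrow> real^'k::finite) \<Rightarrow> (real^'k \<Rightarrow> real) \<Rightarrow> ('k1 \<Rightarrow> 'k) \<Rightarrow>
    nat \<Rightarrow> ('k, 'k1::finite, 'p::finite) param \<Rightarrow> (nat \<Rightarrow> (real^'p) \<times> (real^'q)) \<Rightarrow> real" where
  "M_crit T \<psi> \<kappa> n \<xi> z = 1 / real n * (\<Sum>i<n. m_crit T \<psi> \<kappa> \<xi> (z i))"

definition W_inv :: "'w measure \<Rightarrow> (real^'k::finite \<Rightarrow> real) \<Rightarrow> ('k1 \<Rightarrow> 'k) \<Rightarrow>
    ('w \<Rightarrow> real^'p::finite) \<Rightarrow> ('k, 'k1::finite, 'p) param \<Rightarrow>
    real ^ ('k + 'k1 \<times> 'p) ^ ('k + 'k1 \<times> 'p)" where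
  "W_inv M \<psi> \<kappa> X \<xi> = integral\<^sup>L M (\<lambda>\<omega>.
     transpose (F_mat \<kappa> (X \<omega>)) ** hessian \<psi> (F_mat \<kappa> (X \<omega>) *v \<xi>) ** F_mat \<kappa> (X \<omega>))"

text \<open>\<open>D (D\<^sup>T A D)\<^sup>- D\<^sup>T A\<close>, where \<open>G\<close> is the chosen generalised inverse of \<open>D\<^sup>T A D\<close>.\<close>

definition projection_matrix :: "real^'t^'n \<Rightarrow> real^'t^'t \<Rightarrow> real^'n^'n \<Rightarrow> real^'n^'n" where
  "projection_matrix D G A = D ** G ** transpose D ** A"

end

theory Submission
  imports Defs
begin

text \<open>
  The criterion is concave in the parameter, since \<open>\<psi>\<close> is convex and the natural parameter is linear
  in \<open>\<xi>\<close>.  Let \<open>A\<close> be the information matrix \<open>W_inv\<close> at \<open>\<xi>\<^sub>0\<close> and \<open>G\<^sub>n\<close> the sum of the scores of the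
  observations at \<open>\<xi>\<^sub>0\<close> divided by \<open>\<surd>n\<close>.  The Taylor expansion of \<open>\<psi>\<close> at \<open>\<xi>\<^sub>0\<close>, the weak law of large
  numbers for the information matrices of the observations, and the fact that their oscillation over
  small balls is small in mean (\<open>small_oscillation_in_mean\<close>) yield
  \<open>M\<^sub>n \<xi> - M\<^sub>n \<xi>\<^sub>0 = (\<xi> - \<xi>\<^sub>0) \<bullet> G\<^sub>n / \<surd>n - (\<xi> - \<xi>\<^sub>0) \<bullet> A (\<xi> - \<xi>\<^sub>0) / 2\<close>, up to an error of at most
  \<open>\<delta> \<parallel>\<xi> - \<xi>\<^sub>0\<parallel>\<^sup>2\<close> on a small ball, with probability tending to one (\<open>criterion_expansion\<close>).
  The matrix \<open>A\<close> is positive definite by identifiability, and the score has mean zero and covariance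
  \<open>A\<close>, because \<open>\<nabla>\<psi>\<close> and \<open>\<nabla>\<^sup>2\<psi>\<close> are the mean and the covariance of \<open>T\<close>.

  Existence and consistency do not use the rank constraint.  On a small sphere around \<open>\<xi>\<^sub>0\<close> the criterion lies
  below its value at \<open>\<xi>\<^sub>0\<close> by a fixed amount, and concavity extends this to everything outside the
  sphere (\<open>well_separated\<close>).  Hence the criterion is bounded above with probability tending to one,
  so that near-maximisers over a subset exist (\<open>strong_M_estimator_exists\<close>), and near-maximisers over
  any subset containing \<open>\<xi>\<^sub>0\<close> converge to \<open>\<xi>\<^sub>0\<close> in probability (\<open>consistent\<close>).

  The rank constraint enters the limit law through its tangent space.  Write \<open>D\<close> for the Jacobian of \<open>g\<close>
  at \<open>\<theta>\<^sub>0\<close>.  As \<open>g\<close> is the sum of an affine and a quadratic map and has a local Lipschitz section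
  (\<open>g_map_Lipschitz_section\<close>), the constraint set and \<open>\<xi>\<^sub>0 + range D\<close> agree to second order at \<open>\<xi>\<^sub>0\<close>.
  The rescaled estimator therefore maximises \<open>u \<bullet> G\<^sub>n - u \<bullet> A u / 2\<close> over the range of \<open>D\<close> up to
  \<open>o\<^sub>p(1)\<close>, so that \<open>\<surd>n (\<xi>\<^sub>n - \<xi>\<^sub>0) = B G\<^sub>n + o\<^sub>p(1)\<close> with \<open>B = D (D\<^sup>T A D)\<^sup>- D\<^sup>T\<close>
  (\<open>near_maximiser_linear\<close>, \<open>asymptotically_linear\<close>).  Whatever the generalised inverse, \<open>B\<close> is symmetric
  and \<open>B A B = B\<close> (\<open>generalised_inverse_projection\<close>), which makes \<open>B\<close> the limiting covariance; and
  \<open>B = \<Pi> W\<close> for the projection \<open>\<Pi> = B A\<close> of the statement.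

  The central limit theorem for the real variables \<open>t \<bullet> G\<^sub>n\<close> gives the limit of the
  characteristic functions, and these determine weak convergence in several dimensions
  (\<open>conv_in_distr_by_characteristic_functions\<close>).
\<close>

section \<open>Matrices\<close>

lemma matrix_add_mult_distrib: "(A + B) ** C = A ** C + B ** (C :: real^'c^'b)" for A B :: "real^'b^'a"
  by (simp add: vec_eq_iff matrix_matrix_mult_def distrib_right sum.distrib)

lemma bounded_bilinear_matrix_mult:
  "bounded_bilinear (\<lambda>(A :: real^'b^'a) (B :: real^'c^'b). A ** B)"
proof -
  have "bilinear (\<lambda>(A :: real^'b^'a) (B :: real^'c^'b). A ** B)"
    unfolding bilinear_def
    by (auto intro!: linearI simp: matrix_add_ldistrib matrix_add_mult_distrib vec_eq_iff
        matrix_matrix_mult_def sum_distrib_left algebra_simps sum.distrib)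
  then show ?thesis by (simp add: bilinear_conv_bounded_bilinear)
qed

lemma continuous_on_matrix_mult [continuous_intros]:
  fixes f :: "'z::topological_space \<Rightarrow> real^'b^'a" and h :: "'z \<Rightarrow> real^'c^'b"
  shows "continuous_on S f \<Longrightarrow> continuous_on S h \<Longrightarrow> continuous_on S (\<lambda>x. f x ** h x)"
  by (rule bounded_bilinear.continuous_on[OF bounded_bilinear_matrix_mult])

lemma linear_eq_sum_axis:
  fixes f :: "real^'n \<Rightarrow> real"
  assumes "linear f"
  shows "f v = (\<chi> i. f (axis i 1)) \<bullet> v"
proof -
  interpret linear f by fact
  have "f v = f (\<Sum>i\<in>UNIV. (v $ i) *\<^sub>R axis i 1)"
    using arg_cong[OF basis_expansion[of v], of f] by (simp add: scalar_mult_eq_scaleR)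
  also have "\<dots> = (\<chi> i. f (axis i 1)) \<bullet> v" by (simp add: sum scale inner_vec_def mult.commute)
  finally show ?thesis .
qed

lemma continuous_on_matrix_vector_mult [continuous_intros]:
  fixes f :: "'z::topological_space \<Rightarrow> real^'n^'m" and h :: "'z \<Rightarrow> real^'n"
  shows "continuous_on S f \<Longrightarrow> continuous_on S h \<Longrightarrow> continuous_on S (\<lambda>x. f x *v h x)"
  unfolding matrix_vector_mult_def by (intro continuous_intros continuous_on_vec_lambda)

lemma continuous_on_vector_matrix_mult [continuous_intros]:
  fixes f :: "'z::topological_space \<Rightarrow> real^'n^'m" and h :: "'z \<Rightarrow> real^'m"
  shows "continuous_on S f \<Longrightarrow> continuous_on S h \<Longrightarrow> continuous_on S (\<lambda>x. h x v* f x)"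
  unfolding vector_matrix_mult_def by (intro continuous_intros continuous_on_vec_lambda)

lemma continuous_on_transpose [continuous_intros]:
  fixes f :: "'z::topological_space \<Rightarrow> real^'n^'m"
  shows "continuous_on S f \<Longrightarrow> continuous_on S (\<lambda>x. transpose (f x))"
  unfolding transpose_def by (intro continuous_intros continuous_on_vec_lambda)

lemma bounded_linear_matrix_form: "bounded_linear (\<lambda>B :: real^'n^'m. u \<bullet> (B *v v))"
  by (intro linear_conv_bounded_linear[THEN iffD1] linearI)
    (simp_all add: matrix_vector_mult_add_rdistrib inner_add_right flip: scaleR_matrix_vector_assoc)

lemma matrix_eq_by_forms:
  assumes "\<And>u v. u \<bullet> (A *v v) = u \<bullet> (B *v v)" shows "A = (B :: real^'n^'m)"
proof -
  have "A *v v = B *v v" for v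
  proof -
    have "(A *v v - B *v v) \<bullet> (A *v v - B *v v) = 0"
      unfolding inner_diff_right[of "A *v v - B *v v"] assms by simp
    then show ?thesis by simp
  qed
  then show ?thesis by (simp add: matrix_eq)
qed

lemma matrix_form_bound:
  obtains K where "K > 0" "\<And>(B :: real^'n^'m) u v. \<bar>u \<bullet> (B *v v)\<bar> \<le> K * norm B * (norm u * norm v)"
proof -
  have "bilinear (\<lambda>(B :: real^'n^'m) (v :: real^'n). B *v v)"
    unfolding bilinear_def
    by (auto intro!: linearI simp: matrix_vector_mult_add_rdistrib matrix_vector_right_distrib
        matrix_vector_mult_scaleR scaleR_matrix_vector_assoc)
  then have "bounded_bilinear (\<lambda>(B :: real^'n^'m) (v :: real^'n). B *v v)"
    by (simp add: bilinear_conv_bounded_bilinear)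
  then obtain K where K: "K > 0" "\<And>(B :: real^'n^'m) v. norm (B *v v) \<le> norm B * norm v * K"
    using bounded_bilinear.pos_bounded by blast
  have "\<bar>u \<bullet> (B *v v)\<bar> \<le> K * norm B * (norm u * norm v)" for B :: "real^'n^'m" and u v
  proof -
    have "\<bar>u \<bullet> (B *v v)\<bar> \<le> norm u * norm (B *v v)" by (rule Cauchy_Schwarz_ineq2)
    also have "\<dots> \<le> norm u * (norm B * norm v * K)" by (intro mult_left_mono K) simp
    finally show ?thesis by (simp add: mult_ac)
  qed
  then show ?thesis using K(1) that by blast
qed

text \<open>The model together with an infinite sample \<open>Z\<close> of independent copies of \<open>(X, Y)\<close>, under
  identifiability and moment conditions.\<close>

subsection \<open>Positive definite forms and generalised inverses\<close>

text \<open>For a positive semidefinite form, \<open>v\<^sup>T A v = 0\<close> forces \<open>A v = 0\<close>.\<close>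

lemma psd_form_zero_imp:
  fixes A :: "real^'n^'n"
  assumes sym: "transpose A = A" and psd: "\<And>t. 0 \<le> t \<bullet> (A *v t)" and v: "v \<bullet> (A *v v) = 0"
  shows "A *v v = 0"
proof -
  have symm: "x \<bullet> (A *v y) = y \<bullet> (A *v x)" for x y
    by (metis dot_lmul_matrix inner_commute sym vector_transpose_matrix)
  have "u \<bullet> (A *v v) = 0" for u
  proof (rule ccontr)
    assume *: "u \<bullet> (A *v v) \<noteq> 0"
    have "0 \<le> u \<bullet> (A *v u) + 2 * s * (u \<bullet> (A *v v))" for s
      using psd[of "u + s *\<^sub>R v"] v symm[of u v]
      by (simp add: matrix_vector_right_distrib matrix_vector_mult_scaleR inner_add_left
          inner_add_right algebra_simps)
    from this[of "- (u \<bullet> (A *v u) + 1) / (2 * (u \<bullet> (A *v v)))"] * show False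
      by (simp add: field_simps)
  qed
  then show ?thesis by (metis inner_eq_zero_iff)
qed

lemma pos_def_lower_bound:
  fixes A :: "real^'n^'n"
  assumes pd: "\<And>v. v \<noteq> 0 \<Longrightarrow> 0 < v \<bullet> (A *v v)"
  obtains c where "c > 0" "\<And>v. c * (norm v)\<^sup>2 \<le> v \<bullet> (A *v v)"
proof -
  let ?q = "\<lambda>v. v \<bullet> (A *v v)"
  let ?S = "sphere (0 :: real^'n) 1"
  have "continuous_on ?S ?q" by (intro continuous_intros)
  moreover have "?S \<noteq> {}" "compact ?S" by (auto simp: sphere_eq_empty)
  ultimately obtain u where u: "u \<in> ?S" "\<And>v. v \<in> ?S \<Longrightarrow> ?q u \<le> ?q v"
    using continuous_attains_inf[of ?S ?q] by blast
  have "?q u * (norm v)\<^sup>2 \<le> ?q v" for v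
  proof (cases "v = 0")
    case False
    define w where "w = v /\<^sub>R norm v"
    have "v = norm v *\<^sub>R w" using False by (simp add: w_def)
    then have "?q v = ?q (norm v *\<^sub>R w)" by (rule arg_cong)
    also have "\<dots> = ?q w * (norm v)\<^sup>2"
      by (simp add: matrix_vector_mult_scaleR power2_eq_square)
    finally have "?q v = ?q w * (norm v)\<^sup>2" .
    moreover have "?q u \<le> ?q w" using False by (intro u(2)) (simp add: w_def)
    then have "?q u * (norm v)\<^sup>2 \<le> ?q w * (norm v)\<^sup>2" by (rule mult_right_mono) simp
    ultimately show ?thesis by simp
  qed simp
  moreover have "?q u > 0" using u(1) by (intro pd) auto
  ultimately show ?thesis using that by blast
qed

text \<open>For a positive definite \<open>A\<close>, the matrix \<open>B = D (D\<^sup>T A D)\<^sup>- D\<^sup>T\<close> does not depend on the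
  generalised inverse, since \<open>B A\<close> is the projection onto the range of \<open>D\<close> that is orthogonal for
  the inner product defined by \<open>A\<close>.\<close>

lemma generalised_inverse_projection:
  fixes D :: "real^'t^'n" and A :: "real^'n^'n"
  assumes sym: "transpose A = A" and pd: "\<And>v. v \<noteq> 0 \<Longrightarrow> 0 < v \<bullet> (A *v v)"
    and G: "generalised_inverse (transpose D ** A ** D) G"
  defines "B \<equiv> D ** G ** transpose D"
  shows "B ** A ** D = D" "transpose B = B" "B ** A ** B = B"
proof -
  define N where "N = transpose D ** A ** D"
  have NGN: "N ** G ** N = N" using G by (simp add: generalised_inverse_def N_def)
  have N_sym: "transpose N = N"
    by (simp add: N_def matrix_transpose_mul sym matrix_mul_assoc)
  have "D *v (G *v (N *v v)) = D *v v" for v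
  proof -
    define w where "w = G *v (N *v v) - v"
    have "N *v w = (N ** G ** N) *v v - N *v v"
      by (simp add: w_def matrix_vector_mult_diff_distrib matrix_vector_mul_assoc matrix_mul_assoc)
    then have "N *v w = 0" by (simp add: NGN)
    then have "(D *v w) \<bullet> (A *v (D *v w)) = 0"
    proof -
      have "w \<bullet> (N *v w) = w \<bullet> (transpose D *v (A *v (D *v w)))"
        by (simp add: N_def matrix_vector_mul_assoc matrix_mul_assoc)
      also have "\<dots> = (D *v w) \<bullet> (A *v (D *v w))"
        using dot_lmul_matrix[of "A *v (D *v w)" D w] by (simp add: inner_commute)
      finally show ?thesis using \<open>N *v w = 0\<close> by simp
    qed
    then have "D *v w = 0" using pd by force
    then show ?thesis by (simp add: w_def matrix_vector_mult_diff_distrib)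
  qed
  then have DGN: "D ** G ** N = D"
    by (simp add: matrix_eq matrix_vector_mul_assoc[symmetric])
  then show "B ** A ** D = D" by (simp add: B_def N_def matrix_mul_assoc)
  from DGN have "transpose (D ** G ** N) = transpose D" by simp
  then have NGD: "N ** transpose G ** transpose D = transpose D"
    by (simp add: matrix_transpose_mul N_sym matrix_mul_assoc)
  have "B = D ** G ** (N ** transpose G ** transpose D)" by (simp add: NGD B_def)
  also have "\<dots> = (D ** G ** N) ** transpose G ** transpose D" by (simp add: matrix_mul_assoc)
  also have "\<dots> = D ** transpose G ** transpose D" by (simp add: DGN)
  also have "\<dots> = transpose B" by (simp add: B_def matrix_transpose_mul matrix_mul_assoc)
  finally show sym_B: "transpose B = B" by simp
  have "B ** A ** B = B ** A ** D ** G ** transpose D" by (simp add: B_def matrix_mul_assoc)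
  also have "\<dots> = B" using \<open>B ** A ** D = D\<close> by (simp add: B_def)
  finally show "B ** A ** B = B" .
qed

subsection \<open>Matrices of fixed rank\<close>

lemma rank_factorization:
  fixes M :: "real^'n^'m"
  assumes "rank M = CARD('d::finite)"
  obtains S :: "real^'d^'m" and R :: "real^'n^'d" where "M = S ** R"
proof -
  let ?V = "range (\<lambda>x. M *v x)"
  have "subspace ?V" by (intro linear_subspace_image matrix_vector_mul_linear) auto
  moreover have "dim (UNIV :: (real^'d) set) = dim ?V" using assms by (simp add: rank_dim_range)
  ultimately obtain f :: "real^'d \<Rightarrow> real^'m" and g where fg: "linear f" "linear g" "\<And>y. y \<in> ?V \<Longrightarrow> f (g y) = y"
    using isometries_subspaces[of "UNIV :: (real^'d) set" ?V] by (metis subspace_UNIV)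
  have "linear (\<lambda>x. g (M *v x))"
    using linear_compose[OF matrix_vector_mul_linear[of M] fg(2)] by (simp add: o_def)
  then have "M = matrix f ** matrix (\<lambda>x. g (M *v x))"
    using fg by (simp add: matrix_eq matrix_vector_mul_assoc[symmetric] matrix_works)
  then show ?thesis using that by blast
qed

lemma rank_one_side_inverses:
  fixes S :: "real^'d^'m" and R :: "real^'n^'d"
  assumes "rank S = CARD('d)" "rank R = CARD('d)"
  obtains L N where "L ** S = mat 1" "R ** N = mat 1"
proof -
  have "inj ((*v) S)" using assms(1) by (simp add: full_rank_injective)
  then obtain L where "L ** S = mat 1" by (auto simp: matrix_left_invertible_injective[symmetric])
  moreover have "surj ((*v) R)" using assms(2) by (simp add: full_rank_surjective)
  then obtain N where "R ** N = mat 1" by (auto simp: matrix_right_invertible_surjective[symmetric])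
  ultimately show ?thesis using that by blast
qed

lemma invertible_near:
  fixes f :: "'z::metric_space \<Rightarrow> real^'d^'d"
  assumes "continuous_on UNIV f" "f x = mat 1"
  obtains e where "e > 0" "\<And>y. dist y x < e \<Longrightarrow> invertible (f y)"
proof -
  have "continuous_on UNIV (\<lambda>y. det (f y))"
    using assms(1) unfolding det_def by (intro continuous_intros)
  then have "isCont (\<lambda>y. det (f y)) x" by (simp add: continuous_on_eq_continuous_at)
  moreover have "det (f x) \<noteq> 0" using assms(2) by simp
  ultimately obtain e where "e > 0" "\<And>y. dist x y < e \<Longrightarrow> det (f y) \<noteq> 0"
    using continuous_at_avoid[of x "\<lambda>y. det (f y)" 0] by auto
  then show ?thesis using that by (metis dist_commute invertible_det_nz)
qed

lemma rank_invertible: "invertible (A :: real^'d^'d) \<Longrightarrow> rank A = CARD('d)"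
  by (metis full_rank_injective invertible_left_inverse matrix_left_invertible_injective)

text \<open>Near \<open>S\<^sub>0 R\<^sub>0\<close>, the matrices of rank \<open>d\<close> factor with factors that depend in a Lipschitz way on the
  matrix: if \<open>L\<close> is a left inverse of \<open>S\<^sub>0\<close> and \<open>N\<close> a right inverse of \<open>R\<^sub>0\<close>, a matrix \<open>A\<close> of rank \<open>d\<close>
  for which \<open>L A N\<close> is invertible equals \<open>A N (L A N)\<^sup>-\<^sup>1 L A\<close>.\<close>

lemma Lipschitz_rank_factorization:
  fixes S\<^sub>0 :: "real^'d^'m" and R\<^sub>0 :: "real^'n^'d"
  assumes "rank S\<^sub>0 = CARD('d)" "rank R\<^sub>0 = CARD('d)"
  obtains C e where "C > 0" "e > 0"
    "\<And>A. rank A = CARD('d) \<Longrightarrow> norm (A - S\<^sub>0 ** R\<^sub>0) < e \<Longrightarrow>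
      \<exists>S R. A = S ** R \<and> norm (S - S\<^sub>0) \<le> C * norm (A - S\<^sub>0 ** R\<^sub>0) \<and> norm (R - R\<^sub>0) \<le> C * norm (A - S\<^sub>0 ** R\<^sub>0)"
proof -
  obtain L N where L: "L ** S\<^sub>0 = mat 1" and N: "R\<^sub>0 ** N = mat 1"
    using rank_one_side_inverses[OF assms] by blast
  have LS: "L ** S\<^sub>0 ** X = X" for X :: "real^'x^'d" using L by simp
  have "L ** (S\<^sub>0 ** R\<^sub>0) ** N = (L ** S\<^sub>0) ** (R\<^sub>0 ** N)" by (simp only: matrix_mul_assoc)
  then have base: "L ** (S\<^sub>0 ** R\<^sub>0) ** N = mat 1" by (simp add: L N)
  obtain e1 where e1: "e1 > 0" "\<And>A. dist A (S\<^sub>0 ** R\<^sub>0) < e1 \<Longrightarrow> invertible (L ** A ** N)"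
    by (rule invertible_near[of "\<lambda>A. L ** A ** N" "S\<^sub>0 ** R\<^sub>0"])
      (auto intro!: continuous_intros base)
  obtain K1 where K1: "\<And>(A :: real^'n^'m) (B :: real^'d^'n). norm (A ** B) \<le> norm A * norm B * K1" "K1 > 0"
    using bounded_bilinear.pos_bounded[OF bounded_bilinear_matrix_mult] by blast
  obtain K2 where K2: "\<And>(A :: real^'m^'d) (B :: real^'n^'m). norm (A ** B) \<le> norm A * norm B * K2" "K2 > 0"
    using bounded_bilinear.pos_bounded[OF bounded_bilinear_matrix_mult] by blast
  obtain K3 where K3: "\<And>(A :: real^'d^'m) (B :: real^'d^'d). norm (A ** B) \<le> norm A * norm B * K3" "K3 > 0"
    using bounded_bilinear.pos_bounded[OF bounded_bilinear_matrix_mult] by blast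
  obtain K4 where K4: "\<And>(A :: real^'n^'d) (B :: real^'d^'n). norm (A ** B) \<le> norm A * norm B * K4" "K4 > 0"
    using bounded_bilinear.pos_bounded[OF bounded_bilinear_matrix_mult] by blast
  obtain K5 where K5: "\<And>(A :: real^'m^'m) (B :: real^'d^'m). norm (A ** B) \<le> norm A * norm B * K5" "K5 > 0"
    using bounded_bilinear.pos_bounded[OF bounded_bilinear_matrix_mult] by blast
  define P where "P = mat 1 - S\<^sub>0 ** L"
  define a where "a = norm L * norm N * K2 * K4 * K3"
  define b where "b = norm P * (norm N * K1) * K5"
  define C where "C = 2 * b + norm L * K2 + 1"
  define e where "e = min e1 (1 / (2 * (a + 1)))"
  have ab: "a \<ge> 0" "b \<ge> 0" using K1(2) K2(2) K3(2) K4(2) K5(2) by (auto simp: a_def b_def)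
  have "C > 0" using ab K2(2) by (simp add: C_def add_nonneg_pos)
  moreover have "e > 0" using e1(1) ab by (simp add: e_def)
  moreover have "\<exists>S R. A = S ** R \<and> norm (S - S\<^sub>0) \<le> C * norm (A - S\<^sub>0 ** R\<^sub>0) \<and> norm (R - R\<^sub>0) \<le> C * norm (A - S\<^sub>0 ** R\<^sub>0)"
    if rank: "rank A = CARD('d)" and near: "norm (A - S\<^sub>0 ** R\<^sub>0) < e" for A
  proof -
    define \<Delta> where "\<Delta> = A - S\<^sub>0 ** R\<^sub>0"
    have A: "A = S\<^sub>0 ** R\<^sub>0 + \<Delta>" by (simp add: \<Delta>_def)
    have "invertible (L ** A ** N)" using near by (intro e1(2)) (simp add: e_def dist_norm)
    then obtain J where J: "L ** A ** N ** J = mat 1" "J ** (L ** A ** N) = mat 1"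
      by (auto simp: invertible_def)
    obtain S1 :: "real^'d^'m" and R1 :: "real^'n^'d" where SR: "A = S1 ** R1"
      using rank_factorization[OF rank] by blast
    define S where "S = A ** N ** J"
    define R where "R = L ** A"
    have "(L ** S1) ** (R1 ** N ** J) = mat 1" using J(1) by (simp add: SR matrix_mul_assoc)
    then have "(R1 ** N ** J) ** (L ** S1) = mat 1" by (simp add: matrix_left_right_inverse)
    then have "S1 ** ((R1 ** N ** J) ** (L ** S1)) ** R1 = A" by (simp add: SR)
    then have "A = S ** R" by (simp add: S_def R_def SR matrix_mul_assoc)
    moreover have R_diff: "R - R\<^sub>0 = L ** \<Delta>"
      by (simp add: R_def A matrix_add_ldistrib matrix_mul_assoc LS)
    have "norm (R - R\<^sub>0) \<le> C * norm \<Delta>"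
    proof -
      have "norm (R - R\<^sub>0) \<le> norm L * norm \<Delta> * K2" unfolding R_diff by (rule K2(1))
      also have "\<dots> = (norm L * K2) * norm \<Delta>" by simp
      also have "\<dots> \<le> C * norm \<Delta>"
        using ab by (intro mult_right_mono) (auto simp: C_def)
      finally show ?thesis .
    qed
    moreover have "norm (S - S\<^sub>0) \<le> C * norm \<Delta>"
    proof -
      define U where "U = S - S\<^sub>0"
      define E where "E = L ** \<Delta> ** N"
      have LAN: "L ** A ** N = mat 1 + E"
        using base by (simp add: A E_def matrix_add_ldistrib matrix_add_mult_distrib)
      have AN: "A ** N = S\<^sub>0 + \<Delta> ** N"
        by (simp add: A matrix_add_mult_distrib N flip: matrix_mul_assoc)
      have "S ** (L ** A ** N) = A ** N ** (J ** (L ** A ** N))"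
        by (simp add: S_def matrix_mul_assoc)
      then have "S ** (L ** A ** N) = A ** N" by (simp add: J(2))
      then have "S + S ** E = S\<^sub>0 + \<Delta> ** N" by (simp add: LAN AN matrix_add_ldistrib)
      moreover have "S ** E = U ** E + S\<^sub>0 ** E"
        by (simp add: U_def flip: matrix_add_mult_distrib)
      moreover have "S\<^sub>0 ** E = \<Delta> ** N - P ** (\<Delta> ** N)"
      proof -
        have "(mat 1 - P) ** (\<Delta> ** N) + P ** (\<Delta> ** N) = \<Delta> ** N"
          by (simp flip: matrix_add_mult_distrib)
        moreover have "(mat 1 - P) ** (\<Delta> ** N) = S\<^sub>0 ** E"
          by (simp add: P_def E_def matrix_mul_assoc)
        ultimately show ?thesis by (simp add: eq_diff_eq)
      qed
      ultimately have U: "U = P ** (\<Delta> ** N) - U ** E"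
        by (simp add: U_def algebra_simps)
      have E_norm: "norm E * K3 \<le> 1 / 2"
      proof -
        have "norm E \<le> norm (L ** \<Delta>) * norm N * K4" unfolding E_def by (rule K4(1))
        also have "\<dots> \<le> (norm L * norm \<Delta> * K2) * norm N * K4"
          using K2(1) K4(2) by (intro mult_right_mono) auto
        finally have "norm E * K3 \<le> (norm L * norm \<Delta> * K2) * norm N * K4 * K3"
          using K3(2) by (intro mult_right_mono) auto
        also have "\<dots> = a * norm \<Delta>" by (simp add: a_def)
        also have "\<dots> \<le> a * (1 / (2 * (a + 1)))"
          using near ab by (intro mult_left_mono) (auto simp: e_def \<Delta>_def)
        also have "\<dots> \<le> 1 / 2" using ab by (simp add: field_simps)
        finally show ?thesis .
      qed
      have "norm U \<le> norm (P ** (\<Delta> ** N)) + norm (U ** E)"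
        by (subst U) (rule norm_triangle_ineq4)
      also have "norm (U ** E) \<le> norm U * (norm E * K3)"
        using K3(1)[of U E] by (simp add: mult.assoc)
      also have "\<dots> \<le> norm U * (1 / 2)" using E_norm by (rule mult_left_mono) simp
      also have "norm (P ** (\<Delta> ** N)) \<le> norm P * norm (\<Delta> ** N) * K5" by (rule K5(1))
      also have "\<dots> \<le> norm P * (norm \<Delta> * norm N * K1) * K5"
        using K1(1) K5(2) by (intro mult_right_mono mult_left_mono) auto
      also have "\<dots> = b * norm \<Delta>" by (simp add: b_def)
      finally have "norm U \<le> 2 * b * norm \<Delta>" by simp
      also have "\<dots> \<le> C * norm \<Delta>"
        using ab K2(2) by (intro mult_right_mono) (auto simp: C_def add_nonneg_nonneg)
      finally show ?thesis by (simp add: U_def)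
    qed
    ultimately show ?thesis unfolding \<Delta>_def by blast
  qed
  ultimately show ?thesis using that by blast
qed

section \<open>The parametrisation of the rank-constrained set\<close>

lemma theta_components_add:
  "theta_eta (\<theta> + s) = theta_eta \<theta> + theta_eta s" "theta_S (\<theta> + s) = theta_S \<theta> + theta_S s"
  "theta_R (\<theta> + s) = theta_R \<theta> + theta_R s" "theta_beta2 (\<theta> + s) = theta_beta2 \<theta> + theta_beta2 s"
  by (simp_all add: vec_eq_iff theta_eta_def theta_S_def theta_R_def theta_beta2_def)

lemma theta_components_scaleR:
  "theta_eta (c *\<^sub>R s) = c *\<^sub>R theta_eta s" "theta_S (c *\<^sub>R s) = c *\<^sub>R theta_S s"
  "theta_R (c *\<^sub>R s) = c *\<^sub>R theta_R s" "theta_beta2 (c *\<^sub>R s) = c *\<^sub>R theta_beta2 s"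
  by (simp_all add: vec_eq_iff theta_eta_def theta_S_def theta_R_def theta_beta2_def)

lemma theta_components_continuous:
  "continuous_on UNIV theta_eta" "continuous_on UNIV theta_S" "continuous_on UNIV theta_R"
  unfolding theta_eta_def theta_S_def theta_R_def
  by (auto intro!: continuous_intros)

text \<open>In the increment \<open>s\<close> of the parameter, the map \<open>g\<close> is the exact sum of its value at \<open>\<theta>\<close>, a part
  \<open>g_linear\<close> that is linear in \<open>s\<close>, which is its derivative, and a part \<open>g_quadratic\<close> that comes from the
  product of the increments of \<open>S\<close> and \<open>R\<close> and does not depend on \<open>\<theta>\<close>.\<close>

definition g_linear :: "('r \<Rightarrow> 'p) \<Rightarrow>
    ('k::finite, 'k1::finite, 'd::finite, 'r::finite, 'p::finite) theta \<Rightarrow>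
    ('k, 'k1, 'd, 'r, 'p) theta \<Rightarrow> ('k, 'k1, 'p) param" where
  "g_linear \<rho> \<theta> s = (\<chi> c. case c of
      Inl i \<Rightarrow> theta_eta s $ i
    | Inr (a, l) \<Rightarrow> if l \<in> range \<rho>
        then (theta_S \<theta> ** theta_R s + theta_S s ** theta_R \<theta>) $ a $ inv \<rho> l
        else theta_beta2 s $ a $ l)"

definition g_quadratic :: "('r \<Rightarrow> 'p) \<Rightarrow>
    ('k::finite, 'k1::finite, 'd::finite, 'r::finite, 'p::finite) theta \<Rightarrow> ('k, 'k1, 'p) param" where
  "g_quadratic \<rho> s = (\<chi> c. case c of
      Inl i \<Rightarrow> 0
    | Inr (a, l) \<Rightarrow> if l \<in> range \<rho> then (theta_S s ** theta_R s) $ a $ inv \<rho> l else 0)"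

lemma g_map_expansion: "g_map \<rho> (\<theta> + s) = g_map \<rho> \<theta> + g_linear \<rho> \<theta> s + g_quadratic \<rho> s"
  by (auto simp: vec_eq_iff g_map_def g_linear_def g_quadratic_def theta_components_add
      matrix_add_ldistrib matrix_add_mult_distrib split: sum.split)

lemma matrix_mult_scaleR_left: "(c *\<^sub>R A) ** B = c *\<^sub>R (A ** B)" for A :: "real^'b^'a"
  by (simp add: vec_eq_iff matrix_matrix_mult_def sum_distrib_left mult.assoc)

lemma matrix_mult_scaleR_right: "A ** (c *\<^sub>R B) = c *\<^sub>R (A ** B)" for A :: "real^'b^'a"
  by (simp add: vec_eq_iff matrix_matrix_mult_def sum_distrib_left mult.left_commute)

lemma linear_g_linear: "linear (g_linear \<rho> \<theta>)"
  by (rule linearI) (auto simp: vec_eq_iff g_linear_def theta_components_add theta_components_scaleR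
      matrix_add_ldistrib matrix_add_mult_distrib matrix_mult_scaleR_left matrix_mult_scaleR_right
      algebra_simps split: sum.split)

lemma g_quadratic_bound:
  fixes \<rho> :: "'r::finite \<Rightarrow> 'p::finite"
  shows "\<exists>C>0. \<forall>s :: ('k::finite, 'k1::finite, 'd::finite, 'r, 'p) theta.
    norm (g_quadratic \<rho> s) \<le> C * (norm s)\<^sup>2"
proof -
  let ?C = "real CARD('k + 'k1 \<times> 'p) * real CARD('d)"
  have "norm (g_quadratic \<rho> s) \<le> ?C * (norm s)\<^sup>2" for s :: "('k, 'k1, 'd, 'r, 'p) theta"
  proof -
    have prod: "\<bar>(theta_S s ** theta_R s) $ a $ j\<bar> \<le> real CARD('d) * (norm s)\<^sup>2" for a j
    proof -
      have "\<bar>(theta_S s ** theta_R s) $ a $ j\<bar> \<le> (\<Sum>u\<in>UNIV. \<bar>theta_S s $ a $ u * theta_R s $ u $ j\<bar>)"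
        by (simp add: matrix_matrix_mult_def)
      also have "\<dots> \<le> (\<Sum>u\<in>(UNIV::'d set). norm s * norm s)"
        unfolding abs_mult theta_S_def theta_R_def
        by (intro sum_mono mult_mono) (auto simp: component_le_norm_cart)
      finally show ?thesis by (simp add: power2_eq_square)
    qed
    have "norm (g_quadratic \<rho> s) \<le> (\<Sum>c\<in>UNIV. \<bar>g_quadratic \<rho> s $ c\<bar>)" by (rule norm_le_l1_cart)
    also have "\<dots> \<le> (\<Sum>c\<in>(UNIV :: ('k + 'k1 \<times> 'p) set). real CARD('d) * (norm s)\<^sup>2)"
      by (intro sum_mono) (auto simp: g_quadratic_def prod split: sum.split)
    finally show ?thesis by (simp only: sum_constant mult.assoc)
  qed
  moreover have "?C > 0"
    by (intro mult_pos_pos) (simp_all only: of_nat_0_less_iff zero_less_card_finite)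
  ultimately show ?thesis by blast
qed

lemma g_map_has_derivative:
  fixes \<theta> :: "('k::finite, 'k1::finite, 'd::finite, 'r::finite, 'p::finite) theta"
  shows "(g_map \<rho> has_derivative g_linear \<rho> \<theta>) (at \<theta>)"
proof -
  obtain C where C: "C > 0"
    "\<And>s :: ('k, 'k1, 'd, 'r, 'p) theta. norm (g_quadratic \<rho> s) \<le> C * (norm s)\<^sup>2"
    using g_quadratic_bound[of \<rho>] by blast
  show ?thesis
    unfolding has_derivative_at
  proof
    show "bounded_linear (g_linear \<rho> \<theta>)"
      using linear_g_linear by (rule linear_conv_bounded_linear[THEN iffD1])
    have "((\<lambda>s. C * norm s) \<longlongrightarrow> 0) (at 0)"
      by (rule tendsto_eq_intros refl | simp)+
    then show "(\<lambda>s. norm (g_map \<rho> (\<theta> + s) - g_map \<rho> \<theta> - g_linear \<rho> \<theta> s) / norm s) \<midarrow>0\<rightarrow> 0"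
    proof (rule Lim_null_comparison[rotated], intro always_eventually allI)
      fix s
      show "norm (norm (g_map \<rho> (\<theta> + s) - g_map \<rho> \<theta> - g_linear \<rho> \<theta> s) / norm s) \<le> C * norm s"
      proof (cases "s = 0")
        case False
        then show ?thesis
          using C(2)[of s] by (simp add: g_map_expansion divide_le_eq power2_eq_square mult.assoc)
      qed simp
    qed
  qed
qed

lemma jacobian_g_map: "jacobian (g_map \<rho>) (at \<theta>) *v s = g_linear \<rho> \<theta> s"
  unfolding jacobian_def frechet_derivative_at[OF g_map_has_derivative, symmetric]
  by (simp add: linear_g_linear matrix_works)

lemma open_second_part:
  assumes "openin (top_of_set (range (second_part \<kappa>))) H2"
  shows "open {\<eta> :: real^'k. second_part \<kappa> \<eta> \<in> H2}"
proof -
  obtain U where "open U" "H2 = range (second_part \<kappa>) \<inter> U" using assms by (auto simp: openin_open)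
  then have "{\<eta>. second_part \<kappa> \<eta> \<in> H2} = second_part \<kappa> -` U" by auto
  moreover have "continuous_on UNIV (second_part \<kappa> :: real^'k \<Rightarrow> real^'k)"
    unfolding second_part_def
  proof (rule continuous_on_vec_lambda)
    fix i show "continuous_on UNIV (\<lambda>\<eta> :: real^'k. if i \<in> range \<kappa> then 0 else \<eta> $ i)"
      by (cases "i \<in> range \<kappa>") (auto intro: continuous_intros)
  qed
  ultimately show ?thesis using \<open>open U\<close> by (simp add: open_vimage)
qed

text \<open>Local surjectivity onto the constrained set: a point of \<open>Xi_res\<close> near \<open>g \<theta>\<^sub>0\<close> has a preimage at a
  comparable distance from \<open>\<theta>\<^sub>0\<close>.\<close>

lemma g_map_Lipschitz_section:
  fixes \<theta>\<^sub>0 :: "('k::finite, 'k1::finite, 'd::finite, 'r::finite, 'p::finite) theta"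
  assumes "inj \<rho>" and \<theta>\<^sub>0: "\<theta>\<^sub>0 \<in> Theta \<kappa> H2 \<rho>"
  obtains C e where "C > 0" "e > 0"
    "\<And>\<xi>. rank (beta1 \<rho> \<xi>) = CARD('d) \<Longrightarrow> norm (\<xi> - g_map \<rho> \<theta>\<^sub>0) < e \<Longrightarrow>
      \<exists>s. \<xi> = g_map \<rho> (\<theta>\<^sub>0 + s) \<and> norm s \<le> C * norm (\<xi> - g_map \<rho> \<theta>\<^sub>0)"
proof -
  let ?\<xi>\<^sub>0 = "g_map \<rho> \<theta>\<^sub>0"
  have rank: "rank (theta_S \<theta>\<^sub>0) = CARD('d)" "rank (theta_R \<theta>\<^sub>0) = CARD('d)"
    using \<theta>\<^sub>0 by (auto simp: Theta_def)
  let ?A0 = "theta_S \<theta>\<^sub>0 ** theta_R \<theta>\<^sub>0"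
  obtain C1 e1 where "C1 > 0" "e1 > 0" and fac:
    "\<And>A. rank A = CARD('d) \<Longrightarrow> norm (A - ?A0) < e1 \<Longrightarrow>
      \<exists>S R. A = S ** R \<and> norm (S - theta_S \<theta>\<^sub>0) \<le> C1 * norm (A - ?A0) \<and> norm (R - theta_R \<theta>\<^sub>0) \<le> C1 * norm (A - ?A0)"
    by (rule Lipschitz_rank_factorization[OF rank]) blast
  define k where "k = real CARD('k1) * real CARD('r)"
  have "k > 0" by (simp add: k_def)
  have b1: "norm (beta1 \<rho> \<xi> - ?A0) \<le> k * norm (\<xi> - ?\<xi>\<^sub>0)" for \<xi>
  proof -
    have "norm (beta1 \<rho> \<xi> - ?A0) \<le> (\<Sum>a\<in>UNIV. \<Sum>j\<in>UNIV. \<bar>(beta1 \<rho> \<xi> - ?A0) $ a $ j\<bar>)"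
    proof -
      have "norm (beta1 \<rho> \<xi> - ?A0) \<le> (\<Sum>a\<in>UNIV. norm ((beta1 \<rho> \<xi> - ?A0) $ a))"
        unfolding norm_vec_def[of "beta1 \<rho> \<xi> - ?A0"] by (rule L2_set_le_sum) simp
      also have "\<dots> \<le> (\<Sum>a\<in>UNIV. \<Sum>j\<in>UNIV. \<bar>(beta1 \<rho> \<xi> - ?A0) $ a $ j\<bar>)"
        by (intro sum_mono norm_le_l1_cart)
      finally show ?thesis .
    qed
    also have "\<dots> \<le> (\<Sum>a\<in>(UNIV::'k1 set). \<Sum>j\<in>(UNIV::'r set). norm (\<xi> - ?\<xi>\<^sub>0))"
    proof (intro sum_mono)
      fix a j
      have "(beta1 \<rho> \<xi> - ?A0) $ a $ j = (\<xi> - ?\<xi>\<^sub>0) $ Inr (a, \<rho> j)"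
        by (simp add: beta1_g_map[OF \<open>inj \<rho>\<close>, symmetric] beta1_def beta_def)
      then show "\<bar>(beta1 \<rho> \<xi> - ?A0) $ a $ j\<bar> \<le> norm (\<xi> - ?\<xi>\<^sub>0)"
        by (simp only: component_le_norm_cart)
    qed
    finally show ?thesis by (simp add: k_def)
  qed
  define K where "K = C1 * k + 1"
  define N where "N = real CARD('k + ('k1 \<times> 'd) + ('d \<times> 'r) + ('k1 \<times> 'p))"
  define C where "C = N * K"
  have "K > 0" using \<open>C1 > 0\<close> \<open>k > 0\<close> by (simp add: K_def add_pos_pos)
  have "N > 0" unfolding N_def by (simp only: of_nat_0_less_iff zero_less_card_finite)
  have "C > 0" using \<open>K > 0\<close> \<open>N > 0\<close> by (simp add: C_def)
  moreover have "e1 / k > 0" using \<open>e1 > 0\<close> \<open>k > 0\<close> by simp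
  moreover have "\<exists>s. \<xi> = g_map \<rho> (\<theta>\<^sub>0 + s) \<and> norm s \<le> C * norm (\<xi> - ?\<xi>\<^sub>0)"
    if rank: "rank (beta1 \<rho> \<xi>) = CARD('d)" and near: "norm (\<xi> - ?\<xi>\<^sub>0) < e1 / k" for \<xi>
  proof -
    have "norm (beta1 \<rho> \<xi> - ?A0) < e1"
      using b1[of \<xi>] near \<open>k > 0\<close> by (simp add: field_simps)
    then obtain S R where SR: "beta1 \<rho> \<xi> = S ** R"
      and "norm (S - theta_S \<theta>\<^sub>0) \<le> C1 * norm (beta1 \<rho> \<xi> - ?A0)"
        "norm (R - theta_R \<theta>\<^sub>0) \<le> C1 * norm (beta1 \<rho> \<xi> - ?A0)"
      using fac[OF rank] by blast
    moreover have "C1 * norm (beta1 \<rho> \<xi> - ?A0) \<le> K * norm (\<xi> - ?\<xi>\<^sub>0)"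
    proof -
      have "C1 * norm (beta1 \<rho> \<xi> - ?A0) \<le> C1 * (k * norm (\<xi> - ?\<xi>\<^sub>0))"
        using b1 \<open>C1 > 0\<close> by (intro mult_left_mono) auto
      also have "\<dots> \<le> K * norm (\<xi> - ?\<xi>\<^sub>0)" by (simp add: K_def distrib_right)
      finally show ?thesis .
    qed
    ultimately have S: "norm (S - theta_S \<theta>\<^sub>0) \<le> K * norm (\<xi> - ?\<xi>\<^sub>0)"
      and R: "norm (R - theta_R \<theta>\<^sub>0) \<le> K * norm (\<xi> - ?\<xi>\<^sub>0)" by auto
    have K1: "norm (\<xi> - ?\<xi>\<^sub>0) \<le> K * norm (\<xi> - ?\<xi>\<^sub>0)"
      using \<open>C1 > 0\<close> \<open>k > 0\<close> by (simp add: K_def distrib_right)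
    define s :: "('k, 'k1, 'd, 'r, 'p) theta" where "s = (\<chi> c. case c of
        Inl i \<Rightarrow> (\<xi> - ?\<xi>\<^sub>0) $ Inl i
      | Inr (Inl (a, u)) \<Rightarrow> (S - theta_S \<theta>\<^sub>0) $ a $ u
      | Inr (Inr (Inl (u, j))) \<Rightarrow> (R - theta_R \<theta>\<^sub>0) $ u $ j
      | Inr (Inr (Inr (a, l))) \<Rightarrow> (\<xi> - ?\<xi>\<^sub>0) $ Inr (a, l))"
    have s_eta: "theta_eta (\<theta>\<^sub>0 + s) $ i = \<xi> $ Inl i" for i
      by (simp add: s_def theta_eta_def g_map_def)
    have s_S: "theta_S (\<theta>\<^sub>0 + s) = S"
      by (simp add: s_def theta_S_def vec_eq_iff)
    have s_R: "theta_R (\<theta>\<^sub>0 + s) = R"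
      by (simp add: s_def theta_R_def vec_eq_iff)
    have s_b: "theta_beta2 (\<theta>\<^sub>0 + s) $ a $ l = \<xi> $ Inr (a, l)" if "l \<notin> range \<rho>" for a l
      using that by (simp add: s_def theta_beta2_def g_map_def)
    have "\<xi> $ c = g_map \<rho> (\<theta>\<^sub>0 + s) $ c" for c
    proof (cases c)
      case (Inl i)
      then show ?thesis by (simp add: g_map_def s_eta)
    next
      case (Inr al)
      obtain a l where al: "al = (a, l)" by (cases al)
      show ?thesis
      proof (cases "l \<in> range \<rho>")
        case True
        then obtain j where "l = \<rho> j" by auto
        then show ?thesis
          using \<open>inj \<rho>\<close> Inr al by (simp add: g_map_def s_S s_R SR[symmetric] beta1_def beta_def)
      next
        case False
        then show ?thesis using Inr al by (simp add: g_map_def s_b)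
      qed
    qed
    then have "\<xi> = g_map \<rho> (\<theta>\<^sub>0 + s)" by (simp add: vec_eq_iff)
    moreover have "norm s \<le> C * norm (\<xi> - ?\<xi>\<^sub>0)"
    proof -
      have comp: "\<bar>(S - theta_S \<theta>\<^sub>0) $ a $ u\<bar> \<le> norm (S - theta_S \<theta>\<^sub>0)"
        "\<bar>(R - theta_R \<theta>\<^sub>0) $ u $ j\<bar> \<le> norm (R - theta_R \<theta>\<^sub>0)" for a u j
        by (meson component_le_norm_cart Finite_Cartesian_Product.norm_nth_le order_trans)+
      have "norm s \<le> (\<Sum>c\<in>UNIV. \<bar>s $ c\<bar>)" by (rule norm_le_l1_cart)
      also have "\<dots> \<le> (\<Sum>c\<in>(UNIV :: ('k + ('k1 \<times> 'd) + ('d \<times> 'r) + ('k1 \<times> 'p)) set). K * norm (\<xi> - ?\<xi>\<^sub>0))"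
      proof (rule sum_mono)
        fix c
        have "\<bar>(\<xi> - ?\<xi>\<^sub>0) $ b\<bar> \<le> K * norm (\<xi> - ?\<xi>\<^sub>0)" for b
          using component_le_norm_cart[of "\<xi> - ?\<xi>\<^sub>0" b] K1 by linarith
        moreover have "\<bar>(S - theta_S \<theta>\<^sub>0) $ a $ u\<bar> \<le> K * norm (\<xi> - ?\<xi>\<^sub>0)"
          "\<bar>(R - theta_R \<theta>\<^sub>0) $ u $ j\<bar> \<le> K * norm (\<xi> - ?\<xi>\<^sub>0)" for a u j
          using comp(1)[of a u] comp(2)[of u j] S R by linarith+
        ultimately show "\<bar>s $ c\<bar> \<le> K * norm (\<xi> - ?\<xi>\<^sub>0)"
          unfolding s_def by (auto split: sum.split prod.split)
      qed
      finally show ?thesis by (simp only: sum_constant N_def C_def mult.assoc)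
    qed
    ultimately show ?thesis by blast
  qed
  ultimately show ?thesis using that by blast
qed

lemma g_map_near_in_Xi_res:
  fixes \<theta>\<^sub>0 :: "('k::finite, 'k1::finite, 'd::finite, 'r::finite, 'p::finite) theta"
  assumes "inj \<rho>" and \<theta>\<^sub>0: "\<theta>\<^sub>0 \<in> Theta \<kappa> H2 \<rho>"
    and H2: "openin (top_of_set (range (second_part \<kappa>))) H2"
  obtains e where "e > 0" "\<And>s. norm s < e \<Longrightarrow> g_map \<rho> (\<theta>\<^sub>0 + s) \<in> Xi_res \<kappa> H2 \<rho> CARD('d)"
proof -
  have rank: "rank (theta_S \<theta>\<^sub>0) = CARD('d)" "rank (theta_R \<theta>\<^sub>0) = CARD('d)"
    and \<theta>\<^sub>0_H: "theta_eta \<theta>\<^sub>0 \<in> {\<eta>. second_part \<kappa> \<eta> \<in> H2}"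
    using \<theta>\<^sub>0 by (auto simp: Theta_def)
  obtain L N where L: "L ** theta_S \<theta>\<^sub>0 = mat 1" and N: "theta_R \<theta>\<^sub>0 ** N = mat 1"
    using rank_one_side_inverses[OF rank] by blast
  define f where "f \<theta> = (L ** theta_S \<theta>) ** (theta_R \<theta> ** N)" for \<theta> :: "('k, 'k1, 'd, 'r, 'p) theta"
  have "continuous_on UNIV f"
    unfolding f_def by (intro continuous_intros theta_components_continuous)
  moreover have "f \<theta>\<^sub>0 = mat 1" by (simp add: f_def L N)
  ultimately obtain e1 where e1: "e1 > 0" "\<And>\<theta>. dist \<theta> \<theta>\<^sub>0 < e1 \<Longrightarrow> invertible (f \<theta>)"
    by (rule invertible_near) blast
  have "open (theta_eta -` {\<eta>. second_part \<kappa> \<eta> \<in> H2} :: ('k, 'k1, 'd, 'r, 'p) theta set)"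
    by (intro open_vimage open_second_part H2 theta_components_continuous)
  then obtain e2 where e2: "e2 > 0" "\<And>\<theta>. dist \<theta> \<theta>\<^sub>0 < e2 \<Longrightarrow> second_part \<kappa> (theta_eta \<theta>) \<in> H2"
    unfolding open_dist using \<theta>\<^sub>0_H by (metis (no_types, lifting) mem_Collect_eq vimage_eq)
  have "g_map \<rho> (\<theta>\<^sub>0 + s) \<in> Xi_res \<kappa> H2 \<rho> CARD('d)" if s: "norm s < min e1 e2" for s
  proof -
    let ?\<theta> = "\<theta>\<^sub>0 + s"
    have "eta_bar (g_map \<rho> ?\<theta>) = theta_eta ?\<theta>"
      by (simp add: eta_bar_def g_map_def vec_eq_iff)
    then have "second_part \<kappa> (eta_bar (g_map \<rho> ?\<theta>)) \<in> H2"
      using e2(2)[of ?\<theta>] s by (simp add: dist_norm)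
    moreover have "rank (theta_S ?\<theta> ** theta_R ?\<theta>) = CARD('d)"
    proof (rule antisym)
      show "rank (theta_S ?\<theta> ** theta_R ?\<theta>) \<le> CARD('d)"
        using rank_mul_le_left[of "theta_S ?\<theta>" "theta_R ?\<theta>"] rank_bound[of "theta_S ?\<theta>"] by simp
      have "rank (f ?\<theta>) = CARD('d)"
        using e1(2)[of ?\<theta>] s by (intro rank_invertible) (simp add: dist_norm)
      moreover have "f ?\<theta> = L ** ((theta_S ?\<theta> ** theta_R ?\<theta>) ** N)"
        by (simp add: f_def matrix_mul_assoc)
      moreover have "rank (L ** ((theta_S ?\<theta> ** theta_R ?\<theta>) ** N)) \<le> rank (theta_S ?\<theta> ** theta_R ?\<theta>)"
        using rank_mul_le_right rank_mul_le_left order_trans by blast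
      ultimately show "CARD('d) \<le> rank (theta_S ?\<theta> ** theta_R ?\<theta>)" by simp
    qed
    ultimately show ?thesis
      by (simp add: Xi_res_def Xi_def beta1_g_map[OF \<open>inj \<rho>\<close>])
  qed
  moreover have "min e1 e2 > 0" using e1 e2 by simp
  ultimately show ?thesis using that by blast
qed

section \<open>Near-maximisers of a locally quadratic criterion on a curved set\<close>

text \<open>The local quadratic approximation, with argument rescaled by \<open>\<surd>n\<close> and value by \<open>n\<close>.\<close>

definition local_quadratic :: "real^'n^'n \<Rightarrow> real^'n \<Rightarrow> real^'n \<Rightarrow> real" where
  "local_quadratic A g u = g \<bullet> u - (u \<bullet> (A *v u)) / 2"

lemma local_quadratic_Lipschitz:
  assumes \<alpha>: "\<And>x y. \<bar>x \<bullet> (A *v y)\<bar> \<le> \<alpha> * norm x * norm y" and g: "norm g \<le> K"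
  shows "\<bar>local_quadratic A g u - local_quadratic A g v\<bar> \<le> norm (u - v) * (K + \<alpha> * (norm u + norm v))"
proof -
  have abs_bound: "\<bar>a - (b + c) / 2\<bar> \<le> a' + (b' + c')"
    if "\<bar>a\<bar> \<le> a'" "\<bar>b\<bar> \<le> b'" "\<bar>c\<bar> \<le> c'" for a b c a' b' c' :: real
    using that by (simp add: abs_le_iff field_simps)
  have "local_quadratic A g u - local_quadratic A g v
      = g \<bullet> (u - v) - ((u - v) \<bullet> (A *v u) + v \<bullet> (A *v (u - v))) / 2"
    by (simp add: local_quadratic_def inner_diff_right inner_diff_left matrix_vector_mult_diff_distrib
        diff_divide_distrib add_divide_distrib)
  also have "\<bar>\<dots>\<bar> \<le> norm (u - v) * K + (\<alpha> * norm (u - v) * norm u + \<alpha> * norm v * norm (u - v))"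
  proof (intro abs_bound \<alpha>)
    have "\<bar>g \<bullet> (u - v)\<bar> \<le> norm g * norm (u - v)" by (rule Cauchy_Schwarz_ineq2)
    also have "\<dots> \<le> K * norm (u - v)" using g by (rule mult_right_mono) simp
    finally show "\<bar>g \<bullet> (u - v)\<bar> \<le> norm (u - v) * K" by (simp add: mult.commute)
  qed
  also have "\<dots> = norm (u - v) * (K + \<alpha> * (norm u + norm v))" by (simp add: algebra_simps)
  finally show ?thesis .
qed

text \<open>\<open>B g\<close> maximises the quadratic over the range of \<open>D\<close>.\<close>

lemma local_quadratic_gap:
  fixes A :: "real^'n^'n" and D :: "real^'t^'n"
  assumes sym: "transpose A = A" and pd: "\<And>v. v \<noteq> 0 \<Longrightarrow> 0 < v \<bullet> (A *v v)"
    and gi: "generalised_inverse (transpose D ** A ** D) Gi"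
  defines "B \<equiv> D ** Gi ** transpose D"
  shows "local_quadratic A g (B *v g) - local_quadratic A g (D *v v)
    = ((B *v g - D *v v) \<bullet> (A *v (B *v g - D *v v))) / 2"
proof -
  have BAD: "B ** A ** D = D" and B_sym: "transpose B = B"
    using generalised_inverse_projection[OF sym pd gi] by (auto simp: B_def)
  \<comment> \<open>the normal equations of the maximisation over the range of \<open>D\<close>\<close>
  have normal_eq: "g \<bullet> (D *v w) = (B *v g) \<bullet> (A *v (D *v w))" for w
  proof -
    have "(B *v g) \<bullet> (A *v (D *v w)) = g \<bullet> (B *v (A *v (D *v w)))"
      by (metis B_sym dot_lmul_matrix vector_transpose_matrix)
    also have "B *v (A *v (D *v w)) = D *v w"
      using BAD by (simp add: matrix_vector_mul_assoc matrix_mul_assoc)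
    finally show ?thesis by simp
  qed
  have Bg: "B *v g = D *v ((Gi ** transpose D) *v g)"
    by (simp add: B_def matrix_vector_mul_assoc matrix_mul_assoc)
  have "g \<bullet> (B *v g) = (B *v g) \<bullet> (A *v (B *v g))"
    unfolding Bg by (subst normal_eq) (simp only: Bg[symmetric])
  moreover have "(D *v v) \<bullet> (A *v (B *v g)) = (B *v g) \<bullet> (A *v (D *v v))"
    by (metis dot_lmul_matrix inner_commute sym vector_transpose_matrix)
  ultimately show ?thesis
    unfolding local_quadratic_def normal_eq[of v]
    by (simp add: inner_diff_right inner_diff_left matrix_vector_mult_diff_distrib field_simps)
qed

text \<open>The error of the quadratic approximation at \<open>\<xi>\<close> to a criterion \<open>m\<close> with linear coefficient
  \<open>g / \<surd>n\<close> and curvature \<open>A\<close> at \<open>\<xi>\<^sub>0\<close>.\<close>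

definition quad_remainder ::
    "real^'n^'n \<Rightarrow> real^'n \<Rightarrow> nat \<Rightarrow> real^'n \<Rightarrow> (real^'n \<Rightarrow> real) \<Rightarrow> real^'n \<Rightarrow> real" where
  "quad_remainder A \<xi>\<^sub>0 n g m \<xi> = m \<xi> - m \<xi>\<^sub>0 - (g \<bullet> (\<xi> - \<xi>\<^sub>0)) / sqrt (real n)
     + ((\<xi> - \<xi>\<^sub>0) \<bullet> (A *v (\<xi> - \<xi>\<^sub>0))) / 2"

text \<open>For sample size \<open>n\<close>: whenever \<open>\<parallel>g\<parallel> \<le> K\<close> and the criterion is quadratic up to
  \<open>\<delta> \<parallel>\<xi> - \<xi>\<^sub>0\<parallel>\<^sup>2\<close> on the ball of radius \<open>e\<close>, a maximiser up to \<open>\<delta> / n\<close> over \<open>\<Xi>r\<close> within distance \<open>r\<close> of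
  \<open>\<xi>\<^sub>0\<close> agrees with \<open>\<xi>\<^sub>0 + B g / \<surd>n\<close> up to \<open>\<epsilon> / \<surd>n\<close>.\<close>

definition linear_near_maximisers ::
    "real^'n^'n \<Rightarrow> real^'n^'n \<Rightarrow> (real^'n) set \<Rightarrow> real^'n \<Rightarrow> real \<Rightarrow> real \<Rightarrow> real \<Rightarrow> real \<Rightarrow> real \<Rightarrow> nat \<Rightarrow> bool"
  where
  "linear_near_maximisers A B \<Xi>r \<xi>\<^sub>0 K \<epsilon> \<delta> e r n \<longleftrightarrow> (\<forall>g m x.
     norm g \<le> K \<and> x \<in> \<Xi>r \<and> norm (x - \<xi>\<^sub>0) \<le> r \<and>
     (\<forall>\<xi>\<in>cball \<xi>\<^sub>0 e. \<bar>quad_remainder A \<xi>\<^sub>0 n g m \<xi>\<bar> \<le> \<delta> * (norm (\<xi> - \<xi>\<^sub>0))\<^sup>2) \<and>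
     (\<forall>\<xi>\<in>\<Xi>r. m \<xi> \<le> m x + \<delta> / real n) \<longrightarrow>
     norm (sqrt (real n) *\<^sub>R (x - \<xi>\<^sub>0) - B *v g) \<le> \<epsilon>)"

text \<open>The deterministic core of the asymptotic expansion.  If the constraint set \<open>\<Xi>r\<close> is tangent to the
  range of \<open>D\<close> at \<open>\<xi>\<^sub>0\<close>, near-maximisers over \<open>\<Xi>r\<close> are linear in \<open>g\<close> to first order, since \<open>B g\<close>
  maximises the quadratic over the tangent space.\<close>

lemma near_maximiser_linear:
  fixes A :: "real^'n^'n" and D :: "real^'t^'n" and \<Xi>r :: "(real^'n) set"
  assumes sym: "transpose A = A" and pd: "\<And>v. v \<noteq> 0 \<Longrightarrow> 0 < v \<bullet> (A *v v)"
    and gi: "generalised_inverse (transpose D ** A ** D) Gi"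
    and centre: "\<xi>\<^sub>0 \<in> \<Xi>r"
    and C1: "C1 > 0" "e1 > 0" and tangent: "\<And>\<xi>. \<xi> \<in> \<Xi>r \<Longrightarrow> norm (\<xi> - \<xi>\<^sub>0) < e1 \<Longrightarrow>
      \<exists>s. norm (\<xi> - \<xi>\<^sub>0 - D *v s) \<le> C1 * (norm (\<xi> - \<xi>\<^sub>0))\<^sup>2"
    and C2: "C2 > 0" "e2 > 0" and curve: "\<And>s. norm s < e2 \<Longrightarrow>
      \<exists>\<xi>\<in>\<Xi>r. norm (\<xi> - \<xi>\<^sub>0 - D *v s) \<le> C2 * (norm s)\<^sup>2"
    and K: "K > 0" and \<epsilon>: "\<epsilon> > 0"
  defines "B \<equiv> D ** Gi ** transpose D"
  shows "\<exists>\<delta>>0. \<forall>e>0. \<exists>r>0. eventually (linear_near_maximisers A B \<Xi>r \<xi>\<^sub>0 K \<epsilon> \<delta> e r) sequentially"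
proof -
  obtain lam where lam: "lam > 0" "\<And>v. lam * (norm v)\<^sup>2 \<le> v \<bullet> (A *v v)"
    using pos_def_lower_bound[OF pd] by blast
  obtain \<alpha>' where "\<alpha>' > 0" and \<alpha>': "\<And>(M :: real^'n^'n) x y. \<bar>x \<bullet> (M *v y)\<bar> \<le> \<alpha>' * norm M * (norm x * norm y)"
    by (rule matrix_form_bound) blast
  define \<alpha> where "\<alpha> = \<alpha>' * norm A"
  have \<alpha>: "\<alpha> \<ge> 0" "\<And>x y. \<bar>x \<bullet> (A *v y)\<bar> \<le> \<alpha> * norm x * norm y"
    using \<open>\<alpha>' > 0\<close> \<alpha>'[of _ A] by (auto simp: \<alpha>_def mult.assoc)
  define \<sigma> where "\<sigma> = onorm ((*v) (Gi ** transpose D))"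
  have \<sigma>: "\<sigma> \<ge> 0" "norm ((Gi ** transpose D) *v g) \<le> \<sigma> * norm g" for g
    by (auto simp: \<sigma>_def onorm_pos_le intro: onorm)
  define b where "b = onorm ((*v) B)"
  have b: "b \<ge> 0" "norm (B *v g) \<le> b * norm g" for g
    by (auto simp: b_def onorm_pos_le intro: onorm)
  \<comment> \<open>\<open>U\<close> bounds the rescaled near-maximiser and \<open>U2\<close> the rescaled competitor.  Their distances from the
    tangent space are at most \<open>k1 / \<surd>n\<close> and \<open>k2 / \<surd>n\<close>, which changes the quadratic by at most \<open>c2 / \<surd>n\<close>
    in total, and the quadratic approximation of the criterion costs \<open>\<delta> c1\<close>.\<close>
  define U where "U = 1 + 8 * (K + 1) / (3 * lam)"
  define k1 where "k1 = C1 * U\<^sup>2"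
  define k2 where "k2 = C2 * (\<sigma> * K)\<^sup>2"
  define U2 where "U2 = b * K + k2"
  define c1 where "c1 = 1 + U\<^sup>2 + U2\<^sup>2"
  define c2 where "c2 = k1 * (K + \<alpha> * (2 * U + k1)) + k2 * (K + \<alpha> * (2 * U2))"
  have pos: "U \<ge> 1" "k1 \<ge> 0" "k2 \<ge> 0" "U2 \<ge> 0" "c1 > 0" "c2 \<ge> 0"
    using lam(1) K C1 C2 b(1) \<alpha>(1)
    by (auto simp: U_def k1_def k2_def U2_def c1_def c2_def intro!: add_nonneg_nonneg mult_nonneg_nonneg add_pos_nonneg)
  define \<delta> where "\<delta> = min (min 1 (lam / 8)) (lam * \<epsilon>\<^sup>2 / (16 * c1))"
  have \<delta>: "\<delta> > 0" "\<delta> \<le> 1" "\<delta> \<le> lam / 8" "2 * \<delta> * c1 / lam \<le> \<epsilon>\<^sup>2 / 8"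
  proof -
    show "\<delta> > 0" using lam(1) \<epsilon> pos by (simp add: \<delta>_def)
    have "\<delta> \<le> lam * \<epsilon>\<^sup>2 / (16 * c1)" by (simp add: \<delta>_def)
    then have "\<delta> * (16 * c1) \<le> lam * \<epsilon>\<^sup>2" using pos by (simp add: pos_le_divide_eq)
    then show "2 * \<delta> * c1 / lam \<le> \<epsilon>\<^sup>2 / 8" using lam(1) by (simp add: field_simps)
  qed (auto simp: \<delta>_def)
  let ?quad = "local_quadratic A"
  have "\<exists>r>0. eventually (linear_near_maximisers A B \<Xi>r \<xi>\<^sub>0 K \<epsilon> \<delta> e r) sequentially" if "e > 0" for e
  proof (intro exI conjI)
    show "min e (e1 / 2) > 0" using \<open>e > 0\<close> C1 by simp
    have small: "eventually (\<lambda>n. c / sqrt (real n) < d) sequentially" if "d > 0" for c d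
    proof -
      have "(\<lambda>n. c / sqrt (real n)) \<longlonglongrightarrow> 0"
        by (intro tendsto_divide_0[OF tendsto_const] filterlim_at_top_imp_at_infinity
            filterlim_compose[OF sqrt_at_top filterlim_real_sequentially])
      then show ?thesis using that by (rule order_tendstoD(2))
    qed
    have "eventually (\<lambda>n. n > 0 \<and> \<sigma> * K / sqrt (real n) < e2 \<and> U2 / sqrt (real n) < e
        \<and> k1 / sqrt (real n) < \<epsilon> / 2 \<and> c2 / sqrt (real n) < lam * \<epsilon>\<^sup>2 / 16) sequentially"
      using C2(2) \<open>e > 0\<close> \<epsilon> lam(1)
      by (intro eventually_conj small eventually_gt_at_top) auto
    then show "eventually (linear_near_maximisers A B \<Xi>r \<xi>\<^sub>0 K \<epsilon> \<delta> e (min e (e1 / 2))) sequentially"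
    proof (rule eventually_mono, unfold linear_near_maximisers_def, intro allI impI, elim conjE)
      fix n :: nat and g :: "real^'n" and m :: "real^'n \<Rightarrow> real" and x :: "real^'n"
      define q where "q = sqrt (real n)"
      assume n: "n > 0" and large: "\<sigma> * K / sqrt (real n) < e2" "U2 / sqrt (real n) < e"
          "k1 / sqrt (real n) < \<epsilon> / 2" "c2 / sqrt (real n) < lam * \<epsilon>\<^sup>2 / 16"
        and g: "norm g \<le> K" and x: "x \<in> \<Xi>r" and near: "norm (x - \<xi>\<^sub>0) \<le> min e (e1 / 2)"
        and expansion: "\<forall>\<xi>\<in>cball \<xi>\<^sub>0 e. \<bar>quad_remainder A \<xi>\<^sub>0 n g m \<xi>\<bar> \<le> \<delta> * (norm (\<xi> - \<xi>\<^sub>0))\<^sup>2"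
        and near_max: "\<forall>\<xi>\<in>\<Xi>r. m \<xi> \<le> m x + \<delta> / real n"
      have q: "q \<ge> 1" "q\<^sup>2 = real n" "q > 0" using n by (auto simp: q_def)
      define u where "u \<xi> = q *\<^sub>R (\<xi> - \<xi>\<^sub>0)" for \<xi>
      have u_norm: "norm (u \<xi>) = q * norm (\<xi> - \<xi>\<^sub>0)" for \<xi> using q by (simp add: u_def)
      have scaled: "\<bar>real n * (m \<xi> - m \<xi>\<^sub>0) - ?quad g (u \<xi>)\<bar> \<le> \<delta> * (norm (u \<xi>))\<^sup>2"
        if "norm (\<xi> - \<xi>\<^sub>0) \<le> e" for \<xi>
      proof -
        let ?R = "quad_remainder A \<xi>\<^sub>0 n g m \<xi>"
        have "\<bar>?R\<bar> \<le> \<delta> * (norm (\<xi> - \<xi>\<^sub>0))\<^sup>2"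
          using expansion that by (auto simp: dist_norm norm_minus_commute)
        then have "q\<^sup>2 * \<bar>?R\<bar> \<le> q\<^sup>2 * (\<delta> * (norm (\<xi> - \<xi>\<^sub>0))\<^sup>2)" by (rule mult_left_mono) simp
        moreover have "q\<^sup>2 * ?R = real n * (m \<xi> - m \<xi>\<^sub>0) - ?quad g (u \<xi>)"
        proof -
          have 1: "g \<bullet> u \<xi> = q * (g \<bullet> (\<xi> - \<xi>\<^sub>0))"
            by (simp only: u_def inner_scaleR_right)
          have 2: "u \<xi> \<bullet> (A *v u \<xi>) = q\<^sup>2 * ((\<xi> - \<xi>\<^sub>0) \<bullet> (A *v (\<xi> - \<xi>\<^sub>0)))"
            by (simp only: u_def matrix_vector_mult_scaleR inner_scaleR_left inner_scaleR_right
                power2_eq_square mult.assoc)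
          have 3: "q\<^sup>2 * (d - l / q + a / 2) = q\<^sup>2 * d - (q * l - q\<^sup>2 * a / 2)" for d l a
            using q(3) by (simp add: field_simps power2_eq_square)
          show ?thesis unfolding quad_remainder_def q_def[symmetric] unfolding q(2)[symmetric] local_quadratic_def 1 2 by (rule 3)
        qed
        moreover have "q\<^sup>2 * \<bar>?R\<bar> = \<bar>q\<^sup>2 * ?R\<bar>" by (simp add: abs_mult)
        moreover have "q\<^sup>2 * (\<delta> * (norm (\<xi> - \<xi>\<^sub>0))\<^sup>2) = \<delta> * (norm (u \<xi>))\<^sup>2"
          by (simp add: u_norm power_mult_distrib)
        ultimately show ?thesis by simp
      qed
      have near_e: "norm (x - \<xi>\<^sub>0) \<le> e" using near by simp
      have max_n: "real n * (m \<xi> - m \<xi>\<^sub>0) - real n * (m x - m \<xi>\<^sub>0) \<le> \<delta>" if "\<xi> \<in> \<Xi>r" for \<xi>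
      proof -
        have "m \<xi> - m x \<le> \<delta> / real n" using near_max that by force
        then have "(m \<xi> - m x) * real n \<le> \<delta>" using n by (simp add: pos_le_divide_eq)
        then show ?thesis by (simp add: algebra_simps)
      qed
      \<comment> \<open>Comparison with \<open>\<xi>\<^sub>0\<close> bounds the rescaled near-maximiser.\<close>
      have u_bound: "norm (u x) \<le> U"
      proof (cases "norm (u x) \<le> 1")
        case False
        have "- \<delta> \<le> real n * (m x - m \<xi>\<^sub>0)" using max_n[OF centre] by simp
        also have "\<dots> \<le> ?quad g (u x) + \<delta> * (norm (u x))\<^sup>2"
          using scaled[OF near_e] by linarith
        also have "?quad g (u x) \<le> K * norm (u x) - lam * (norm (u x))\<^sup>2 / 2"
        proof -
          have "g \<bullet> u x \<le> norm g * norm (u x)" by (rule norm_cauchy_schwarz)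
          also have "\<dots> \<le> K * norm (u x)" using g by (rule mult_right_mono) simp
          finally show ?thesis using lam(2)[of "u x"] by (simp add: local_quadratic_def)
        qed
        also have "\<delta> * (norm (u x))\<^sup>2 \<le> lam / 8 * (norm (u x))\<^sup>2" using \<delta>(3) by (rule mult_right_mono) simp
        finally have "3 * lam / 8 * (norm (u x))\<^sup>2 \<le> K * norm (u x) + \<delta>" by simp
        also have "\<dots> \<le> K * norm (u x) + 1 * norm (u x)" using False \<delta>(2) by simp
        finally have "(3 * lam / 8 * norm (u x)) * norm (u x) \<le> (K + 1) * norm (u x)"
          by (simp add: power2_eq_square algebra_simps)
        then have "3 * lam / 8 * norm (u x) \<le> K + 1"
          by (rule mult_right_le_imp_le) (use False in linarith)
        then show ?thesis using lam(1) by (simp add: U_def field_simps)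
      qed (use pos in linarith)
      obtain s where s: "norm (x - \<xi>\<^sub>0 - D *v s) \<le> C1 * (norm (x - \<xi>\<^sub>0))\<^sup>2"
        using tangent[OF x] near C1(2) by auto
      define t where "t = D *v (q *\<^sub>R s)"
      have ut: "norm (u x - t) \<le> k1 / q"
      proof -
        have "u x - t = q *\<^sub>R (x - \<xi>\<^sub>0 - D *v s)"
          by (simp add: u_def t_def matrix_vector_mult_scaleR scaleR_right_diff_distrib)
        then have "norm (u x - t) = q * norm (x - \<xi>\<^sub>0 - D *v s)" using q by simp
        also have "\<dots> \<le> q * (C1 * (norm (x - \<xi>\<^sub>0))\<^sup>2)" using s q by (intro mult_left_mono) auto
        also have "\<dots> = C1 * (norm (u x))\<^sup>2 / q"
          using q(3) by (simp add: u_norm power2_eq_square)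
        also have "\<dots> \<le> C1 * U\<^sup>2 / q"
          using u_bound q(3) C1(1) by (intro divide_right_mono mult_left_mono power_mono) auto
        finally show ?thesis by (simp add: k1_def)
      qed
      have k1q: "k1 / q \<le> k1" "k2 / q \<le> k2"
        using pos q by (simp_all add: divide_le_eq mult_le_cancel_left1)
      have t_bound: "norm t \<le> U + k1"
        using norm_triangle_sub[of t "u x"] ut u_bound k1q by (simp add: norm_minus_commute)
      \<comment> \<open>The competitor: a point of the constraint set that, rescaled, is close to \<open>B g = D w\<close>.\<close>
      define w where "w = (Gi ** transpose D) *v g"
      have w: "norm w \<le> \<sigma> * K"
        using \<sigma>(2)[of g] mult_left_mono[OF g \<sigma>(1)] by (simp add: w_def)
      have Dw: "D *v w = B *v g" by (simp add: w_def B_def matrix_vector_mul_assoc matrix_mul_assoc)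
      have "norm (w /\<^sub>R q) \<le> \<sigma> * K / q" using w q by (simp add: divide_inverse_commute mult.commute)
      then have "norm (w /\<^sub>R q) < e2" using large by (simp add: q_def)
      then obtain y where y: "y \<in> \<Xi>r" "norm (y - \<xi>\<^sub>0 - D *v (w /\<^sub>R q)) \<le> C2 * (norm (w /\<^sub>R q))\<^sup>2"
        using curve by blast
      have uy: "norm (u y - B *v g) \<le> k2 / q"
      proof -
        have "u y - B *v g = q *\<^sub>R (y - \<xi>\<^sub>0 - D *v (w /\<^sub>R q))"
          using q(3) by (simp add: u_def Dw[symmetric] matrix_vector_mult_scaleR scaleR_right_diff_distrib)
        then have "norm (u y - B *v g) = q * norm (y - \<xi>\<^sub>0 - D *v (w /\<^sub>R q))" using q by simp
        also have "\<dots> \<le> q * (C2 * (norm (w /\<^sub>R q))\<^sup>2)" using y(2) q by (intro mult_left_mono) auto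
        also have "\<dots> = C2 * (norm w)\<^sup>2 / q"
          using q(3) by (simp add: power2_eq_square divide_inverse)
        also have "\<dots> \<le> C2 * (\<sigma> * K)\<^sup>2 / q"
          using w q(3) C2(1) by (intro divide_right_mono mult_left_mono power_mono) auto
        finally show ?thesis by (simp add: k2_def)
      qed
      have Bg: "norm (B *v g) \<le> b * K" using b(2)[of g] mult_left_mono[OF g b(1)] by linarith
      have uy_bound: "norm (u y) \<le> U2"
        using norm_triangle_sub[of "u y" "B *v g"] uy Bg k1q by (simp add: U2_def)
      have y_near: "norm (y - \<xi>\<^sub>0) \<le> e"
      proof -
        have "norm (y - \<xi>\<^sub>0) = norm (u y) / q" using q by (simp add: u_norm)
        also have "\<dots> \<le> U2 / q" using uy_bound q by (intro divide_right_mono) auto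
        finally show ?thesis using large by (simp add: q_def)
      qed
      have "?quad g (u y) - ?quad g (u x) \<le> \<delta> + \<delta> * (norm (u y))\<^sup>2 + \<delta> * (norm (u x))\<^sup>2"
        using scaled[OF y_near] scaled[OF near_e] max_n[OF y(1)] by linarith
      also have "\<dots> \<le> \<delta> + \<delta> * U2\<^sup>2 + \<delta> * U\<^sup>2"
        using u_bound uy_bound \<delta>(1) by (intro add_mono mult_left_mono power_mono order_refl) auto
      also have "\<dots> = \<delta> * c1" by (simp add: c1_def algebra_simps)
      finally have gap1: "?quad g (u y) - ?quad g (u x) \<le> \<delta> * c1" .
      have gap2: "\<bar>?quad g (u x) - ?quad g t\<bar> \<le> k1 / q * (K + \<alpha> * (2 * U + k1))"
      proof -
        have "\<bar>?quad g (u x) - ?quad g t\<bar> \<le> norm (u x - t) * (K + \<alpha> * (norm (u x) + norm t))"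
          by (rule local_quadratic_Lipschitz[OF \<alpha>(2) g])
        also have "\<dots> \<le> k1 / q * (K + \<alpha> * (2 * U + k1))"
        proof (intro mult_mono ut add_left_mono mult_left_mono)
          show "norm (u x) + norm t \<le> 2 * U + k1" using u_bound t_bound by simp
        qed (use \<alpha>(1) K pos q in auto)
        finally show ?thesis .
      qed
      have gap3: "\<bar>?quad g (u y) - ?quad g (B *v g)\<bar> \<le> k2 / q * (K + \<alpha> * (2 * U2))"
      proof -
        have "\<bar>?quad g (u y) - ?quad g (B *v g)\<bar> \<le> norm (u y - B *v g) * (K + \<alpha> * (norm (u y) + norm (B *v g)))"
          by (rule local_quadratic_Lipschitz[OF \<alpha>(2) g])
        also have "\<dots> \<le> k2 / q * (K + \<alpha> * (2 * U2))"
        proof (intro mult_mono uy add_left_mono mult_left_mono)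
          have "norm (B *v g) \<le> U2" using Bg pos by (simp add: U2_def)
          then show "norm (u y) + norm (B *v g) \<le> 2 * U2" using uy_bound by simp
        qed (use \<alpha>(1) K pos q in auto)
        finally show ?thesis .
      qed
      have "k1 / q * (K + \<alpha> * (2 * U + k1)) + k2 / q * (K + \<alpha> * (2 * U2)) = c2 / q"
        by (simp add: c2_def add_divide_distrib)
      then have "?quad g (B *v g) - ?quad g t \<le> \<delta> * c1 + c2 / q"
        using gap1 gap2 gap3 by linarith
      moreover have "?quad g (B *v g) - ?quad g t = ((B *v g - t) \<bullet> (A *v (B *v g - t))) / 2"
        unfolding t_def B_def by (rule local_quadratic_gap[OF sym _ gi]) (rule pd)
      ultimately have "((B *v g - t) \<bullet> (A *v (B *v g - t))) / 2 \<le> \<delta> * c1 + c2 / q" by simp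
      then have "lam * (norm (B *v g - t))\<^sup>2 \<le> 2 * (\<delta> * c1 + c2 / q)"
        using lam(2)[of "B *v g - t"] by argo
      then have "(norm (B *v g - t))\<^sup>2 \<le> 2 * (\<delta> * c1 + c2 / q) / lam"
        using lam(1) by (simp add: pos_le_divide_eq mult.commute)
      also have "\<dots> = 2 * \<delta> * c1 / lam + 2 * (c2 / q) / lam" by (simp add: add_divide_distrib distrib_left)
      also have "\<dots> \<le> \<epsilon>\<^sup>2 / 8 + 2 * (lam * \<epsilon>\<^sup>2 / 16) / lam"
        using large lam(1) by (intro add_mono \<delta>(4) divide_right_mono mult_left_mono) (auto simp: q_def)
      also have "\<dots> = (\<epsilon> / 2)\<^sup>2" using lam(1) by (simp add: power_divide)
      finally have "norm (B *v g - t) \<le> \<epsilon> / 2" using \<epsilon> by (simp add: power2_le_iff_abs_le)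
      moreover have "norm (u x - t) \<le> \<epsilon> / 2" using ut large unfolding q_def by linarith
      moreover have "norm (u x - B *v g) \<le> norm (u x - t) + norm (B *v g - t)"
        using norm_triangle_ineq4[of "u x - t" "B *v g - t"] by simp
      ultimately show "norm (sqrt (real n) *\<^sub>R (x - \<xi>\<^sub>0) - B *v g) \<le> \<epsilon>"
        unfolding u_def q_def by linarith
    qed
  qed
  then show ?thesis using \<delta>(1) by blast
qed

section \<open>Laws of large numbers for independent copies\<close>

lemma (in prob_space) prob_tendsto_zeroI:
  assumes "\<And>r. r > 0 \<Longrightarrow> eventually (\<lambda>n. prob (E n) < r) sequentially"
  shows "(\<lambda>n. prob (E n)) \<longlonglongrightarrow> 0"
  by (rule order_tendstoI) (auto intro: always_eventually less_le_trans[OF _ measure_nonneg] assms)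

text \<open>A sequence \<open>Z\<close> of independent random elements with common law \<open>Q\<close>.\<close>

locale iid_copies = prob_space M
  for M :: "'w measure" and Z :: "nat \<Rightarrow> 'w \<Rightarrow> 'z::topological_space" and Q :: "'z measure" +
  assumes Z_indep: "indep_vars (\<lambda>_. borel) Z UNIV"
    and Z_distr: "\<And>i. distr M borel (Z i) = Q"
begin

lemma Z_measurable [measurable]: "Z i \<in> borel_measurable M"
  using Z_indep by (auto simp: indep_vars_def)

lemma sets_Q [measurable_cong]: "sets Q = sets borel"
  using Z_distr[of 0] by (metis sets_distr)

lemma prob_space_Q: "prob_space Q"
  using Z_distr[of 0] prob_space_distr[OF Z_measurable] by metis

lemma integrable_Z_iff:
  fixes f :: "'z \<Rightarrow> 'b::{banach, second_countable_topology}"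
  assumes "f \<in> borel_measurable borel"
  shows "integrable M (\<lambda>\<omega>. f (Z i \<omega>)) \<longleftrightarrow> integrable Q f"
  using assms by (subst Z_distr[of i, symmetric]) (simp add: integrable_distr_eq)

lemma integral_Z_eq:
  fixes f :: "'z \<Rightarrow> 'b::{banach, second_countable_topology}"
  assumes "f \<in> borel_measurable borel"
  shows "(\<integral>\<omega>. f (Z i \<omega>) \<partial>M) = integral\<^sup>L Q f"
  using assms by (subst Z_distr[of i, symmetric]) (simp add: integral_distr)

lemma distr_Z_compose:
  assumes "f \<in> measurable borel N"
  shows "distr M N (\<lambda>\<omega>. f (Z i \<omega>)) = distr Q N f"
  using assms by (subst Z_distr[of i, symmetric]) (simp add: distr_distr comp_def)

lemma indep_compose:
  assumes "f \<in> borel_measurable borel"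
  shows "indep_vars (\<lambda>_. borel) (\<lambda>i \<omega>. f (Z i \<omega>)) UNIV"
  using indep_vars_compose2[OF Z_indep, of "\<lambda>_. f"] assms by simp

lemma second_moment_sum:
  fixes f :: "'z \<Rightarrow> real"
  assumes [measurable]: "f \<in> borel_measurable borel"
    and sq: "integrable Q (\<lambda>z. (f z)\<^sup>2)" and mean: "integral\<^sup>L Q f = 0"
  shows "integrable M (\<lambda>\<omega>. (\<Sum>i<n. f (Z i \<omega>))\<^sup>2)"
    and "(\<integral>\<omega>. (\<Sum>i<n. f (Z i \<omega>))\<^sup>2 \<partial>M) = real n * (\<integral>z. (f z)\<^sup>2 \<partial>Q)"
proof -
  interpret Q: prob_space Q by (rule prob_space_Q)
  have fi: "integrable Q f"
    by (rule Q.square_integrable_imp_integrable[OF _ sq]) measurable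
  have fZ: "integrable M (\<lambda>\<omega>. f (Z i \<omega>))" for i
    using fi by (simp add: integrable_Z_iff)
  have sqZ: "integrable M (\<lambda>\<omega>. (f (Z i \<omega>))\<^sup>2)" for i
    using sq integrable_Z_iff[of "\<lambda>z. (f z)\<^sup>2" i] by simp
  have indep: "indep_var borel (\<lambda>\<omega>. f (Z i \<omega>)) borel (\<lambda>\<omega>. f (Z j \<omega>))" if "i \<noteq> j" for i j
    using indep_vars_sum[of "{j}" i, OF _ _ indep_vars_subset[OF indep_compose[OF assms(1)]]] that by simp
  have prod: "integrable M (\<lambda>\<omega>. f (Z i \<omega>) * f (Z j \<omega>))"
    "(\<integral>\<omega>. f (Z i \<omega>) * f (Z j \<omega>) \<partial>M) = (if i = j then \<integral>z. (f z)\<^sup>2 \<partial>Q else 0)" for i j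
  proof -
    show "integrable M (\<lambda>\<omega>. f (Z i \<omega>) * f (Z j \<omega>))"
      using sqZ[of i] indep_var_integrable[OF indep fZ fZ, of i j]
      by (cases "i = j") (auto simp: power2_eq_square)
    show "(\<integral>\<omega>. f (Z i \<omega>) * f (Z j \<omega>) \<partial>M) = (if i = j then \<integral>z. (f z)\<^sup>2 \<partial>Q else 0)"
      using integral_Z_eq[of "\<lambda>z. (f z)\<^sup>2" i] indep_var_lebesgue_integral[OF indep fZ fZ, of i j]
        integral_Z_eq[of f] mean
      by (cases "i = j") (auto simp: power2_eq_square)
  qed
  have eq: "(\<Sum>i<n. f (Z i \<omega>))\<^sup>2 = (\<Sum>i<n. \<Sum>j<n. f (Z i \<omega>) * f (Z j \<omega>))" for \<omega>
    by (simp add: power2_eq_square sum_product)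
  show "integrable M (\<lambda>\<omega>. (\<Sum>i<n. f (Z i \<omega>))\<^sup>2)"
    unfolding eq by (intro Bochner_Integration.integrable_sum prod)
  show "(\<integral>\<omega>. (\<Sum>i<n. f (Z i \<omega>))\<^sup>2 \<partial>M) = real n * (\<integral>z. (f z)\<^sup>2 \<partial>Q)"
    unfolding eq by (simp add: prod Bochner_Integration.integrable_sum if_distrib cong: if_cong)
qed

lemma Chebyshev_mean:
  fixes f :: "'z \<Rightarrow> real"
  assumes [measurable]: "f \<in> borel_measurable borel"
    and sq: "integrable Q (\<lambda>z. (f z)\<^sup>2)" and mean: "integral\<^sup>L Q f = 0" and "\<epsilon> > 0" "n > 0"
  shows "prob {\<omega> \<in> space M. \<bar>(\<Sum>i<n. f (Z i \<omega>)) / real n\<bar> \<ge> \<epsilon>} \<le> (\<integral>z. (f z)\<^sup>2 \<partial>Q) / (real n * \<epsilon>\<^sup>2)"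
proof -
  have "{\<omega> \<in> space M. \<bar>(\<Sum>i<n. f (Z i \<omega>)) / real n\<bar> \<ge> \<epsilon>}
      = {\<omega> \<in> space M. (\<Sum>i<n. f (Z i \<omega>))\<^sup>2 \<ge> (real n * \<epsilon>)\<^sup>2}" (is "?A = _")
    using \<open>\<epsilon> > 0\<close> \<open>n > 0\<close> abs_le_square_iff[of "real n * \<epsilon>"]
    by (auto simp: abs_divide field_simps abs_mult)
  also have "prob \<dots> \<le> (\<integral>\<omega>. (\<Sum>i<n. f (Z i \<omega>))\<^sup>2 \<partial>M) / (real n * \<epsilon>)\<^sup>2"
    by (rule integral_Markov_inequality_measure[where A = "{}"])
      (use second_moment_sum(1)[OF assms(1-3)] \<open>\<epsilon> > 0\<close> \<open>n > 0\<close> in auto)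
  also have "\<dots> = (\<integral>z. (f z)\<^sup>2 \<partial>Q) / (real n * \<epsilon>\<^sup>2)"
    using \<open>n > 0\<close> by (simp add: second_moment_sum(2)[OF assms(1-3)] power_mult_distrib power2_eq_square[of "real n"])
  finally show ?thesis .
qed

text \<open>The weak law of large numbers under a first moment only, by truncation: the truncated
  part obeys Chebyshev's inequality, and the remainder is small in \<open>L\<^sup>1\<close>.\<close>

lemma weak_law_real:
  fixes f :: "'z \<Rightarrow> real"
  assumes [measurable]: "f \<in> borel_measurable borel" and int: "integrable Q f"
  shows "conv_in_prob M (\<lambda>n \<omega>. (\<Sum>i<n. f (Z i \<omega>)) / real n) (integral\<^sup>L Q f)"
  unfolding conv_in_prob_def
proof (intro allI impI)
  fix \<epsilon> :: real assume "\<epsilon> > 0"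
  interpret Q: prob_space Q by (rule prob_space_Q)
  let ?P = "\<lambda>n. prob {\<omega> \<in> space M. dist ((\<Sum>i<n. f (Z i \<omega>)) / real n) (integral\<^sup>L Q f) > \<epsilon>}"
  define fc where "fc c z = (if \<bar>f z\<bar> \<le> c then f z else 0)" for c z
  have fc_meas [measurable]: "fc c \<in> borel_measurable borel" for c
    unfolding fc_def by measurable
  have fc_int: "integrable Q (fc c)" for c
    by (rule Bochner_Integration.integrable_bound[OF int]) (auto simp: fc_def)
  have tail: "(\<lambda>c::nat. \<integral>z. \<bar>f z - fc (real c) z\<bar> \<partial>Q) \<longlonglongrightarrow> (\<integral>z. 0 \<partial>Q)"
  proof (rule integral_dominated_convergence[where w = "\<lambda>z. \<bar>f z\<bar>"])
    show "AE z in Q. (\<lambda>c::nat. \<bar>f z - fc (real c) z\<bar>) \<longlonglongrightarrow> 0"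
    proof (rule AE_I2)
      fix z
      have "eventually (\<lambda>c::nat. \<bar>f z\<bar> \<le> real c) sequentially"
        using eventually_ge_at_top[of "nat \<lceil>\<bar>f z\<bar>\<rceil>"] by eventually_elim linarith
      then have "eventually (\<lambda>c::nat. \<bar>f z - fc (real c) z\<bar> = 0) sequentially"
        by eventually_elim (simp add: fc_def)
      then show "(\<lambda>c::nat. \<bar>f z - fc (real c) z\<bar>) \<longlonglongrightarrow> 0" by (rule tendsto_eventually)
    qed
  qed (use int in \<open>auto simp: fc_def\<close>)
  have tail0: "(\<lambda>c::nat. \<integral>z. \<bar>f z - fc (real c) z\<bar> \<partial>Q) \<longlonglongrightarrow> 0"
    using tail by simp
  show "?P \<longlonglongrightarrow> 0"
  proof (rule prob_tendsto_zeroI)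
    fix r :: real assume "r > 0"
    \<comment> \<open>A bound \<open>e\<close> on the mean of the tail: \<open>\<epsilon> / 4\<close> absorbs the shift of the mean, and Markov's inequality
      at level \<open>\<epsilon> / 4\<close> turns \<open>\<epsilon> r / 16\<close> into a probability of at most \<open>r / 4\<close>.\<close>
    define e where "e = min (\<epsilon> / 4) (\<epsilon> * r / 16)"
    have "e > 0" using \<open>\<epsilon> > 0\<close> \<open>r > 0\<close> by (simp add: e_def)
    then obtain c :: nat where c: "(\<integral>z. \<bar>f z - fc (real c) z\<bar> \<partial>Q) < e"
      using order_tendstoD(2)[OF tail0 \<open>e > 0\<close>] by (auto simp: eventually_sequentially)
    define h where "h = fc (real c)"
    define k where "k z = f z - h z" for z
    have [measurable]: "h \<in> borel_measurable borel" "k \<in> borel_measurable borel"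
      by (simp_all add: h_def k_def[abs_def])
    have h_int: "integrable Q h" by (simp add: h_def fc_int)
    have k_int: "integrable Q k" using int h_int by (simp add: k_def[abs_def])
    have k_small: "(\<integral>z. \<bar>k z\<bar> \<partial>Q) < e" using c by (simp add: k_def h_def)
    define \<mu> where "\<mu> = integral\<^sup>L Q h"
    have h_bound: "\<bar>h z\<bar> \<le> real c" for z by (simp add: h_def fc_def)
    have \<mu>_bound: "\<bar>\<mu>\<bar> \<le> real c"
    proof -
      have "\<bar>\<mu>\<bar> \<le> (\<integral>z. \<bar>h z\<bar> \<partial>Q)" unfolding \<mu>_def by (rule integral_abs_bound)
      also have "\<dots> \<le> (\<integral>z. real c \<partial>Q)"
        by (rule integral_mono) (use h_int h_bound in auto)
      finally show ?thesis by (simp add: Q.prob_space)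
    qed
    define h' where "h' z = h z - \<mu>" for z
    have [measurable]: "h' \<in> borel_measurable borel" by (simp add: h'_def[abs_def])
    have h'_bound: "\<bar>h' z\<bar> \<le> 2 * real c" for z
      using h_bound[of z] \<mu>_bound by (simp add: h'_def)
    have sq_bound: "(h' z)\<^sup>2 \<le> (2 * real c)\<^sup>2" for z
      using h'_bound[of z] by (metis abs_ge_zero power2_abs power_mono)
    have h'_sq: "integrable Q (\<lambda>z. (h' z)\<^sup>2)"
    proof (rule Q.integrable_const_bound[where B = "(2 * real c)\<^sup>2"])
      show "AE z in Q. norm ((h' z)\<^sup>2) \<le> (2 * real c)\<^sup>2"
        using sq_bound by (intro AE_I2) simp
    qed measurable
    have h'_mean: "integral\<^sup>L Q h' = 0"
      using h_int by (simp add: h'_def[abs_def] \<mu>_def Q.prob_space)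
    define v where "v = (\<integral>z. (h' z)\<^sup>2 \<partial>Q)"
    have bound: "?P n \<le> v / (real n * (\<epsilon>/4)\<^sup>2) + r / 4" if "n > 0" for n
    proof -
      let ?H = "{\<omega> \<in> space M. \<bar>(\<Sum>i<n. h' (Z i \<omega>)) / real n\<bar> \<ge> \<epsilon>/4}"
      let ?K = "{\<omega> \<in> space M. (\<Sum>i<n. \<bar>k (Z i \<omega>)\<bar>) \<ge> real n * (\<epsilon> / 4)}"
      have \<mu>_diff: "\<bar>\<mu> - integral\<^sup>L Q f\<bar> \<le> \<epsilon> / 4"
      proof -
        have "\<mu> - integral\<^sup>L Q f = - integral\<^sup>L Q k"
          using int h_int by (simp add: \<mu>_def k_def[abs_def])
        then have "\<bar>\<mu> - integral\<^sup>L Q f\<bar> = \<bar>integral\<^sup>L Q k\<bar>" by simp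
        also have "\<dots> \<le> (\<integral>z. \<bar>k z\<bar> \<partial>Q)" by (rule integral_abs_bound)
        also have "\<dots> \<le> \<epsilon> / 4" using k_small by (simp add: e_def)
        finally show ?thesis .
      qed
      have "{\<omega> \<in> space M. dist ((\<Sum>i<n. f (Z i \<omega>)) / real n) (integral\<^sup>L Q f) > \<epsilon>} \<subseteq> ?H \<union> ?K"
      proof (rule subsetI, rule ccontr)
        fix \<omega> assume *: "\<omega> \<in> {\<omega> \<in> space M. dist ((\<Sum>i<n. f (Z i \<omega>)) / real n) (integral\<^sup>L Q f) > \<epsilon>}"
          "\<omega> \<notin> ?H \<union> ?K"
        have "(\<Sum>i<n. f (Z i \<omega>)) = (\<Sum>i<n. h' (Z i \<omega>)) + real n * \<mu> + (\<Sum>i<n. k (Z i \<omega>))"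
          by (simp add: h'_def k_def sum.distrib sum_subtractf)
        then have "(\<Sum>i<n. f (Z i \<omega>)) / real n - integral\<^sup>L Q f
          = (\<Sum>i<n. h' (Z i \<omega>)) / real n + (\<Sum>i<n. k (Z i \<omega>)) / real n + (\<mu> - integral\<^sup>L Q f)"
          using that by (simp add: field_simps)
        moreover have "\<bar>(\<Sum>i<n. k (Z i \<omega>)) / real n\<bar> \<le> (\<Sum>i<n. \<bar>k (Z i \<omega>)\<bar>) / real n"
          using that by (auto simp: abs_divide intro!: divide_right_mono)
        moreover have "(\<Sum>i<n. \<bar>k (Z i \<omega>)\<bar>) / real n < \<epsilon> / 4"
          using * that by (auto simp: field_simps not_le)
        moreover have "\<bar>(\<Sum>i<n. h' (Z i \<omega>)) / real n\<bar> < \<epsilon> / 4" using * by auto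
        moreover have "\<bar>(\<Sum>i<n. f (Z i \<omega>)) / real n - integral\<^sup>L Q f\<bar> > \<epsilon>"
          using * by (simp add: dist_real_def)
        ultimately show False using \<mu>_diff \<open>\<epsilon> > 0\<close> by linarith
      qed
      then have "?P n \<le> prob (?H \<union> ?K)" by (intro finite_measure_mono) measurable
      also have "\<dots> \<le> prob ?H + prob ?K" by (intro measure_Un_le) measurable
      also have "prob ?H \<le> v / (real n * (\<epsilon>/4)\<^sup>2)"
        unfolding v_def using Chebyshev_mean[OF _ h'_sq h'_mean _ that, of "\<epsilon>/4"] \<open>\<epsilon> > 0\<close> by simp
      also have "prob ?K \<le> (\<integral>\<omega>. (\<Sum>i<n. \<bar>k (Z i \<omega>)\<bar>) \<partial>M) / (real n * (\<epsilon> / 4))"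
      proof (rule integral_Markov_inequality_measure[where A = "{}"])
        show "integrable M (\<lambda>\<omega>. \<Sum>i<n. \<bar>k (Z i \<omega>)\<bar>)"
          using k_int by (intro Bochner_Integration.integrable_sum integrable_abs)
            (simp add: integrable_Z_iff)
      qed (use that \<open>\<epsilon> > 0\<close> in \<open>auto intro: sum_nonneg\<close>)
      also have "(\<integral>\<omega>. (\<Sum>i<n. \<bar>k (Z i \<omega>)\<bar>) \<partial>M) = real n * (\<integral>z. \<bar>k z\<bar> \<partial>Q)"
      proof -
        have "integrable M (\<lambda>\<omega>. \<bar>k (Z i \<omega>)\<bar>)" for i
          using k_int by (intro integrable_abs) (simp add: integrable_Z_iff)
        then show ?thesis by (simp add: integral_Z_eq[of "\<lambda>z. \<bar>k z\<bar>"])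
      qed
      also have "real n * (\<integral>z. \<bar>k z\<bar> \<partial>Q) / (real n * (\<epsilon> / 4)) = (\<integral>z. \<bar>k z\<bar> \<partial>Q) * 4 / \<epsilon>"
        using that by simp
      also have "\<dots> \<le> r / 4"
        using k_small \<open>\<epsilon> > 0\<close> by (simp add: e_def field_simps)
      finally show ?thesis by simp
    qed
    have "(\<lambda>n. v / (real n * (\<epsilon>/4)\<^sup>2)) \<longlonglongrightarrow> 0"
      by (intro tendsto_divide_0[OF tendsto_const] filterlim_at_top_imp_at_infinity
          filterlim_at_top_mult_tendsto_pos[OF tendsto_const] filterlim_real_sequentially)
        (use \<open>\<epsilon> > 0\<close> in auto)
    then have "eventually (\<lambda>n. v / (real n * (\<epsilon>/4)\<^sup>2) < r / 4) sequentially"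
      by (rule order_tendstoD(2)) (use \<open>r > 0\<close> in simp)
    moreover note eventually_gt_at_top[of "0::nat"]
    ultimately show "eventually (\<lambda>n. ?P n < r) sequentially"
    proof eventually_elim
      case (elim n)
      then show ?case using bound[of n] \<open>r > 0\<close> by linarith
    qed
  qed
qed

lemma weak_law:
  fixes f :: "'z \<Rightarrow> 'b::euclidean_space"
  assumes [measurable]: "f \<in> borel_measurable borel" and int: "integrable Q f"
  shows "conv_in_prob M (\<lambda>n \<omega>. (\<Sum>i<n. f (Z i \<omega>)) /\<^sub>R real n) (integral\<^sup>L Q f)"
  unfolding conv_in_prob_def
proof (intro allI impI)
  fix \<epsilon> :: real assume "\<epsilon> > 0"
  let ?V = "\<lambda>n \<omega>. (\<Sum>i<n. f (Z i \<omega>)) /\<^sub>R real n"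
  let ?e = "\<epsilon> / real DIM('b)"
  let ?A = "\<lambda>n b. {\<omega> \<in> space M. dist ((\<Sum>i<n. f (Z i \<omega>) \<bullet> b) / real n) (\<integral>z. f z \<bullet> b \<partial>Q) > ?e}"
  have "(\<lambda>n. prob (?A n b)) \<longlonglongrightarrow> 0" if "b \<in> Basis" for b
  proof -
    have "?e > 0" using \<open>\<epsilon> > 0\<close> by simp
    with weak_law_real[of "\<lambda>z. f z \<bullet> b"] int show ?thesis
      unfolding conv_in_prob_def by auto
  qed
  then have lim: "(\<lambda>n. \<Sum>b\<in>Basis. prob (?A n b)) \<longlonglongrightarrow> 0"
    by (intro tendsto_null_sum) auto
  have bound: "prob {\<omega> \<in> space M. dist (?V n \<omega>) (integral\<^sup>L Q f) > \<epsilon>} \<le> (\<Sum>b\<in>Basis. prob (?A n b))" for n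
  proof -
    have "{\<omega> \<in> space M. dist (?V n \<omega>) (integral\<^sup>L Q f) > \<epsilon>} \<subseteq> (\<Union>b\<in>Basis. ?A n b)"
    proof (rule subsetI, rule ccontr)
      fix \<omega> assume *: "\<omega> \<in> {\<omega> \<in> space M. dist (?V n \<omega>) (integral\<^sup>L Q f) > \<epsilon>}"
        "\<omega> \<notin> (\<Union>b\<in>Basis. ?A n b)"
      have "norm (?V n \<omega> - integral\<^sup>L Q f) \<le> (\<Sum>b\<in>Basis. \<bar>(?V n \<omega> - integral\<^sup>L Q f) \<bullet> b\<bar>)"
        by (rule norm_le_l1)
      also have "\<dots> \<le> (\<Sum>b\<in>(Basis::'b set). ?e)"
      proof (rule sum_mono)
        fix b :: 'b assume "b \<in> Basis"
        moreover have "(?V n \<omega> - integral\<^sup>L Q f) \<bullet> b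
            = (\<Sum>i<n. f (Z i \<omega>) \<bullet> b) / real n - (\<integral>z. f z \<bullet> b \<partial>Q)"
          using int by (simp add: inner_diff_left inner_sum_left divide_inverse mult.commute)
        ultimately show "\<bar>(?V n \<omega> - integral\<^sup>L Q f) \<bullet> b\<bar> \<le> ?e"
          using * by (auto simp: dist_real_def not_less)
      qed
      also have "\<dots> = \<epsilon>" by simp
      finally show False using * by (simp add: dist_norm)
    qed
    then have "prob {\<omega> \<in> space M. dist (?V n \<omega>) (integral\<^sup>L Q f) > \<epsilon>} \<le> prob (\<Union>b\<in>Basis. ?A n b)"
      by (intro finite_measure_mono sets.finite_UN) auto
    also have "\<dots> \<le> (\<Sum>b\<in>Basis. prob (?A n b))"
      by (intro finite_measure_subadditive_finite) (auto simp: image_subset_iff)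
    finally show ?thesis .
  qed
  show "(\<lambda>n. prob {\<omega> \<in> space M. dist (?V n \<omega>) (integral\<^sup>L Q f) > \<epsilon>}) \<longlonglongrightarrow> 0"
    by (rule tendsto_sandwich[OF _ _ tendsto_const lim]) (use bound in auto)
qed

end

section \<open>Events of probability tending to one\<close>

text \<open>The property \<open>P n\<close> holds with probability tending to one: the exceptional set is contained in
  events whose probabilities vanish, so that \<open>P n\<close> itself need not be measurable.\<close>

definition whp :: "'w measure \<Rightarrow> (nat \<Rightarrow> 'w \<Rightarrow> bool) \<Rightarrow> bool" where
  "whp M P \<longleftrightarrow> (\<exists>B. (\<forall>n. B n \<in> sets M) \<and> (\<lambda>n. measure M (B n)) \<longlonglongrightarrow> 0 \<and>
     (\<forall>n. \<forall>\<omega>\<in>space M - B n. P n \<omega>))"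

context prob_space
begin

lemma whp_conj:
  assumes "whp M P" "whp M P'" shows "whp M (\<lambda>n \<omega>. P n \<omega> \<and> P' n \<omega>)"
proof -
  obtain B where B: "\<And>n. B n \<in> events" "(\<lambda>n. prob (B n)) \<longlonglongrightarrow> 0" "\<And>n \<omega>. \<omega> \<in> space M - B n \<Longrightarrow> P n \<omega>"
    using assms(1) by (auto simp: whp_def)
  obtain B' where B': "\<And>n. B' n \<in> events" "(\<lambda>n. prob (B' n)) \<longlonglongrightarrow> 0" "\<And>n \<omega>. \<omega> \<in> space M - B' n \<Longrightarrow> P' n \<omega>"
    using assms(2) by (auto simp: whp_def)
  have "(\<lambda>n. prob (B n \<union> B' n)) \<longlonglongrightarrow> 0"
  proof (rule tendsto_sandwich[OF _ _ tendsto_const])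
    show "(\<lambda>n. prob (B n) + prob (B' n)) \<longlonglongrightarrow> 0" using tendsto_add[OF B(2) B'(2)] by simp
  qed (use B(1) B'(1) in \<open>auto intro!: always_eventually measure_Un_le\<close>)
  then show ?thesis
    unfolding whp_def using B B' by (intro exI[of _ "\<lambda>n. B n \<union> B' n"]) auto
qed

lemma whp_mono:
  assumes "whp M P" "eventually (\<lambda>n. \<forall>\<omega>\<in>space M. P n \<omega> \<longrightarrow> P' n \<omega>) sequentially"
  shows "whp M P'"
proof -
  obtain B where B: "\<And>n. B n \<in> events" "(\<lambda>n. prob (B n)) \<longlonglongrightarrow> 0" "\<And>n \<omega>. \<omega> \<in> space M - B n \<Longrightarrow> P n \<omega>"
    using assms(1) by (auto simp: whp_def)
  obtain N where N: "\<And>n \<omega>. n \<ge> N \<Longrightarrow> \<omega> \<in> space M \<Longrightarrow> P n \<omega> \<Longrightarrow> P' n \<omega>"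
    using assms(2) by (auto simp: eventually_sequentially)
  define B' where "B' n = (if n \<ge> N then B n else space M)" for n
  have "eventually (\<lambda>n. prob (B n) = prob (B' n)) sequentially"
    using eventually_ge_at_top[of N] by eventually_elim (simp add: B'_def)
  then have "(\<lambda>n. prob (B' n)) \<longlonglongrightarrow> 0" using B(2) by (rule Lim_transform_eventually[rotated])
  moreover have "B' n \<in> events" for n by (simp add: B'_def B(1))
  moreover have "P' n \<omega>" if "\<omega> \<in> space M - B' n" for n \<omega>
    using that N[of n \<omega>] B(3)[of \<omega> n] by (auto simp: B'_def split: if_splits)
  ultimately show ?thesis unfolding whp_def by blast
qed

lemma whpI:
  assumes "\<And>n. {\<omega> \<in> space M. \<not> P n \<omega>} \<in> events" "(\<lambda>n. prob {\<omega> \<in> space M. \<not> P n \<omega>}) \<longlonglongrightarrow> 0"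
  shows "whp M P"
  unfolding whp_def by (rule exI[of _ "\<lambda>n. {\<omega> \<in> space M. \<not> P n \<omega>}"]) (use assms in auto)

lemma whpD:
  assumes "whp M P" shows "(\<lambda>n. prob {\<omega> \<in> space M. \<not> P n \<omega>}) \<longlonglongrightarrow> 0"
proof -
  obtain B where B: "\<And>n. B n \<in> events" "(\<lambda>n. prob (B n)) \<longlonglongrightarrow> 0" "\<And>n \<omega>. \<omega> \<in> space M - B n \<Longrightarrow> P n \<omega>"
    using assms(1) by (auto simp: whp_def)
  have "prob {\<omega> \<in> space M. \<not> P n \<omega>} \<le> prob (B n)" for n
    using B by (intro finite_measure_mono) auto
  then show ?thesis by (intro tendsto_sandwich[OF _ _ tendsto_const B(2)]) auto
qed

lemma whp_conv_in_prob:
  assumes "conv_in_prob M V c" "\<And>n. V n \<in> borel_measurable M" "\<epsilon> > 0"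
  shows "whp M (\<lambda>n \<omega>. dist (V n \<omega>) (c :: 'b::{second_countable_topology, metric_space}) \<le> \<epsilon>)"
proof (rule whpI)
  show "{\<omega> \<in> space M. \<not> dist (V n \<omega>) c \<le> \<epsilon>} \<in> events" for n
    using assms(2)[of n] by measurable
  show "(\<lambda>n. prob {\<omega> \<in> space M. \<not> dist (V n \<omega>) c \<le> \<epsilon>}) \<longlonglongrightarrow> 0"
    using assms(1,3) by (simp add: conv_in_prob_def not_le)
qed

end

section \<open>Concave, locally quadratic random criteria\<close>

text \<open>A sequence of random concave criteria \<open>Mn n\<close> on a convex set, which near \<open>\<xi>\<^sub>0\<close> is quadratic with
  curvature \<open>A\<close> and linear coefficient \<open>G n / \<surd>n\<close>, up to \<open>o\<^sub>p(1) \<parallel>\<xi> - \<xi>\<^sub>0\<parallel>\<^sup>2\<close> on small balls.\<close>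

locale locally_quadratic_criterion = prob_space M
  for M :: "'w measure" +
  fixes Mn :: "nat \<Rightarrow> real^'n \<Rightarrow> 'w \<Rightarrow> real" and \<Xi> :: "(real^'n) set" and \<xi>\<^sub>0 :: "real^'n"
    and G :: "nat \<Rightarrow> 'w \<Rightarrow> real^'n" and A :: "real^'n^'n"
  assumes convex_domain: "convex \<Xi>" and centre: "\<xi>\<^sub>0 \<in> \<Xi>"
    and concave: "\<And>n \<omega> x y t. \<omega> \<in> space M \<Longrightarrow> x \<in> \<Xi> \<Longrightarrow> y \<in> \<Xi> \<Longrightarrow> 0 \<le> t \<Longrightarrow> t \<le> 1 \<Longrightarrow>
          (1 - t) * Mn n x \<omega> + t * Mn n y \<omega> \<le> Mn n ((1 - t) *\<^sub>R x + t *\<^sub>R y) \<omega>"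
    and continuous: "\<And>n \<omega>. \<omega> \<in> space M \<Longrightarrow> continuous_on \<Xi> (\<lambda>\<xi>. Mn n \<xi> \<omega>)"
    and A_sym: "transpose A = A" and A_pos_def: "\<And>v. v \<noteq> 0 \<Longrightarrow> 0 < v \<bullet> (A *v v)"
    and G_measurable: "\<And>n. G n \<in> borel_measurable M"
    and G_tight: "\<And>\<epsilon>. \<epsilon> > 0 \<Longrightarrow> \<exists>K>0. \<forall>n>0. prob {\<omega> \<in> space M. norm (G n \<omega>) > K} \<le> \<epsilon>"
    and expansion: "\<And>\<delta>. \<delta> > 0 \<Longrightarrow> \<exists>e>0. cball \<xi>\<^sub>0 e \<subseteq> \<Xi> \<and> whp M (\<lambda>n \<omega>. \<forall>\<xi>\<in>cball \<xi>\<^sub>0 e.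
          \<bar>quad_remainder A \<xi>\<^sub>0 n (G n \<omega>) (\<lambda>\<xi>. Mn n \<xi> \<omega>) \<xi>\<bar> \<le> \<delta> * (norm (\<xi> - \<xi>\<^sub>0))\<^sup>2)"
begin

lemma G_small: assumes "c > 0" shows "whp M (\<lambda>n \<omega>. norm (G n \<omega>) \<le> c * sqrt (real n))"
proof (rule whpI)
  show "{\<omega> \<in> space M. \<not> norm (G n \<omega>) \<le> c * sqrt (real n)} \<in> events" for n
    using G_measurable[of n] by measurable
  show "(\<lambda>n. prob {\<omega> \<in> space M. \<not> norm (G n \<omega>) \<le> c * sqrt (real n)}) \<longlonglongrightarrow> 0"
  proof (rule prob_tendsto_zeroI)
    fix r :: real assume "r > 0"
    then obtain K where K: "K > 0" "\<And>n. n > 0 \<Longrightarrow> prob {\<omega> \<in> space M. norm (G n \<omega>) > K} \<le> r / 2"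
      using G_tight[of "r / 2"] by auto
    have "filterlim (\<lambda>n. c * sqrt (real n)) at_top sequentially"
      by (intro filterlim_tendsto_pos_mult_at_top[OF tendsto_const \<open>c > 0\<close>]
          filterlim_compose[OF sqrt_at_top filterlim_real_sequentially])
    then have "eventually (\<lambda>n. K \<le> c * sqrt (real n)) sequentially" by (simp add: filterlim_at_top)
    then show "eventually (\<lambda>n. prob {\<omega> \<in> space M. \<not> norm (G n \<omega>) \<le> c * sqrt (real n)} < r) sequentially"
      using eventually_gt_at_top[of 0]
    proof eventually_elim
      case (elim n)
      have "{\<omega> \<in> space M. norm (G n \<omega>) > K} \<in> events" using G_measurable[of n] by measurable
      then have "prob {\<omega> \<in> space M. \<not> norm (G n \<omega>) \<le> c * sqrt (real n)} \<le> prob {\<omega> \<in> space M. norm (G n \<omega>) > K}"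
        using elim(1) by (intro finite_measure_mono) auto
      then show ?case using K(2)[OF elim(2)] \<open>r > 0\<close> by simp
    qed
  qed
qed

text \<open>On a small sphere the criterion lies below its value at the centre, by the quadratic expansion;
  by concavity it does so everywhere outside the sphere.\<close>

lemma well_separated:
  assumes "r > 0"
  shows "\<exists>c>0. whp M (\<lambda>n \<omega>. (\<forall>\<xi>\<in>\<Xi>. r \<le> norm (\<xi> - \<xi>\<^sub>0) \<longrightarrow> Mn n \<xi> \<omega> \<le> Mn n \<xi>\<^sub>0 \<omega> - c)
      \<and> bdd_above ((\<lambda>\<xi>. Mn n \<xi> \<omega>) ` \<Xi>))"
proof -
  obtain lam where lam: "lam > 0" "\<And>v. lam * (norm v)\<^sup>2 \<le> v \<bullet> (A *v v)"
    using pos_def_lower_bound[OF A_pos_def] by blast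
  obtain e where e: "e > 0" "cball \<xi>\<^sub>0 e \<subseteq> \<Xi>" and quad: "whp M (\<lambda>n \<omega>. \<forall>\<xi>\<in>cball \<xi>\<^sub>0 e.
          \<bar>quad_remainder A \<xi>\<^sub>0 n (G n \<omega>) (\<lambda>\<xi>. Mn n \<xi> \<omega>) \<xi>\<bar> \<le> lam / 8 * (norm (\<xi> - \<xi>\<^sub>0))\<^sup>2)"
    using expansion[of "lam / 8"] lam(1) by auto
  define a where "a = min r e"
  have a: "a > 0" "a \<le> r" "a \<le> e" using \<open>r > 0\<close> e(1) by (auto simp: a_def)
  define c where "c = lam * a\<^sup>2 / 4"
  have "c > 0" using lam(1) a by (simp add: c_def)
  have "whp M (\<lambda>n \<omega>. norm (G n \<omega>) \<le> (lam * a / 8) * sqrt (real n))"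
    using lam(1) a by (intro G_small) simp
  from whp_conj[OF quad this] have "whp M (\<lambda>n \<omega>. (\<forall>\<xi>\<in>\<Xi>. r \<le> norm (\<xi> - \<xi>\<^sub>0) \<longrightarrow> Mn n \<xi> \<omega> \<le> Mn n \<xi>\<^sub>0 \<omega> - c)
      \<and> bdd_above ((\<lambda>\<xi>. Mn n \<xi> \<omega>) ` \<Xi>))"
  proof (rule whp_mono, intro eventually_mono[OF eventually_gt_at_top[of 0]] ballI impI, elim conjE)
    fix n :: nat and \<omega>
    assume "n > 0" and \<omega>: "\<omega> \<in> space M"
      and expand: "\<forall>\<xi>\<in>cball \<xi>\<^sub>0 e. \<bar>quad_remainder A \<xi>\<^sub>0 n (G n \<omega>) (\<lambda>\<xi>. Mn n \<xi> \<omega>) \<xi>\<bar> \<le> lam / 8 * (norm (\<xi> - \<xi>\<^sub>0))\<^sup>2"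
      and G: "norm (G n \<omega>) \<le> (lam * a / 8) * sqrt (real n)"
    have sphere: "Mn n \<xi> \<omega> \<le> Mn n \<xi>\<^sub>0 \<omega> - c" if "norm (\<xi> - \<xi>\<^sub>0) = a" for \<xi>
    proof -
      have "\<bar>quad_remainder A \<xi>\<^sub>0 n (G n \<omega>) (\<lambda>\<xi>. Mn n \<xi> \<omega>) \<xi>\<bar> \<le> lam / 8 * a\<^sup>2"
        using expand a that by (auto simp: dist_norm norm_minus_commute)
      moreover have "(G n \<omega> \<bullet> (\<xi> - \<xi>\<^sub>0)) / sqrt (real n) \<le> lam * a\<^sup>2 / 8"
      proof -
        have "G n \<omega> \<bullet> (\<xi> - \<xi>\<^sub>0) \<le> norm (G n \<omega>) * a"
          using norm_cauchy_schwarz[of "G n \<omega>" "\<xi> - \<xi>\<^sub>0"] that by simp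
        also have "\<dots> \<le> (lam * a / 8) * sqrt (real n) * a" using G a by (intro mult_right_mono) auto
        finally show ?thesis using \<open>n > 0\<close> by (simp add: pos_divide_le_eq power2_eq_square mult_ac)
      qed
      moreover have "lam * a\<^sup>2 \<le> (\<xi> - \<xi>\<^sub>0) \<bullet> (A *v (\<xi> - \<xi>\<^sub>0))" using lam(2)[of "\<xi> - \<xi>\<^sub>0"] that by simp
      ultimately show ?thesis unfolding c_def quad_remainder_def by argo
    qed
    have outside: "Mn n \<xi> \<omega> \<le> Mn n \<xi>\<^sub>0 \<omega> - c" if "\<xi> \<in> \<Xi>" "a \<le> norm (\<xi> - \<xi>\<^sub>0)" for \<xi>
    proof -
      define t where "t = a / norm (\<xi> - \<xi>\<^sub>0)"
      have pos: "0 < norm (\<xi> - \<xi>\<^sub>0)" using a that by linarith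
      then have t: "0 < t" "t \<le> 1" using a that by (auto simp: t_def divide_le_eq)
      have "(1 - t) *\<^sub>R \<xi>\<^sub>0 + t *\<^sub>R \<xi> - \<xi>\<^sub>0 = t *\<^sub>R (\<xi> - \<xi>\<^sub>0)" by (simp add: algebra_simps)
      then have "norm ((1 - t) *\<^sub>R \<xi>\<^sub>0 + t *\<^sub>R \<xi> - \<xi>\<^sub>0) = a" using t pos a by (simp add: t_def)
      then have "(1 - t) * Mn n \<xi>\<^sub>0 \<omega> + t * Mn n \<xi> \<omega> \<le> Mn n \<xi>\<^sub>0 \<omega> - c"
        using concave[OF \<omega> centre that(1), of t n] t sphere by fastforce
      then have "t * (Mn n \<xi> \<omega> - Mn n \<xi>\<^sub>0 \<omega>) \<le> - c" by (simp add: algebra_simps)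
      also have "- c \<le> t * (- c)" using t \<open>c > 0\<close> by (simp add: mult_le_cancel_right1)
      finally have "Mn n \<xi> \<omega> - Mn n \<xi>\<^sub>0 \<omega> \<le> - c" using t(1) by (rule mult_left_le_imp_le)
      then show ?thesis by simp
    qed
    have "compact ((\<lambda>\<xi>. Mn n \<xi> \<omega>) ` cball \<xi>\<^sub>0 e)"
      by (intro compact_continuous_image continuous_on_subset[OF continuous[OF \<omega>] e(2)] compact_cball)
    then have "bdd_above ((\<lambda>\<xi>. Mn n \<xi> \<omega>) ` cball \<xi>\<^sub>0 e)"
      by (intro bounded_imp_bdd_above compact_imp_bounded)
    then obtain b where b: "\<And>\<xi>. \<xi> \<in> cball \<xi>\<^sub>0 e \<Longrightarrow> Mn n \<xi> \<omega> \<le> b" unfolding bdd_above_def by blast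
    have "Mn n \<xi> \<omega> \<le> max b (Mn n \<xi>\<^sub>0 \<omega>)" if "\<xi> \<in> \<Xi>" for \<xi>
    proof (cases "a \<le> norm (\<xi> - \<xi>\<^sub>0)")
      case True
      then show ?thesis using outside[OF that] \<open>c > 0\<close> by fastforce
    next
      case False
      then have "\<xi> \<in> cball \<xi>\<^sub>0 e" using a by (simp add: dist_norm norm_minus_commute)
      then show ?thesis using b by fastforce
    qed
    then have "bdd_above ((\<lambda>\<xi>. Mn n \<xi> \<omega>) ` \<Xi>)" by (auto intro!: bdd_aboveI)
    then show "(\<forall>\<xi>\<in>\<Xi>. r \<le> norm (\<xi> - \<xi>\<^sub>0) \<longrightarrow> Mn n \<xi> \<omega> \<le> Mn n \<xi>\<^sub>0 \<omega> - c)
          \<and> bdd_above ((\<lambda>\<xi>. Mn n \<xi> \<omega>) ` \<Xi>)"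
      using outside a by force
  qed
  then show ?thesis using \<open>c > 0\<close> by blast
qed

lemma whp_bdd_above: "whp M (\<lambda>n \<omega>. bdd_above ((\<lambda>\<xi>. Mn n \<xi> \<omega>) ` \<Xi>))"
proof -
  obtain c where "whp M (\<lambda>n \<omega>. (\<forall>\<xi>\<in>\<Xi>. 1 \<le> norm (\<xi> - \<xi>\<^sub>0) \<longrightarrow> Mn n \<xi> \<omega> \<le> Mn n \<xi>\<^sub>0 \<omega> - c)
      \<and> bdd_above ((\<lambda>\<xi>. Mn n \<xi> \<omega>) ` \<Xi>))" using well_separated[of 1] by auto
  then show ?thesis by (rule whp_mono) auto
qed

lemma consistent:
  assumes est: "\<And>n \<omega>. \<omega> \<in> space M \<Longrightarrow> est n \<omega> \<in> \<Xi>"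
    and near_max: "\<And>\<delta>. \<delta> > 0 \<Longrightarrow> whp M (\<lambda>n \<omega>. Mn n \<xi>\<^sub>0 \<omega> \<le> Mn n (est n \<omega>) \<omega> + \<delta>)"
    and "r > 0"
  shows "whp M (\<lambda>n \<omega>. norm (est n \<omega> - \<xi>\<^sub>0) \<le> r)"
proof -
  obtain c where c: "c > 0" "whp M (\<lambda>n \<omega>. (\<forall>\<xi>\<in>\<Xi>. r \<le> norm (\<xi> - \<xi>\<^sub>0) \<longrightarrow> Mn n \<xi> \<omega> \<le> Mn n \<xi>\<^sub>0 \<omega> - c)
      \<and> bdd_above ((\<lambda>\<xi>. Mn n \<xi> \<omega>) ` \<Xi>))" using well_separated[OF \<open>r > 0\<close>] by auto
  have "whp M (\<lambda>n \<omega>. Mn n \<xi>\<^sub>0 \<omega> \<le> Mn n (est n \<omega>) \<omega> + c / 2)" using near_max c(1) by simp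
  from whp_conj[OF c(2) this] show ?thesis
  proof (rule whp_mono, intro always_eventually allI ballI impI)
    fix n \<omega> assume \<omega>: "\<omega> \<in> space M"
      and *: "((\<forall>\<xi>\<in>\<Xi>. r \<le> norm (\<xi> - \<xi>\<^sub>0) \<longrightarrow> Mn n \<xi> \<omega> \<le> Mn n \<xi>\<^sub>0 \<omega> - c)
        \<and> bdd_above ((\<lambda>\<xi>. Mn n \<xi> \<omega>) ` \<Xi>)) \<and> Mn n \<xi>\<^sub>0 \<omega> \<le> Mn n (est n \<omega>) \<omega> + c / 2"
    show "norm (est n \<omega> - \<xi>\<^sub>0) \<le> r"
    proof (rule ccontr)
      assume "\<not> ?thesis"
      then have "Mn n (est n \<omega>) \<omega> \<le> Mn n \<xi>\<^sub>0 \<omega> - c" using * est[OF \<omega>] by auto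
      then show False using * c(1) by argo
    qed
  qed
qed

text \<open>Asymptotic linearity of near-maximisers over a constraint set that is tangent to the range of
  \<open>D\<close> at \<open>\<xi>\<^sub>0\<close>.\<close>

lemma asymptotically_linear:
  fixes D :: "real^'t^'n"
  assumes gi: "generalised_inverse (transpose D ** A ** D) Gi"
    and sub: "\<Xi>r \<subseteq> \<Xi>" and centre_r: "\<xi>\<^sub>0 \<in> \<Xi>r"
    and C1: "C1 > 0" "e1 > 0" and tangent: "\<And>\<xi>. \<xi> \<in> \<Xi>r \<Longrightarrow> norm (\<xi> - \<xi>\<^sub>0) < e1 \<Longrightarrow>
      \<exists>s. norm (\<xi> - \<xi>\<^sub>0 - D *v s) \<le> C1 * (norm (\<xi> - \<xi>\<^sub>0))\<^sup>2"
    and C2: "C2 > 0" "e2 > 0" and curve: "\<And>s. norm s < e2 \<Longrightarrow>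
      \<exists>\<xi>\<in>\<Xi>r. norm (\<xi> - \<xi>\<^sub>0 - D *v s) \<le> C2 * (norm s)\<^sup>2"
    and est: "\<And>n \<omega>. \<omega> \<in> space M \<Longrightarrow> est n \<omega> \<in> \<Xi>r"
    and near_max: "\<And>\<delta>. \<delta> > 0 \<Longrightarrow> whp M (\<lambda>n \<omega>. \<forall>\<xi>\<in>\<Xi>r. Mn n \<xi> \<omega> \<le> Mn n (est n \<omega>) \<omega> + \<delta> / real n)"
    and "K > 0" "\<epsilon> > 0"
  shows "whp M (\<lambda>n \<omega>. norm (G n \<omega>) \<le> K \<longrightarrow>
      norm (sqrt (real n) *\<^sub>R (est n \<omega> - \<xi>\<^sub>0) - (D ** Gi ** transpose D) *v G n \<omega>) \<le> \<epsilon>)"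
proof -
  obtain \<delta> where \<delta>: "\<delta> > 0" and core: "\<And>e. e > 0 \<Longrightarrow> \<exists>r>0. eventually
      (linear_near_maximisers A (D ** Gi ** transpose D) \<Xi>r \<xi>\<^sub>0 K \<epsilon> \<delta> e r) sequentially"
    using near_maximiser_linear[OF A_sym A_pos_def gi centre_r C1 tangent C2 curve \<open>K > 0\<close> \<open>\<epsilon> > 0\<close>]
    by blast
  obtain e where e: "e > 0" and quad: "whp M (\<lambda>n \<omega>. \<forall>\<xi>\<in>cball \<xi>\<^sub>0 e.
          \<bar>quad_remainder A \<xi>\<^sub>0 n (G n \<omega>) (\<lambda>\<xi>. Mn n \<xi> \<omega>) \<xi>\<bar> \<le> \<delta> * (norm (\<xi> - \<xi>\<^sub>0))\<^sup>2)"
    using expansion[OF \<delta>] by blast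
  obtain r where "r > 0" and ev: "eventually
      (linear_near_maximisers A (D ** Gi ** transpose D) \<Xi>r \<xi>\<^sub>0 K \<epsilon> \<delta> e r) sequentially"
    using core[OF e] by blast
  have weak: "whp M (\<lambda>n \<omega>. Mn n \<xi>\<^sub>0 \<omega> \<le> Mn n (est n \<omega>) \<omega> + \<delta>')" if "\<delta>' > 0" for \<delta>'
  proof (rule whp_mono[OF near_max[OF that]])
    show "eventually (\<lambda>n. \<forall>\<omega>\<in>space M. (\<forall>\<xi>\<in>\<Xi>r. Mn n \<xi> \<omega> \<le> Mn n (est n \<omega>) \<omega> + \<delta>' / real n) \<longrightarrow>
        Mn n \<xi>\<^sub>0 \<omega> \<le> Mn n (est n \<omega>) \<omega> + \<delta>') sequentially"
      using eventually_ge_at_top[of 1]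
    proof eventually_elim
      case (elim n)
      then have "\<delta>' / real n \<le> \<delta>'" using that by (simp add: divide_le_eq mult_le_cancel_left1)
      then show ?case using centre_r by fastforce
    qed
  qed
  have cons: "whp M (\<lambda>n \<omega>. norm (est n \<omega> - \<xi>\<^sub>0) \<le> r)"
    using est sub by (intro consistent weak \<open>r > 0\<close>) auto
  show ?thesis
  proof (rule whp_mono[OF whp_conj[OF quad whp_conj[OF cons near_max[OF \<delta>]]]], rule eventually_mono[OF ev],
      intro ballI impI)
    fix n \<omega> assume "\<omega> \<in> space M" "norm (G n \<omega>) \<le> K"
      and lin: "linear_near_maximisers A (D ** Gi ** transpose D) \<Xi>r \<xi>\<^sub>0 K \<epsilon> \<delta> e r n"
      and "(\<forall>\<xi>\<in>cball \<xi>\<^sub>0 e. \<bar>quad_remainder A \<xi>\<^sub>0 n (G n \<omega>) (\<lambda>\<xi>. Mn n \<xi> \<omega>) \<xi>\<bar> \<le> \<delta> * (norm (\<xi> - \<xi>\<^sub>0))\<^sup>2)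
        \<and> norm (est n \<omega> - \<xi>\<^sub>0) \<le> r \<and> (\<forall>\<xi>\<in>\<Xi>r. Mn n \<xi> \<omega> \<le> Mn n (est n \<omega>) \<omega> + \<delta> / real n)"
    then show "norm (sqrt (real n) *\<^sub>R (est n \<omega> - \<xi>\<^sub>0) - (D ** Gi ** transpose D) *v G n \<omega>) \<le> \<epsilon>"
      using lin[unfolded linear_near_maximisers_def, rule_format, of "G n \<omega>" "est n \<omega>" "\<lambda>\<xi>. Mn n \<xi> \<omega>"] est
      by blast
  qed
qed

end

section \<open>M-estimators\<close>

lemma sample_measurable:
  assumes "\<And>i. Z i \<in> borel_measurable M"
  shows "sample n Z \<in> measurable M (PiM {..<n} (\<lambda>_. borel))"
proof -
  have "(\<lambda>\<omega>. \<lambda>i\<in>{..<n}. Z i \<omega>) \<in> measurable M (PiM {..<n} (\<lambda>_. borel))"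
    by (intro measurable_restrict assms)
  then show ?thesis by (simp add: sample_def[abs_def])
qed

lemma M_estimator_measurable:
  assumes "M_estimator M Z Mn \<Xi>' a est" "\<And>i. Z i \<in> borel_measurable M"
  shows "(\<lambda>\<omega>. est n (sample n Z \<omega>)) \<in> borel_measurable M"
    and "\<omega> \<in> space M \<Longrightarrow> est n (sample n Z \<omega>) \<in> \<Xi>'"
proof -
  have est: "est n \<in> measurable (PiM {..<n} (\<lambda>_. borel)) (restrict_space borel \<Xi>')"
    using assms(1) by (simp add: M_estimator_def)
  have "est n \<in> measurable (PiM {..<n} (\<lambda>_. borel)) borel"
    using est by (auto simp: measurable_restrict_space2_iff)
  then show "(\<lambda>\<omega>. est n (sample n Z \<omega>)) \<in> borel_measurable M"
    by (rule measurable_compose[OF sample_measurable[OF assms(2)]])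
  show "est n (sample n Z \<omega>) \<in> \<Xi>'" if "\<omega> \<in> space M"
  proof -
    have "sample n Z \<omega> \<in> space (PiM {..<n} (\<lambda>_. borel))"
      by (rule measurable_space[OF sample_measurable[OF assms(2)] that])
    from measurable_space[OF est this] show ?thesis by (simp add: space_restrict_space)
  qed
qed

text \<open>With probability tending to one, the extended-real remainder of an M-estimator may be replaced by
  \<open>\<delta> a\<^sub>n\<close>.\<close>

lemma (in prob_space) M_estimator_near_max:
  assumes "M_estimator M Z Mn \<Xi>' a est" "\<delta> > 0"
  shows "whp M (\<lambda>n \<omega>. \<forall>\<xi>\<in>\<Xi>'. Mn n \<xi> (sample n Z \<omega>)
      \<le> Mn n (est n (sample n Z \<omega>)) (sample n Z \<omega>) + \<delta> * a n)"
proof -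
  obtain A where A: "small_o_p M A a" and near: "\<And>n \<omega>. \<omega> \<in> space M \<Longrightarrow>
      (SUP \<xi>\<in>\<Xi>'. ereal (Mn n \<xi> (sample n Z \<omega>)))
        \<le> ereal (Mn n (est n (sample n Z \<omega>)) (sample n Z \<omega>)) + A n \<omega>"
    using assms(1) by (auto simp: M_estimator_def)
  have A_meas [measurable]: "A n \<in> borel_measurable M" for n using A by (simp add: small_o_p_def)
  have "whp M (\<lambda>n \<omega>. \<not> \<bar>A n \<omega>\<bar> > ereal (\<delta> * a n))"
  proof (rule whpI)
    show "(\<lambda>n. prob {\<omega> \<in> space M. \<not> \<not> \<bar>A n \<omega>\<bar> > ereal (\<delta> * a n)}) \<longlonglongrightarrow> 0"
      using A assms(2) by (simp add: small_o_p_def)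
  qed measurable
  then show ?thesis
  proof (rule whp_mono, intro always_eventually allI ballI impI)
    fix n \<omega> \<xi> assume \<omega>: "\<omega> \<in> space M" and small: "\<not> \<bar>A n \<omega>\<bar> > ereal (\<delta> * a n)" and \<xi>: "\<xi> \<in> \<Xi>'"
    have "ereal (Mn n \<xi> (sample n Z \<omega>)) \<le> (SUP \<xi>\<in>\<Xi>'. ereal (Mn n \<xi> (sample n Z \<omega>)))"
      using \<xi> by (rule SUP_upper)
    also have "\<dots> \<le> ereal (Mn n (est n (sample n Z \<omega>)) (sample n Z \<omega>)) + A n \<omega>" by (rule near[OF \<omega>])
    also have "\<dots> \<le> ereal (Mn n (est n (sample n Z \<omega>)) (sample n Z \<omega>)) + ereal (\<delta> * a n)"
      using small by (intro add_left_mono) (cases "A n \<omega>", auto)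
    finally show "Mn n \<xi> (sample n Z \<omega>) \<le> Mn n (est n (sample n Z \<omega>)) (sample n Z \<omega>) + \<delta> * a n"
      by simp
  qed
qed

text \<open>Strong M-estimators exist as soon as the criterion is bounded above with probability tending to
  one: the estimator is the first element of a countable dense subset whose criterion is
  within \<open>1 / (n + 1)\<^sup>2\<close> of the supremum.  The remainder is set to \<open>\<infinity>\<close> for the samples on which no such
  element exists.\<close>

theorem (in prob_space) strong_M_estimator_exists:
  fixes Mn :: "nat \<Rightarrow> 'x::{metric_space, second_countable_topology} \<Rightarrow> (nat \<Rightarrow> 'z::topological_space) \<Rightarrow> real"
  assumes ne: "\<Xi>' \<noteq> {}"
    and cont: "\<And>n z. continuous_on \<Xi>' (\<lambda>\<xi>. Mn n \<xi> z)"
    and meas: "\<And>n \<xi>. \<xi> \<in> \<Xi>' \<Longrightarrow> Mn n \<xi> \<in> borel_measurable (PiM {..<n} (\<lambda>_. borel))"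
    and Z: "\<And>i. Z i \<in> borel_measurable M"
    and bdd: "whp M (\<lambda>n \<omega>. bdd_above ((\<lambda>\<xi>. Mn n \<xi> (sample n Z \<omega>)) ` \<Xi>'))"
  shows "\<exists>est. strong_M_estimator M Z Mn \<Xi>' est"
proof -
  obtain T where T: "countable T" "T \<subseteq> \<Xi>'" "\<Xi>' \<subseteq> closure T" by (rule separable)
  have "T \<noteq> {}" using ne T(3) by auto
  define t where "t = from_nat_into T"
  have t: "range t = T" unfolding t_def using \<open>T \<noteq> {}\<close> T(1) by (rule range_from_nat_into)
  have t_in: "t j \<in> \<Xi>'" for j using t T(2) by blast
  define c where "c n = 1 / (real n + 1)\<^sup>2" for n
  have c: "c n > 0" for n by (simp add: c_def)
  define E where "E n z j \<longleftrightarrow> (\<forall>i. Mn n (t i) z \<le> Mn n (t j) z + c n)" for n z j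
  have [measurable]: "Measurable.pred (PiM {..<n} (\<lambda>_. borel)) (\<lambda>z. Mn n (t i) z \<le> Mn n (t j) z + c n)" for n i j
    unfolding pred_def
    by (intro borel_measurable_le borel_measurable_add borel_measurable_const meas t_in)
  have E_meas [measurable]: "Measurable.pred (PiM {..<n} (\<lambda>_. borel)) (\<lambda>z. E n z j)" for n j
    unfolding E_def by measurable
  define est where "est n z = t (LEAST j. E n z j)" for n z
  define A where "A n \<omega> = (if \<exists>j. E n (sample n Z \<omega>) j then ereal (c n) else \<infinity>)" for n \<omega>
  have A_meas [measurable]: "A n \<in> borel_measurable M" for n
  proof -
    have "Measurable.pred M (\<lambda>\<omega>. \<exists>j. E n (sample n Z \<omega>) j)"
      by (rule measurable_compose[OF sample_measurable[OF Z], of "\<lambda>z. \<exists>j. E n z j"]) measurable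
    then show ?thesis unfolding A_def by measurable
  qed
  have near_max: "Mn n \<xi> z \<le> Mn n (t j) z + c n" if E: "E n z j" and \<xi>: "\<xi> \<in> \<Xi>'" for n z j \<xi>
  proof -
    obtain x where x: "\<And>i. x i \<in> T" "x \<longlonglongrightarrow> \<xi>"
      using T(3) \<xi> closure_sequential[of \<xi> T] by blast
    have "(\<lambda>i. Mn n (x i) z) \<longlonglongrightarrow> Mn n \<xi> z"
      by (rule continuous_on_tendsto_compose[OF cont x(2) \<xi>]) (use x(1) T(2) in \<open>simp add: subset_iff\<close>)
    moreover have "Mn n (x i) z \<le> Mn n (t j) z + c n" for i
      using E x(1)[of i] t unfolding E_def by (metis imageE)
    ultimately show ?thesis by (intro LIMSEQ_le_const2) auto
  qed
  have exists: "\<exists>j. E n z j" if "bdd_above ((\<lambda>\<xi>. Mn n \<xi> z) ` \<Xi>')" for n z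
  proof -
    have bdd: "bdd_above (range (\<lambda>j. Mn n (t j) z))"
      using that by (rule bdd_above_mono) (use t_in in auto)
    have "(SUP j. Mn n (t j) z) - c n < (SUP j. Mn n (t j) z)" using c[of n] by simp
    then obtain j where j: "(SUP j. Mn n (t j) z) - c n < Mn n (t j) z"
      using less_cSUP_iff[OF _ bdd] by auto
    have "Mn n (t i) z \<le> Mn n (t j) z + c n" for i
      using cSUP_upper[OF _ bdd, of i] j by simp
    then show ?thesis unfolding E_def by blast
  qed
  have "strong_M_estimator M Z Mn \<Xi>' est"
    unfolding strong_M_estimator_def M_estimator_def
  proof (intro conjI exI allI ballI)
    fix n
    have "(\<lambda>z. LEAST j. E n z j) \<in> measurable (PiM {..<n} (\<lambda>_. borel)) (count_space UNIV)"
      by measurable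
    moreover have "t \<in> measurable (count_space UNIV) (restrict_space borel \<Xi>')"
      using t_in by (auto simp: space_restrict_space)
    ultimately show "est n \<in> measurable (PiM {..<n} (\<lambda>_. borel)) (restrict_space borel \<Xi>')"
      unfolding est_def by (rule measurable_compose)
  next
    show "small_o_p M A (\<lambda>n. 1 / real n)"
      unfolding small_o_p_def
    proof (intro conjI allI impI A_meas)
      fix \<epsilon> :: real assume "\<epsilon> > 0"
      have "whp M (\<lambda>n \<omega>. \<not> \<bar>A n \<omega>\<bar> > ereal (\<epsilon> * (1 / real n)))"
      proof (rule whp_mono[OF bdd])
        have "eventually (\<lambda>n. real n \<ge> 1 / \<epsilon>) sequentially"
          by (rule eventually_sequentiallyI[of "nat \<lceil>1 / \<epsilon>\<rceil>"]) linarith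
        then show "eventually (\<lambda>n. \<forall>\<omega>\<in>space M. bdd_above ((\<lambda>\<xi>. Mn n \<xi> (sample n Z \<omega>)) ` \<Xi>') \<longrightarrow>
            \<not> \<bar>A n \<omega>\<bar> > ereal (\<epsilon> * (1 / real n))) sequentially"
          using eventually_gt_at_top[of 0]
        proof (eventually_elim, intro ballI impI)
          fix n \<omega> assume n: "1 / \<epsilon> \<le> real n" "0 < n"
            and "bdd_above ((\<lambda>\<xi>. Mn n \<xi> (sample n Z \<omega>)) ` \<Xi>')"
          then have "A n \<omega> = ereal (c n)" using exists by (simp add: A_def)
          moreover have "c n \<le> \<epsilon> * (1 / real n)"
          proof -
            have "1 \<le> \<epsilon> * real n" using n(1) \<open>\<epsilon> > 0\<close> by (simp add: field_simps)
            then have "real n * 1 \<le> real n * (\<epsilon> * real n)" by (rule mult_left_mono) simp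
            also have "\<dots> \<le> \<epsilon> * (real n + 1)\<^sup>2"
              using \<open>\<epsilon> > 0\<close> by (simp add: power2_eq_square algebra_simps)
            finally show ?thesis using n(2) by (simp add: c_def field_simps)
          qed
          ultimately show "\<not> \<bar>A n \<omega>\<bar> > ereal (\<epsilon> * (1 / real n))" using c[of n] by simp
        qed
      qed
      from whpD[OF this] show "(\<lambda>n. prob {\<omega> \<in> space M. \<bar>A n \<omega>\<bar> > ereal (\<epsilon> * (1 / real n))}) \<longlonglongrightarrow> 0"
        by simp
    qed
  next
    fix n \<omega>
    show "(SUP \<xi>\<in>\<Xi>'. ereal (Mn n \<xi> (sample n Z \<omega>)))
        \<le> ereal (Mn n (est n (sample n Z \<omega>)) (sample n Z \<omega>)) + A n \<omega>"
    proof (cases "\<exists>j. E n (sample n Z \<omega>) j")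
      case True
      then have "E n (sample n Z \<omega>) (LEAST j. E n (sample n Z \<omega>) j)" by (rule LeastI_ex)
      then show ?thesis
        using near_max True by (auto simp: A_def est_def intro!: SUP_least)
    qed (simp add: A_def)
  qed
  then show ?thesis by (intro exI)
qed

section \<open>Weak convergence on \<open>\<real>\<^sup>n\<close> through characteristic functions\<close>

text \<open>Trigonometric polynomials in several variables, with arbitrary real frequencies: the complex
  linear combinations of the functions \<open>x \<mapsto> exp (\<i> t \<bullet> x)\<close>, whose expectations are values of the
  characteristic function.\<close>

inductive trig_poly :: "('a::euclidean_space \<Rightarrow> complex) \<Rightarrow> bool" where
  monom: "trig_poly (\<lambda>x. c * iexp (t \<bullet> x))"
| add: "trig_poly f \<Longrightarrow> trig_poly g \<Longrightarrow> trig_poly (\<lambda>x. f x + g x)"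

lemma trig_poly_const: "trig_poly (\<lambda>x. c)"
  using trig_poly.monom[of c 0] by simp

lemma trig_poly_mult_monom:
  "trig_poly f \<Longrightarrow> trig_poly (\<lambda>x. (c * iexp (t \<bullet> x)) * f x)"
proof (induction rule: trig_poly.induct)
  case (monom c' t')
  have "(\<lambda>x. (c * iexp (t \<bullet> x)) * (c' * iexp (t' \<bullet> x))) = (\<lambda>x. (c * c') * iexp ((t + t') \<bullet> x))"
    by (auto simp: inner_add_left exp_add algebra_simps)
  then show ?case using trig_poly.monom by metis
next
  case (add f g)
  then show ?case using trig_poly.add by (simp add: distrib_left)
qed

lemma trig_poly_mult: "trig_poly f \<Longrightarrow> trig_poly g \<Longrightarrow> trig_poly (\<lambda>x. f x * g x)"
proof (induction rule: trig_poly.induct)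
  case (monom c t)
  then show ?case by (rule trig_poly_mult_monom)
next
  case (add f h)
  then show ?case using trig_poly.add by (simp add: distrib_right)
qed

lemma trig_poly_sum: "(\<And>i. i \<in> I \<Longrightarrow> trig_poly (f i)) \<Longrightarrow> trig_poly (\<lambda>x. \<Sum>i\<in>I. f i x)"
proof (induction I rule: infinite_finite_induct)
  case (insert i I)
  then show ?case using trig_poly.add[of "f i" "\<lambda>x. \<Sum>i\<in>I. f i x"] by simp
qed (simp_all add: trig_poly_const)

lemma trig_poly_sin: "trig_poly (\<lambda>x. of_real (sin (t \<bullet> x)))"
proof -
  have "trig_poly (\<lambda>x. (1 / (2 * \<i>)) * iexp (t \<bullet> x) + (- 1 / (2 * \<i>)) * iexp ((- t) \<bullet> x))"
    by (intro trig_poly.intros)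
  also have "(\<lambda>x. (1 / (2 * \<i>)) * iexp (t \<bullet> x) + (- 1 / (2 * \<i>)) * iexp ((- t) \<bullet> x))
      = (\<lambda>x. of_real (sin (t \<bullet> x)))"
  proof (rule ext)
    fix x :: 'a
    have "complex_of_real (sin (t \<bullet> x)) = sin (of_real (t \<bullet> x))" by (simp only: sin_of_real)
    also have "\<dots> = \<i> * (exp (- (\<i> * of_real (t \<bullet> x))) - exp (\<i> * of_real (t \<bullet> x))) / 2"
      by (rule sin_exp_eq')
    finally show "(1 / (2 * \<i>)) * iexp (t \<bullet> x) + (- 1 / (2 * \<i>)) * iexp ((- t) \<bullet> x)
        = complex_of_real (sin (t \<bullet> x))"
      by (simp add: right_diff_distrib diff_divide_distrib)
  qed
  finally show ?thesis .
qed

lemma trig_poly_polynomial_sin: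
  fixes p :: "real^'n \<Rightarrow> real"
  assumes "real_polynomial_function p"
  shows "trig_poly (\<lambda>x. of_real (p (\<chi> i. sin (a * x $ i))))"
  using assms
proof (induction rule: real_polynomial_function.induct)
  case (linear f)
  have f_sum: "f v = (\<Sum>i\<in>UNIV. v $ i * f (axis i 1))" for v
    using linear_eq_sum_axis[OF bounded_linear.linear[OF linear], of v] by (simp add: inner_vec_def mult.commute)
  have "(\<lambda>x. complex_of_real (f (\<chi> i. sin (a * x $ i))))
      = (\<lambda>x. \<Sum>i\<in>UNIV. of_real (sin ((a *\<^sub>R axis i 1) \<bullet> x)) * of_real (f (axis i 1)))"
    by (subst f_sum) (simp add: inner_axis' fun_eq_iff)
  moreover have "trig_poly (\<lambda>x::real^'n. \<Sum>i\<in>UNIV. of_real (sin ((a *\<^sub>R axis i 1) \<bullet> x)) * of_real (f (axis i 1)))"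
  proof (rule trig_poly_sum)
    fix i :: 'n
    show "trig_poly (\<lambda>x. of_real (sin ((a *\<^sub>R axis i 1) \<bullet> x)) * of_real (f (axis i 1)))"
      by (rule trig_poly_mult[OF trig_poly_sin trig_poly_const])
  qed
  ultimately show ?case by simp
next
  case (const c)
  then show ?case by (rule trig_poly_const)
next
  case (add f g)
  then show ?case using trig_poly.add[OF add.IH] by simp
next
  case (mult f g)
  then show ?case using trig_poly_mult[OF mult.IH] by simp
qed

lemma trig_poly_continuous: "trig_poly f \<Longrightarrow> continuous_on UNIV f"
proof (induction rule: trig_poly.induct)
  case (monom c t)
  show ?case by (intro continuous_intros)
next
  case (add f g)
  then show ?case by (intro continuous_on_add)
qed

lemma trig_poly_bounded: "trig_poly f \<Longrightarrow> \<exists>B. \<forall>x. norm (f x) \<le> B"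
proof (induction rule: trig_poly.induct)
  case (monom c t)
  then show ?case by (intro exI[of _ "norm c"]) (simp add: norm_mult)
next
  case (add f g)
  then obtain B C where "\<And>x. norm (f x) \<le> B" "\<And>x. norm (g x) \<le> C" by auto
  then have "norm (f x + g x) \<le> B + C" for x by (meson norm_triangle_mono)
  then show ?case by blast
qed

lemma trig_poly_integrable:
  fixes f :: "'a::euclidean_space \<Rightarrow> complex"
  assumes "trig_poly f" "prob_space M" "V \<in> borel_measurable M"
  shows "integrable M (\<lambda>\<omega>. f (V \<omega>))"
proof -
  interpret prob_space M by fact
  obtain B where "\<And>x. norm (f x) \<le> B" using trig_poly_bounded[OF assms(1)] by auto
  moreover have "f \<in> borel_measurable borel"
    using trig_poly_continuous[OF assms(1)] by (rule borel_measurable_continuous_onI)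
  ultimately show ?thesis using assms(3) by (intro integrable_const_bound[of _ B]) auto
qed

lemma trig_poly_expectation_tendsto:
  fixes V :: "nat \<Rightarrow> 'w \<Rightarrow> 'a::euclidean_space"
  assumes "trig_poly f" "prob_space M" "\<And>n. V n \<in> borel_measurable M"
    "prob_space \<mu>" "sets \<mu> = sets borel"
    and char: "\<And>t. (\<lambda>n. CLINT \<omega>|M. iexp (t \<bullet> V n \<omega>)) \<longlonglongrightarrow> (CLINT v|\<mu>. iexp (t \<bullet> v))"
  shows "(\<lambda>n. CLINT \<omega>|M. f (V n \<omega>)) \<longlonglongrightarrow> (CLINT v|\<mu>. f v)"
  using assms(1)
proof (induction rule: trig_poly.induct)
  case (monom c t)
  show ?case using tendsto_mult_left[OF char[of t], of c] by simp
next
  case (add f g)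
  have "(\<lambda>v. v) \<in> borel_measurable \<mu>" using assms(5) by simp
  then have "integrable \<mu> f" "integrable \<mu> g"
    using trig_poly_integrable[OF _ assms(4)] add.hyps by auto
  moreover have "integrable M (\<lambda>\<omega>. f (V n \<omega>))" "integrable M (\<lambda>\<omega>. g (V n \<omega>))" for n
    using trig_poly_integrable[OF _ assms(2,3)] add.hyps by auto
  ultimately show ?case using tendsto_add[OF add.IH] by simp
qed

text \<open>Convergence of the characteristic functions, together with tightness, implies weak
  convergence.  On a large cube, \<open>f x\<close> agrees with \<open>f (L arcsin (sin (x / L)))\<close>, taken
  coordinatewise; by the Weierstrass theorem the latter is a uniform limit, on the whole space, of
  polynomials in the \<open>sin (x\<^sub>i / L)\<close>, which are trigonometric polynomials.\<close>

theorem conv_in_distr_by_characteristic_functions: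
  fixes V :: "nat \<Rightarrow> 'w \<Rightarrow> real^'n"
  assumes M: "prob_space M" and V: "\<And>n. V n \<in> borel_measurable M"
    and \<mu>: "prob_space \<mu>" and sets_\<mu>: "sets \<mu> = sets borel"
    and char: "\<And>t. (\<lambda>n. CLINT \<omega>|M. iexp (t \<bullet> V n \<omega>)) \<longlonglongrightarrow> (CLINT v|\<mu>. iexp (t \<bullet> v))"
    and tight: "\<And>\<epsilon>. \<epsilon> > 0 \<Longrightarrow>
      \<exists>K. eventually (\<lambda>n. measure M {\<omega> \<in> space M. norm (V n \<omega>) > K} < \<epsilon>) sequentially"
  shows "conv_in_distr M V \<mu>"
  unfolding conv_in_distr_def
proof (intro allI impI)
  fix f :: "real^'n \<Rightarrow> real"
  assume f: "continuous_on UNIV f \<and> bounded (range f)"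
  interpret prob_space M by fact
  interpret \<mu>: prob_space \<mu> by fact
  note V[measurable] sets_\<mu>[measurable_cong]
  have space_\<mu>: "space \<mu> = UNIV" using sets_eq_imp_space_eq[OF sets_\<mu>] by simp
  obtain B0 where B0: "\<And>x. \<bar>f x\<bar> \<le> B0" using f by (auto simp: bounded_iff)
  define B where "B = B0 + 1"
  have B: "\<bar>f x\<bar> \<le> B" for x using B0[of x] by (simp add: B_def)
  have "B > 0" using B0[of 0] by (simp add: B_def)
  have [measurable]: "f \<in> borel_measurable borel"
    using f by (auto intro: borel_measurable_continuous_onI)
  show "(\<lambda>n. \<integral>\<omega>. f (V n \<omega>) \<partial>M) \<longlonglongrightarrow> (\<integral>v. f v \<partial>\<mu>)"
  proof (rule LIMSEQ_I)
    fix r :: real assume "r > 0"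
    \<comment> \<open>Where \<open>\<parallel>x\<parallel> > L\<close>, \<open>f\<close> and its approximation differ by at most \<open>2 B\<close> and a small constant, so the tails
      contribute \<open>2 B e = 2 r / 9\<close> for each of the two laws.\<close>
    define e where "e = r / (9 * B)"
    have "e > 0" using \<open>r > 0\<close> \<open>B > 0\<close> by (simp add: e_def)
    obtain K1 where K1: "eventually (\<lambda>n. prob {\<omega> \<in> space M. norm (V n \<omega>) > K1} < e) sequentially"
      using tight[OF \<open>e > 0\<close>] by blast
    have "(\<lambda>k::nat. measure \<mu> {v \<in> space \<mu>. norm v > real k}) \<longlonglongrightarrow> measure \<mu> (\<Inter>k::nat. {v \<in> space \<mu>. norm v > real k})"
      by (rule \<mu>.finite_Lim_measure_decseq) (auto simp: decseq_def image_subset_iff)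
    also have "(\<Inter>k::nat. {v \<in> space \<mu>. norm v > real k}) = {}"
    proof -
      have "\<exists>k::nat. \<not> norm v > real k" for v :: "real^'n"
        using real_arch_simple[of "norm v"] by (auto simp: not_less)
      then show ?thesis by blast
    qed
    finally have "(\<lambda>k::nat. measure \<mu> {v \<in> space \<mu>. norm v > real k}) \<longlonglongrightarrow> 0" by simp
    then obtain k where k: "measure \<mu> {v \<in> space \<mu>. norm v > real k} < e"
      using order_tendstoD(2)[OF _ \<open>e > 0\<close>] by (force simp: eventually_sequentially)
    define L where "L = max 1 (max K1 (real k))"
    have L: "L \<ge> 1" "L \<ge> K1" "L \<ge> real k" by (auto simp: L_def)
    \<comment> \<open>\<open>F\<close> undoes \<open>S\<close> as long as the coordinates of \<open>x / L\<close> stay in the range of \<open>arcsin\<close>.\<close>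
    define S :: "real^'n \<Rightarrow> real^'n" where "S x = (\<chi> i. sin (x $ i / L))" for x
    define F :: "real^'n \<Rightarrow> real" where "F s = f (\<chi> i. L * arcsin (s $ i))" for s
    let ?C = "cbox (- 1) 1 :: (real^'n) set"
    have S_in: "S x \<in> ?C" for x by (simp add: mem_box_cart S_def)
    have "continuous_on ?C F"
      unfolding F_def
      by (rule continuous_on_compose2[OF conjunct1[OF f]])
        (auto intro!: continuous_intros continuous_on_vec_lambda simp: mem_box_cart)
    then obtain p where p: "real_polynomial_function p" "\<And>s. s \<in> ?C \<Longrightarrow> \<bar>F s - p s\<bar> < r / 18"
      using Stone_Weierstrass_real_polynomial_function[of ?C F "r / 18"] \<open>r > 0\<close> by auto
    define q where "q x = p (S x)" for x
    have trig: "trig_poly (\<lambda>x. of_real (q x))"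
      using trig_poly_polynomial_sin[OF p(1), of "1 / L"] by (simp add: q_def S_def)
    have q_int: "integrable M (\<lambda>\<omega>. q (V n \<omega>))" for n
      using trig_poly_integrable[OF trig M V] by (rule iffD1[OF complex_of_real_integrable_eq])
    have q_int_\<mu>: "integrable \<mu> q"
      using trig_poly_integrable[OF trig \<mu>, of "\<lambda>v. v"] by (simp add: complex_of_real_integrable_eq)
    have f_int: "integrable M (\<lambda>\<omega>. f (V n \<omega>))" for n
      by (rule integrable_const_bound[of _ B]) (use B in auto)
    have f_int_\<mu>: "integrable \<mu> f"
      by (rule \<mu>.integrable_const_bound[of _ B]) (use B in auto)
    have agree: "F (S x) = f x" if "norm x \<le> L" for x
    proof -
      have "arcsin (sin (x $ i / L)) = x $ i / L" for i
      proof (rule arcsin_sin)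
        have "\<bar>x $ i\<bar> \<le> L" using component_le_norm_cart[of x i] that by linarith
        then have "\<bar>x $ i / L\<bar> \<le> 1" using L by (simp add: abs_divide)
        then show "- (pi / 2) \<le> x $ i / L" "x $ i / L \<le> pi / 2" using pi_gt3 by linarith+
      qed
      then show ?thesis using L by (simp add: F_def S_def vec_eq_iff)
    qed
    have diff: "\<bar>f x - q x\<bar> \<le> r / 18 + 2 * B * indicator {x. norm x > L} x" for x
    proof -
      have 1: "\<bar>F (S x) - q x\<bar> < r / 18" unfolding q_def by (rule p(2)[OF S_in])
      show ?thesis
      proof (cases "norm x \<le> L")
        case True
        then show ?thesis using 1 agree[OF True] by simp
      next
        case False
        have "\<bar>F (S x)\<bar> \<le> B" by (simp add: F_def B)
        then have "\<bar>f x - q x\<bar> \<le> r / 18 + 2 * B" using 1 B[of x] by linarith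
        then show ?thesis using False by simp
      qed
    qed
    have err: "\<bar>(\<integral>\<omega>. f (W \<omega>) \<partial>N) - (\<integral>\<omega>. q (W \<omega>) \<partial>N)\<bar> \<le> r / 18 + 2 * B * e"
      if N: "prob_space N" "W \<in> borel_measurable N" and int: "integrable N (\<lambda>\<omega>. f (W \<omega>))" "integrable N (\<lambda>\<omega>. q (W \<omega>))"
        and small: "measure N {\<omega> \<in> space N. norm (W \<omega>) > L} < e"
      for N :: "'u measure" and W
    proof -
      interpret N: prob_space N by fact
      note N(2)[measurable]
      let ?A = "{\<omega> \<in> space N. norm (W \<omega>) > L}"
      have "\<bar>(\<integral>\<omega>. f (W \<omega>) \<partial>N) - (\<integral>\<omega>. q (W \<omega>) \<partial>N)\<bar> = \<bar>\<integral>\<omega>. f (W \<omega>) - q (W \<omega>) \<partial>N\<bar>"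
        using int by simp
      also have "\<dots> \<le> (\<integral>\<omega>. \<bar>f (W \<omega>) - q (W \<omega>)\<bar> \<partial>N)" by (rule integral_abs_bound)
      also have "\<dots> \<le> (\<integral>\<omega>. r / 18 + 2 * B * indicator ?A \<omega> \<partial>N)"
      proof (rule integral_mono)
        show "\<bar>f (W \<omega>) - q (W \<omega>)\<bar> \<le> r / 18 + 2 * B * indicator ?A \<omega>" if "\<omega> \<in> space N" for \<omega>
          using diff[of "W \<omega>"] that by (auto simp: indicator_def split: if_splits)
        show "integrable N (\<lambda>\<omega>. r / 18 + 2 * B * indicator ?A \<omega>)"
          using \<open>B > 0\<close> \<open>r > 0\<close>
          by (intro N.integrable_const_bound[of _ "r / 18 + 2 * B"]) (auto simp: indicator_def)
      qed (use int in auto)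
      also have "\<dots> = r / 18 + 2 * B * measure N ?A"
      proof -
        have "integrable N (indicat_real ?A)"
          by (rule integrable_real_indicator) (auto simp: N.emeasure_eq_measure)
        then show ?thesis by (simp add: N.prob_space)
      qed
      also have "\<dots> \<le> r / 18 + 2 * B * e" using small \<open>B > 0\<close> by simp
      finally show ?thesis .
    qed
    have Be: "2 * B * e = 2 * r / 9" using \<open>B > 0\<close> by (simp add: e_def)
    have err_\<mu>: "\<bar>(\<integral>v. f v \<partial>\<mu>) - (\<integral>v. q v \<partial>\<mu>)\<bar> \<le> r / 18 + 2 * B * e"
    proof (rule err[OF \<mu>, of "\<lambda>v. v"])
      have "measure \<mu> {v \<in> space \<mu>. norm v > L} \<le> measure \<mu> {v \<in> space \<mu>. norm v > real k}"
        by (rule \<mu>.finite_measure_mono) (use L in auto)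
      then show "measure \<mu> {v \<in> space \<mu>. norm v > L} < e" using k by linarith
    qed (use f_int_\<mu> q_int_\<mu> in auto)
    have "(\<lambda>n. CLINT \<omega>|M. of_real (q (V n \<omega>))) \<longlonglongrightarrow> (CLINT v|\<mu>. of_real (q v))"
      by (rule trig_poly_expectation_tendsto[OF trig M V \<mu> sets_\<mu> char])
    then have "(\<lambda>n. \<integral>\<omega>. q (V n \<omega>) \<partial>M) \<longlonglongrightarrow> (\<integral>v. q v \<partial>\<mu>)"
      by (simp add: tendsto_of_real_iff)
    then have "eventually (\<lambda>n. dist (\<integral>\<omega>. q (V n \<omega>) \<partial>M) (\<integral>v. q v \<partial>\<mu>) < r / 9) sequentially"
      by (rule tendstoD) (use \<open>r > 0\<close> in simp)
    then have "eventually (\<lambda>n. norm ((\<integral>\<omega>. f (V n \<omega>) \<partial>M) - (\<integral>v. f v \<partial>\<mu>)) < r) sequentially"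
      using K1
    proof eventually_elim
      case (elim n)
      have "prob {\<omega> \<in> space M. norm (V n \<omega>) > L} \<le> prob {\<omega> \<in> space M. norm (V n \<omega>) > K1}"
        by (rule finite_measure_mono) (use L in auto)
      then have "\<bar>(\<integral>\<omega>. f (V n \<omega>) \<partial>M) - (\<integral>\<omega>. q (V n \<omega>) \<partial>M)\<bar> \<le> r / 18 + 2 * B * e"
        using elim by (intro err[OF M V f_int q_int]) linarith
      then show ?case
        using err_\<mu> elim(1) \<open>r > 0\<close> unfolding Be real_norm_def dist_real_def by linarith
    qed
    then show "\<exists>N. \<forall>n\<ge>N. norm ((\<integral>\<omega>. f (V n \<omega>) \<partial>M) - (\<integral>v. f v \<partial>\<mu>)) < r"
      by (auto simp: eventually_sequentially)
  qed
qed

section \<open>Existence of normal laws\<close>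

text \<open>Completing the square, coordinate after coordinate, writes a positive semidefinite quadratic
  form as a sum of squares of linear forms.\<close>

lemma psd_form_sum_of_squares:
  fixes A :: "real^'n^'n"
  assumes sym: "transpose A = A" and psd: "\<And>t. 0 \<le> t \<bullet> (A *v t)"
  shows "\<exists>c :: 'n \<Rightarrow> real^'n. \<forall>t. t \<bullet> (A *v t) = (\<Sum>j\<in>UNIV. (c j \<bullet> t)\<^sup>2)"
proof -
  have "\<exists>(c :: 'n \<Rightarrow> real^'n) R. linear R \<and> (\<forall>x y. x \<bullet> R y = R x \<bullet> y) \<and> (\<forall>t. 0 \<le> t \<bullet> R t) \<and>
      (\<forall>t. t \<bullet> (A *v t) = (\<Sum>j\<in>S. (c j \<bullet> t)\<^sup>2) + t \<bullet> R t) \<and> (\<forall>j\<in>S. R (axis j 1) = 0)" for S :: "'n set"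
  proof (induction S rule: finite_induct[OF finite])
    case 1
    show ?case
    proof (intro exI conjI)
      show "linear (\<lambda>t. A *v t)" by (rule matrix_vector_mul_linear)
      show "\<forall>x y. x \<bullet> (A *v y) = (A *v x) \<bullet> y"
        by (metis dot_lmul_matrix sym vector_transpose_matrix)
    qed (use psd in auto)
  next
    case (2 i S)
    then obtain c :: "'n \<Rightarrow> real^'n" and R where R: "linear R" "\<And>x y. x \<bullet> R y = R x \<bullet> y" "\<And>t. 0 \<le> t \<bullet> R t"
      and form: "\<And>t. t \<bullet> (A *v t) = (\<Sum>j\<in>S. (c j \<bullet> t)\<^sup>2) + t \<bullet> R t"
      and kernel: "\<And>j. j \<in> S \<Longrightarrow> R (axis j 1) = 0" by blast
    interpret R: linear R by (rule R(1))
    define e :: "real^'n" where "e = axis i 1"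
    define r where "r = R e"
    define \<delta> where "\<delta> = e \<bullet> r"
    have expand: "(t + s *\<^sub>R e) \<bullet> R (t + s *\<^sub>R e) = t \<bullet> R t + 2 * s * (r \<bullet> t) + s\<^sup>2 * \<delta>" for t s
      using R(2)[of e t]
      by (simp add: R.add R.scale inner_add_left inner_add_right r_def \<delta>_def power2_eq_square
          inner_commute algebra_simps)
    have "\<delta> \<ge> 0" using R(3)[of e] by (simp add: \<delta>_def r_def)
    show ?case
    proof (cases "\<delta> = 0")
      case True
      have "r \<bullet> t = 0" for t
      proof (rule ccontr)
        assume *: "r \<bullet> t \<noteq> 0"
        have "0 \<le> t \<bullet> R t + 2 * s * (r \<bullet> t)" for s
          using R(3)[of "t + s *\<^sub>R e"] by (simp add: expand True)
        \<comment> \<open>an \<open>s\<close> that makes the right-hand side equal to \<open>- 1\<close>\<close>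
        from this[of "- (t \<bullet> R t + 1) / (2 * (r \<bullet> t))"] * show False by (simp add: field_simps)
      qed
      then have "r = 0" by (metis inner_eq_zero_iff)
      then have "R (axis i 1) = 0" by (simp add: r_def e_def)
      moreover have "(\<Sum>j\<in>insert i S. ((c(i := 0)) j \<bullet> t)\<^sup>2) = (\<Sum>j\<in>S. (c j \<bullet> t)\<^sup>2)" for t
        using 2 by (auto intro!: sum.cong)
      ultimately show ?thesis using R form kernel
        by (intro exI[of _ "c(i := 0)"] exI[of _ R]) auto
    next
      case False
      with \<open>\<delta> \<ge> 0\<close> have "\<delta> > 0" by simp
      \<comment> \<open>Subtracting the square of \<open>t \<mapsto> r \<bullet> t / \<surd>\<delta>\<close> puts \<open>e\<close> into the kernel and keeps there what was in it.\<close>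
      define R' where "R' t = R t - ((r \<bullet> t) / \<delta>) *\<^sub>R r" for t
      have form': "t \<bullet> R' t = t \<bullet> R t - (r \<bullet> t)\<^sup>2 / \<delta>" for t
        by (simp add: R'_def inner_diff_right inner_commute power2_eq_square)
      have "linear R'"
        unfolding R'_def
        by (intro linearI) (simp_all add: R.add R.scale inner_add_right add_divide_distrib
            scaleR_add_left algebra_simps)
      moreover have "x \<bullet> R' y = R' x \<bullet> y" for x y
        using R(2)[of x y] by (simp add: R'_def inner_diff_right inner_diff_left inner_commute)
      moreover have "0 \<le> t \<bullet> R' t" for t
      proof -
        have "0 \<le> (t + (- (r \<bullet> t) / \<delta>) *\<^sub>R e) \<bullet> R (t + (- (r \<bullet> t) / \<delta>) *\<^sub>R e)" by (rule R(3))
        also have "\<dots> = t \<bullet> R' t"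
          using \<open>\<delta> > 0\<close> unfolding expand form' by (simp add: field_simps power2_eq_square)
        finally show ?thesis .
      qed
      moreover have "t \<bullet> (A *v t) = (\<Sum>j\<in>insert i S. ((c(i := r /\<^sub>R sqrt \<delta>)) j \<bullet> t)\<^sup>2) + t \<bullet> R' t" for t
      proof -
        have "(\<Sum>j\<in>S. ((c(i := r /\<^sub>R sqrt \<delta>)) j \<bullet> t)\<^sup>2) = (\<Sum>j\<in>S. (c j \<bullet> t)\<^sup>2)"
          using 2 by (auto intro!: sum.cong)
        then show ?thesis
          using 2 \<open>\<delta> > 0\<close> by (simp add: form form' power_mult_distrib power_divide divide_inverse
              power_inverse)
      qed
      moreover have "R' (axis j 1) = 0" if "j \<in> insert i S" for j
      proof (cases "j = i")
        case True
        then show ?thesis using \<open>\<delta> > 0\<close> by (simp add: R'_def e_def[symmetric] r_def[symmetric] \<delta>_def inner_commute)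
      next
        case False
        with that have "R (axis j 1) = 0" using kernel by auto
        moreover have "r \<bullet> axis j 1 = 0"
          using R(2)[of e "axis j 1"] calculation by (simp add: r_def)
        ultimately show ?thesis by (simp add: R'_def)
      qed
      ultimately show ?thesis by blast
    qed
  qed
  from this[of UNIV] obtain c :: "'n \<Rightarrow> real^'n" and R where "linear R"
    and form: "\<And>t. t \<bullet> (A *v t) = (\<Sum>j\<in>UNIV. (c j \<bullet> t)\<^sup>2) + t \<bullet> R t"
    and kernel: "\<And>j. R (axis j 1) = 0" by auto
  interpret R: linear R by fact
  have "R t = 0" for t
    using arg_cong[OF basis_expansion[of t], of R] kernel
    by (simp add: scalar_mult_eq_scaleR R.sum R.scale)
  then show ?thesis using form by auto
qed

text \<open>The normal law with covariance \<open>A = \<Sum>\<^sub>j c\<^sub>j c\<^sub>j\<^sup>T\<close> is the law of \<open>\<Sum>\<^sub>j N\<^sub>j c\<^sub>j\<close> for independent standard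
  normal \<open>N\<^sub>j\<close>.\<close>

theorem multivariate_normal_exists:
  fixes A :: "real^'n^'n"
  assumes sym: "transpose A = A" and psd: "\<And>t. 0 \<le> t \<bullet> (A *v t)"
  shows "\<exists>\<mu>. multivariate_normal \<mu> 0 A"
proof -
  obtain c :: "'n \<Rightarrow> real^'n" where c: "\<And>t. t \<bullet> (A *v t) = (\<Sum>j\<in>UNIV. (c j \<bullet> t)\<^sup>2)"
    using psd_form_sum_of_squares[OF assms] by blast
  let ?N = "std_normal_distribution"
  interpret N: real_distribution ?N by (rule real_dist_normal_dist)
  interpret P: product_prob_space "\<lambda>_::'n. ?N" UNIV
    by unfold_locales
  let ?P = "\<Pi>\<^sub>M j\<in>(UNIV::'n set). ?N"
  have meas: "(\<lambda>\<omega>. \<Sum>j\<in>UNIV. \<omega> j *\<^sub>R c j) \<in> borel_measurable ?P"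
    by (intro borel_measurable_sum borel_measurable_scaleR) auto
  define \<mu> where "\<mu> = distr ?P borel (\<lambda>\<omega>. \<Sum>j\<in>UNIV. \<omega> j *\<^sub>R c j)"
  have "(CLINT v|\<mu>. iexp (t \<bullet> v)) = of_real (exp (- (t \<bullet> (A *v t)) / 2))" for t
  proof -
    have "(CLINT v|\<mu>. iexp (t \<bullet> v)) = (CLINT \<omega>|?P. iexp (t \<bullet> (\<Sum>j\<in>UNIV. \<omega> j *\<^sub>R c j)))"
      unfolding \<mu>_def by (rule integral_distr[OF meas]) measurable
    also have "\<dots> = (CLINT \<omega>|?P. (\<Prod>j\<in>UNIV. iexp ((c j \<bullet> t) * \<omega> j)))"
    proof -
      have "iexp (t \<bullet> (\<Sum>j\<in>UNIV. \<omega> j *\<^sub>R c j)) = (\<Prod>j\<in>UNIV. iexp ((c j \<bullet> t) * \<omega> j))" for \<omega> :: "'n \<Rightarrow> real"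
      proof -
        have "t \<bullet> (\<Sum>j\<in>UNIV. \<omega> j *\<^sub>R c j) = (\<Sum>j\<in>UNIV. (c j \<bullet> t) * \<omega> j)"
          by (simp add: inner_sum_right inner_commute mult.commute)
        then show ?thesis by (simp only: of_real_sum sum_distrib_left exp_sum[OF finite])
      qed
      then show ?thesis by simp
    qed
    also have "\<dots> = (\<Prod>j\<in>UNIV. CLINT x|?N. iexp ((c j \<bullet> t) * x))"
      by (rule P.product_integral_prod) (auto intro!: N.integrable_iexp)
    also have "\<dots> = (\<Prod>j\<in>UNIV. of_real (exp (- ((c j \<bullet> t)\<^sup>2) / 2)))"
      using char_std_normal_distribution by (simp add: char_def fun_eq_iff)
    also have "\<dots> = of_real (exp (- (t \<bullet> (A *v t)) / 2))"
      by (simp add: c exp_sum[symmetric] sum_negf sum_divide_distrib flip: of_real_prod)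
    finally show ?thesis .
  qed
  moreover have "prob_space \<mu>" unfolding \<mu>_def by (rule P.prob_space_distr[OF meas])
  ultimately have "multivariate_normal \<mu> 0 A"
    using sym by (simp add: multivariate_normal_def \<mu>_def)
  then show ?thesis ..
qed

section \<open>Passage to the normal limit\<close>

lemma norm_iexp_diff_le: "norm (iexp x - iexp y) \<le> \<bar>x - y\<bar>"
proof -
  have "iexp x - iexp y = iexp y * (iexp (x - y) - 1)"
    by (simp add: right_diff_distrib flip: exp_add)
  then have "norm (iexp x - iexp y) = norm (iexp (x - y) - 1)" by (simp add: norm_mult)
  also have "\<dots> \<le> \<bar>x - y\<bar>" using iexp_approx1[of "x - y" 0] by simp
  finally show ?thesis .
qed

text \<open>Limits of characteristic functions are not affected by perturbations that tend to zero in
  probability.\<close>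

lemma (in prob_space) characteristic_function_Slutsky:
  fixes V W :: "nat \<Rightarrow> 'a \<Rightarrow> 'b::euclidean_space"
  assumes V [measurable]: "\<And>n. V n \<in> borel_measurable M" and W [measurable]: "\<And>n. W n \<in> borel_measurable M"
    and diff: "\<And>\<epsilon>. \<epsilon> > 0 \<Longrightarrow> (\<lambda>n. prob {\<omega> \<in> space M. norm (V n \<omega> - W n \<omega>) > \<epsilon>}) \<longlonglongrightarrow> 0"
    and lim: "(\<lambda>n. CLINT \<omega>|M. iexp (t \<bullet> W n \<omega>)) \<longlonglongrightarrow> c"
  shows "(\<lambda>n. CLINT \<omega>|M. iexp (t \<bullet> V n \<omega>)) \<longlonglongrightarrow> c"
proof -
  have "(\<lambda>n. (CLINT \<omega>|M. iexp (t \<bullet> V n \<omega>)) - (CLINT \<omega>|M. iexp (t \<bullet> W n \<omega>))) \<longlonglongrightarrow> 0"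
  proof (rule LIMSEQ_I)
    fix r :: real assume "r > 0"
    define \<epsilon> where "\<epsilon> = r / 4 / (norm t + 1)"
    have t1: "norm t + 1 > 0" by (simp add: add_nonneg_pos)
    then have "\<epsilon> > 0" using \<open>r > 0\<close> by (simp add: \<epsilon>_def)
    have "norm t * \<epsilon> \<le> (norm t + 1) * \<epsilon>" using \<open>\<epsilon> > 0\<close> by simp
    also have "\<dots> = r / 4" using t1 unfolding \<epsilon>_def by (intro nonzero_mult_div_cancel_left[THEN trans[OF times_divide_eq_right]]) simp
    finally have t\<epsilon>: "norm t * \<epsilon> \<le> r / 4" .
    let ?B = "\<lambda>n. {\<omega> \<in> space M. norm (V n \<omega> - W n \<omega>) > \<epsilon>}"
    have bound: "norm ((CLINT \<omega>|M. iexp (t \<bullet> V n \<omega>)) - (CLINT \<omega>|M. iexp (t \<bullet> W n \<omega>))) \<le> r / 4 + 2 * prob (?B n)" for n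
    proof -
      have int: "integrable M (\<lambda>\<omega>. iexp (t \<bullet> V n \<omega>))" "integrable M (\<lambda>\<omega>. iexp (t \<bullet> W n \<omega>))"
        by (rule integrable_iexp; measurable)+
      have ind: "integrable M (indicat_real (?B n))"
        by (rule integrable_real_indicator) (auto simp: emeasure_eq_measure)
      have "norm ((CLINT \<omega>|M. iexp (t \<bullet> V n \<omega>)) - (CLINT \<omega>|M. iexp (t \<bullet> W n \<omega>)))
          = norm (CLINT \<omega>|M. iexp (t \<bullet> V n \<omega>) - iexp (t \<bullet> W n \<omega>))"
        by (simp only: Bochner_Integration.integral_diff[OF int])
      also have "\<dots> \<le> (\<integral>\<omega>. norm (iexp (t \<bullet> V n \<omega>) - iexp (t \<bullet> W n \<omega>)) \<partial>M)"
        by (rule integral_norm_bound)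
      also have "\<dots> \<le> (\<integral>\<omega>. r / 4 + 2 * indicator (?B n) \<omega> \<partial>M)"
      proof (rule integral_mono)
        show "integrable M (\<lambda>\<omega>. norm (iexp (t \<bullet> V n \<omega>) - iexp (t \<bullet> W n \<omega>)))"
          by (intro integrable_norm Bochner_Integration.integrable_diff int)
        show "integrable M (\<lambda>\<omega>. r / 4 + 2 * indicator (?B n) \<omega>)" using ind by simp
        fix \<omega> assume \<omega>: "\<omega> \<in> space M"
        show "norm (iexp (t \<bullet> V n \<omega>) - iexp (t \<bullet> W n \<omega>)) \<le> r / 4 + 2 * indicator (?B n) \<omega>"
        proof (cases "norm (V n \<omega> - W n \<omega>) \<le> \<epsilon>")
          case True
          have "norm (iexp (t \<bullet> V n \<omega>) - iexp (t \<bullet> W n \<omega>)) \<le> \<bar>t \<bullet> V n \<omega> - t \<bullet> W n \<omega>\<bar>"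
            by (rule norm_iexp_diff_le)
          also have "\<dots> = \<bar>t \<bullet> (V n \<omega> - W n \<omega>)\<bar>" by (simp add: inner_diff_right)
          also have "\<dots> \<le> norm t * norm (V n \<omega> - W n \<omega>)" by (rule Cauchy_Schwarz_ineq2)
          also have "\<dots> \<le> norm t * \<epsilon>" using True by (rule mult_left_mono) simp
          also have "\<dots> \<le> r / 4" by (rule t\<epsilon>)
          finally show ?thesis using True by simp
        next
          case False
          have "norm (iexp (t \<bullet> V n \<omega>) - iexp (t \<bullet> W n \<omega>)) \<le> 1 + 1"
            by (rule norm_triangle_le_diff) simp
          then show ?thesis using False \<omega> \<open>r > 0\<close> by simp
        qed
      qed
      also have "\<dots> = r / 4 + 2 * prob (?B n)" using ind by (simp add: prob_space)
      finally show ?thesis .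
    qed
    have "eventually (\<lambda>n. prob (?B n) < r / 4) sequentially"
      by (rule order_tendstoD(2)[OF diff[OF \<open>\<epsilon> > 0\<close>]]) (use \<open>r > 0\<close> in simp)
    then have "eventually (\<lambda>n. norm ((CLINT \<omega>|M. iexp (t \<bullet> V n \<omega>)) - (CLINT \<omega>|M. iexp (t \<bullet> W n \<omega>)) - 0) < r) sequentially"
    proof eventually_elim
      case (elim n)
      then show ?case using bound[of n] \<open>r > 0\<close> unfolding diff_zero by linarith
    qed
    then show "\<exists>N. \<forall>n\<ge>N. norm ((CLINT \<omega>|M. iexp (t \<bullet> V n \<omega>)) - (CLINT \<omega>|M. iexp (t \<bullet> W n \<omega>)) - 0) < r"
      by (auto simp: eventually_sequentially)
  qed
  from tendsto_add[OF this lim] show ?thesis by simp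
qed

text \<open>If \<open>G n\<close> is tight, its characteristic functions converge to that of the normal law with covariance
  \<open>A\<close>, and \<open>V n - B G n\<close> tends to zero in probability, then \<open>V n\<close> is asymptotically normal with covariance
  \<open>B A B\<^sup>T\<close>, which equals \<open>B\<close> here.\<close>

lemma (in prob_space) asymptotically_normal_linear_image:
  fixes V G :: "nat \<Rightarrow> 'a \<Rightarrow> real^'n" and A B :: "real^'n^'n"
  assumes V [measurable]: "\<And>n. V n \<in> borel_measurable M" and G [measurable]: "\<And>n. G n \<in> borel_measurable M"
    and tight: "\<And>\<epsilon>. \<epsilon> > 0 \<Longrightarrow> \<exists>K>0. \<forall>n>0. prob {\<omega> \<in> space M. norm (G n \<omega>) > K} \<le> \<epsilon>"
    and char: "\<And>t. (\<lambda>n. CLINT \<omega>|M. iexp (t \<bullet> G n \<omega>)) \<longlonglongrightarrow> of_real (exp (- (t \<bullet> (A *v t)) / 2))"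
    and B_sym: "transpose B = B" and BAB: "B ** A ** B = B" and A_nonneg: "\<And>t. 0 \<le> t \<bullet> (A *v t)"
    and linear: "\<And>K \<epsilon>. K > 0 \<Longrightarrow> \<epsilon> > 0 \<Longrightarrow> whp M (\<lambda>n \<omega>. norm (G n \<omega>) \<le> K \<longrightarrow> norm (V n \<omega> - B *v G n \<omega>) \<le> \<epsilon>)"
  shows "asymptotically_normal M V 0 B"
proof -
  have BG [measurable]: "(\<lambda>\<omega>. B *v G n \<omega>) \<in> borel_measurable M" for n
    by (rule borel_measurable_continuous_on[OF _ G]) (intro continuous_intros)
  have move: "t \<bullet> (B *v v) = (B *v t) \<bullet> v" for t v
    by (metis B_sym dot_lmul_matrix vector_transpose_matrix)
  have form: "t \<bullet> (B *v t) = (B *v t) \<bullet> (A *v (B *v t))" for t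
    unfolding move[symmetric] by (simp add: matrix_vector_mul_assoc matrix_mul_assoc BAB)
  then have "0 \<le> t \<bullet> (B *v t)" for t using A_nonneg by simp
  then obtain \<mu> where \<mu>: "multivariate_normal \<mu> 0 B"
    using multivariate_normal_exists[OF B_sym] by blast
  have diff: "(\<lambda>n. prob {\<omega> \<in> space M. norm (V n \<omega> - B *v G n \<omega>) > \<epsilon>}) \<longlonglongrightarrow> 0" if "\<epsilon> > 0" for \<epsilon>
  proof (rule prob_tendsto_zeroI)
    fix r :: real assume "r > 0"
    then obtain K where K: "K > 0" "\<And>n. n > 0 \<Longrightarrow> prob {\<omega> \<in> space M. norm (G n \<omega>) > K} \<le> r / 4"
      using tight[of "r / 4"] by auto
    let ?E = "\<lambda>n. {\<omega> \<in> space M. \<not> (norm (G n \<omega>) \<le> K \<longrightarrow> norm (V n \<omega> - B *v G n \<omega>) \<le> \<epsilon>)}"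
    have "(\<lambda>n. prob (?E n)) \<longlonglongrightarrow> 0" by (rule whpD[OF linear[OF K(1) that]])
    then have "eventually (\<lambda>n. prob (?E n) < r / 4) sequentially"
      by (rule order_tendstoD(2)) (use \<open>r > 0\<close> in simp)
    then show "eventually (\<lambda>n. prob {\<omega> \<in> space M. norm (V n \<omega> - B *v G n \<omega>) > \<epsilon>} < r) sequentially"
      using eventually_gt_at_top[of 0]
    proof eventually_elim
      case (elim n)
      have "prob {\<omega> \<in> space M. norm (V n \<omega> - B *v G n \<omega>) > \<epsilon>}
          \<le> prob (?E n \<union> {\<omega> \<in> space M. norm (G n \<omega>) > K})"
        by (intro finite_measure_mono) auto
      also have "\<dots> \<le> prob (?E n) + prob {\<omega> \<in> space M. norm (G n \<omega>) > K}"
        by (intro measure_Un_le) auto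
      also have "\<dots> < r" using elim(1) K(2)[OF elim(2)] \<open>r > 0\<close> by linarith
      finally show ?case .
    qed
  qed
  have "conv_in_distr M V \<mu>"
  proof (rule conv_in_distr_by_characteristic_functions)
    show "prob_space M" by (rule prob_space_axioms)
    show "prob_space \<mu>" "sets \<mu> = sets borel" using \<mu> by (auto simp: multivariate_normal_def)
    fix t :: "real^'n"
    have "(\<lambda>n. CLINT \<omega>|M. iexp (t \<bullet> (B *v G n \<omega>))) \<longlonglongrightarrow> of_real (exp (- (t \<bullet> (B *v t)) / 2))"
      unfolding form using char[of "B *v t"] by (simp only: move)
    from characteristic_function_Slutsky[OF V BG diff this]
    show "(\<lambda>n. CLINT \<omega>|M. iexp (t \<bullet> V n \<omega>)) \<longlonglongrightarrow> (CLINT v|\<mu>. iexp (t \<bullet> v))"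
      using \<mu> by (simp add: multivariate_normal_def)
  next
    fix \<epsilon> :: real assume "\<epsilon> > 0"
    then obtain K where K: "K > 0" "\<And>n. n > 0 \<Longrightarrow> prob {\<omega> \<in> space M. norm (G n \<omega>) > K} \<le> \<epsilon> / 4"
      using tight[of "\<epsilon> / 4"] by auto
    define b where "b = onorm ((*v) B)"
    have b: "b \<ge> 0" "norm (B *v g) \<le> b * norm g" for g
      by (auto simp: b_def onorm_pos_le intro: onorm)
    have "eventually (\<lambda>n. prob {\<omega> \<in> space M. norm (V n \<omega> - B *v G n \<omega>) > 1} < \<epsilon> / 4) sequentially"
      by (rule order_tendstoD(2)[OF diff[of 1]]) (use \<open>\<epsilon> > 0\<close> in simp_all)
    then have "eventually (\<lambda>n. prob {\<omega> \<in> space M. norm (V n \<omega>) > b * K + 1} < \<epsilon>) sequentially"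
      using eventually_gt_at_top[of 0]
    proof eventually_elim
      case (elim n)
      have "{\<omega> \<in> space M. norm (V n \<omega>) > b * K + 1}
          \<subseteq> {\<omega> \<in> space M. norm (V n \<omega> - B *v G n \<omega>) > 1} \<union> {\<omega> \<in> space M. norm (G n \<omega>) > K}"
      proof (rule subsetI, rule ccontr)
        fix \<omega> assume *: "\<omega> \<in> {\<omega> \<in> space M. norm (V n \<omega>) > b * K + 1}"
          "\<omega> \<notin> {\<omega> \<in> space M. norm (V n \<omega> - B *v G n \<omega>) > 1} \<union> {\<omega> \<in> space M. norm (G n \<omega>) > K}"
        then have "norm (V n \<omega> - B *v G n \<omega>) \<le> 1" "norm (G n \<omega>) \<le> K" by auto
        moreover have "norm (B *v G n \<omega>) \<le> b * K"
          using b(2)[of "G n \<omega>"] mult_left_mono[OF calculation(2) b(1)] by linarith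
        moreover have "norm (V n \<omega>) \<le> norm (B *v G n \<omega>) + norm (V n \<omega> - B *v G n \<omega>)"
          by (rule norm_triangle_sub)
        ultimately show False using * by simp
      qed
      then have "prob {\<omega> \<in> space M. norm (V n \<omega>) > b * K + 1}
          \<le> prob ({\<omega> \<in> space M. norm (V n \<omega> - B *v G n \<omega>) > 1} \<union> {\<omega> \<in> space M. norm (G n \<omega>) > K})"
        by (intro finite_measure_mono) auto
      also have "\<dots> \<le> prob {\<omega> \<in> space M. norm (V n \<omega> - B *v G n \<omega>) > 1} + prob {\<omega> \<in> space M. norm (G n \<omega>) > K}"
        by (intro measure_Un_le) auto
      also have "\<dots> < \<epsilon>" using elim(1) K(2)[OF elim(2)] \<open>\<epsilon> > 0\<close> by linarith
      finally show ?case .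
    qed
    then show "\<exists>K. eventually (\<lambda>n. prob {\<omega> \<in> space M. norm (V n \<omega>) > K} < \<epsilon>) sequentially" by blast
  qed (rule V)
  with \<mu> show ?thesis unfolding asymptotically_normal_def by blast
qed

section \<open>The exponential family\<close>

lemma measurable_continuous_on_compose:
  fixes g :: "'b::topological_space \<Rightarrow> 'c::topological_space"
  assumes f: "f \<in> borel_measurable N" and in_S: "\<And>x. x \<in> space N \<Longrightarrow> f x \<in> S" and g: "continuous_on S g"
  shows "(\<lambda>x. g (f x)) \<in> borel_measurable N"
proof -
  have "f \<in> measurable N (restrict_space borel S)"
    using f in_S by (intro measurable_restrict_space2) auto
  moreover have "g \<in> borel_measurable (restrict_space borel S)"
    using g by (rule borel_measurable_continuous_on_restrict)
  ultimately show ?thesis by (rule measurable_compose)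
qed

context exponential_family
begin

text \<open>\<open>H\<close> is the natural parameter space.\<close>

abbreviation "H \<equiv> natural_parameter_space \<nu> T h"

lemma open_H: "open H"
  unfolding natural_parameter_space_eq by (rule open_second_part[OF H2_open])

lemma convex_H: "convex H"
  using psi_strictly_convex by (simp add: strictly_convex_on_def)

lemma psi_convex:
  assumes "x \<in> H" "y \<in> H" "0 \<le> t" "t \<le> 1"
  shows "\<psi> ((1 - t) *\<^sub>R x + t *\<^sub>R y) \<le> (1 - t) * \<psi> x + t * \<psi> y"
proof (cases "x = y \<or> t = 0 \<or> t = 1")
  case True
  then show ?thesis by (auto simp: scaleR_left_diff_distrib algebra_simps)
next
  case False
  then show ?thesis
    using psi_strictly_convex assms unfolding strictly_convex_on_def by (metis less_eq_real_def)
qed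

lemma psi_has_derivative:
  assumes "\<eta> \<in> H"
  shows "(\<psi> has_derivative (\<lambda>v. grad \<psi> \<eta> \<bullet> v)) (at \<eta>)"
proof -
  have "\<psi> differentiable (at \<eta>)" using psi_smooth[of "Suc 0"] assms by simp
  then have *: "(\<psi> has_derivative frechet_derivative \<psi> (at \<eta>)) (at \<eta>)"
    by (simp add: frechet_derivative_works)
  have "frechet_derivative \<psi> (at \<eta>) = (\<lambda>v. grad \<psi> \<eta> \<bullet> v)"
    unfolding grad_def by (rule ext) (rule linear_eq_sum_axis[OF has_derivative_linear[OF *]])
  with * show ?thesis by simp
qed

lemma psi_continuous: "continuous_on H \<psi>"
  using psi_smooth[of 0] by simp

lemma grad_component_smooth: "C_k_on n (\<lambda>\<eta>. grad \<psi> \<eta> $ i) H"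
  using psi_smooth[of "Suc n"] by (simp add: grad_def)

lemma grad_psi_has_derivative:
  assumes "\<eta> \<in> H"
  shows "(grad \<psi> has_derivative (\<lambda>v. hessian \<psi> \<eta> *v v)) (at \<eta>)"
proof -
  have comp: "(\<lambda>\<eta>. grad \<psi> \<eta> $ i) differentiable (at \<eta>)" for i
    using grad_component_smooth[of "Suc 0" i] assms by simp
  have "(grad \<psi> has_derivative (\<lambda>v. \<chi> i. frechet_derivative (\<lambda>\<eta>. grad \<psi> \<eta> $ i) (at \<eta>) v)) (at \<eta>)"
    unfolding has_derivative_componentwise_within[of "grad \<psi>"]
    using comp by (auto simp: Basis_vec_def inner_axis frechet_derivative_works)
  then have "grad \<psi> differentiable (at \<eta>)" by (rule differentiableI)
  then show ?thesis by (simp add: hessian_def jacobian_works)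
qed

lemma grad_psi_continuous: "continuous_on H (grad \<psi>)"
  by (meson continuous_at_imp_continuous_on grad_psi_has_derivative has_derivative_continuous)

lemma hessian_psi_continuous: "continuous_on H (hessian \<psi>)"
proof -
  have "hessian \<psi> \<eta> $ i $ j = frechet_derivative (\<lambda>\<eta>. grad \<psi> \<eta> $ i) (at \<eta>) (axis j 1)"
    if "\<eta> \<in> H" for \<eta> i j
  proof -
    have "((\<lambda>\<eta>. grad \<psi> \<eta> $ i) has_derivative (\<lambda>v. (hessian \<psi> \<eta> *v v) $ i)) (at \<eta>)"
      by (rule bounded_linear.has_derivative[OF bounded_linear_vec_nth grad_psi_has_derivative[OF that]])
    then have "frechet_derivative (\<lambda>\<eta>. grad \<psi> \<eta> $ i) (at \<eta>) (axis j 1) = (hessian \<psi> \<eta> *v axis j 1) $ i"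
      by (metis frechet_derivative_at)
    then show ?thesis by (simp add: matrix_vector_mul_component inner_axis)
  qed
  then have eq: "(\<chi> i j. frechet_derivative (\<lambda>\<eta>. grad \<psi> \<eta> $ i) (at \<eta>) (axis j 1)) = hessian \<psi> \<eta>"
    if "\<eta> \<in> H" for \<eta> using that by (simp add: vec_eq_iff)
  have "continuous_on H (\<lambda>\<eta>. \<chi> i j. frechet_derivative (\<lambda>\<eta>. grad \<psi> \<eta> $ i) (at \<eta>) (axis j 1))"
  proof (intro continuous_on_vec_lambda)
    fix i j
    show "continuous_on H (\<lambda>\<eta>. frechet_derivative (\<lambda>\<eta>. grad \<psi> \<eta> $ i) (at \<eta>) (axis j 1))"
      using grad_component_smooth[of "Suc 0" i] by simp
  qed
  then show ?thesis by (rule continuous_on_eq) (rule eq)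
qed

lemma psi_Taylor:
  assumes "\<eta>\<^sub>0 \<in> H" "\<eta>\<^sub>0 + v \<in> H"
  obtains s where "0 < s" "s < 1"
    "\<psi> (\<eta>\<^sub>0 + v) = \<psi> \<eta>\<^sub>0 + grad \<psi> \<eta>\<^sub>0 \<bullet> v + (v \<bullet> (hessian \<psi> (\<eta>\<^sub>0 + s *\<^sub>R v) *v v)) / 2"
proof -
  have seg: "\<eta>\<^sub>0 + t *\<^sub>R v \<in> H" if "0 \<le> t" "t \<le> 1" for t
    using convexD_alt[OF convex_H assms that] by (simp add: algebra_simps)
  define \<phi> where "\<phi> m t = (if m = 0 then \<psi> (\<eta>\<^sub>0 + t *\<^sub>R v) else if m = 1 then grad \<psi> (\<eta>\<^sub>0 + t *\<^sub>R v) \<bullet> v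
      else v \<bullet> (hessian \<psi> (\<eta>\<^sub>0 + t *\<^sub>R v) *v v))" for m :: nat and t
  have line: "((\<lambda>t. \<eta>\<^sub>0 + t *\<^sub>R v) has_derivative (\<lambda>h. h *\<^sub>R v)) (at t)" for t
    by (auto intro!: derivative_eq_intros)
  have "DERIV (\<phi> m) t :> \<phi> (Suc m) t" if "m < 2" "0 \<le> t" "t \<le> 1" for m t
  proof (cases "m = 0")
    case True
    have "((\<lambda>t. \<psi> (\<eta>\<^sub>0 + t *\<^sub>R v)) has_derivative (\<lambda>h. grad \<psi> (\<eta>\<^sub>0 + t *\<^sub>R v) \<bullet> (h *\<^sub>R v))) (at t)"
      using has_derivative_compose[OF line psi_has_derivative[OF seg[OF that(2,3)]]] by simp
    then show ?thesis
      using True by (auto simp: has_field_derivative_def \<phi>_def[abs_def] mult.commute fun_eq_iff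
          elim!: has_derivative_eq_rhs)
  next
    case False
    with that have "m = 1" by simp
    have "((\<lambda>t. grad \<psi> (\<eta>\<^sub>0 + t *\<^sub>R v)) has_derivative (\<lambda>h. hessian \<psi> (\<eta>\<^sub>0 + t *\<^sub>R v) *v (h *\<^sub>R v))) (at t)"
      using has_derivative_compose[OF line grad_psi_has_derivative[OF seg[OF that(2,3)]]] by simp
    then have "((\<lambda>t. grad \<psi> (\<eta>\<^sub>0 + t *\<^sub>R v) \<bullet> v) has_derivative (\<lambda>h. (hessian \<psi> (\<eta>\<^sub>0 + t *\<^sub>R v) *v (h *\<^sub>R v)) \<bullet> v)) (at t)"
      by (rule has_derivative_inner_left)
    then show ?thesis
      using \<open>m = 1\<close> by (auto simp: has_field_derivative_def \<phi>_def[abs_def] mult.commute fun_eq_iff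
          matrix_vector_mult_scaleR inner_commute elim!: has_derivative_eq_rhs)
  qed
  then obtain s where "0 < s" "s < 1" and
    "\<phi> 0 1 = (\<Sum>m<2. \<phi> m 0 / fact m * 1 ^ m) + \<phi> 2 s / fact 2 * 1 ^ 2"
    using Maclaurin[of 1 2 \<phi> "\<phi> 0"] by auto
  then have "\<psi> (\<eta>\<^sub>0 + v) = \<psi> \<eta>\<^sub>0 + grad \<psi> \<eta>\<^sub>0 \<bullet> v + (v \<bullet> (hessian \<psi> (\<eta>\<^sub>0 + s *\<^sub>R v) *v v)) / 2"
    by (simp add: \<phi>_def numeral_2_eq_2)
  with \<open>0 < s\<close> \<open>s < 1\<close> show ?thesis using that by blast
qed

subsection \<open>The law of the sufficient statistic\<close>

text \<open>\<open>P\<^sub>Y \<eta>\<close> is the member of the family with natural parameter \<open>\<eta>\<close>.\<close>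

abbreviation "P\<^sub>Y \<eta> \<equiv> density \<nu> (\<lambda>y. ennreal (ef_density T h \<psi> \<eta> y))"

lemma sets_nu [measurable_cong]: "sets \<nu> = sets borel"
  using base by (auto simp: base_measure_def)

lemma space_nu: "space \<nu> = UNIV"
  using sets_eq_imp_space_eq[OF sets_nu] by simp

lemma sigma_finite_nu: "sigma_finite_measure \<nu>"
proof (cases "\<nu> = lborel")
  case True
  then show ?thesis using sigma_finite_lborel by simp
next
  case False
  then obtain D where D: "countable D" "\<nu> = distr (count_space D) borel (\<lambda>y. y)"
    using base by (auto simp: base_measure_def)
  have em: "emeasure \<nu> B = emeasure (count_space D) (B \<inter> D)" if "B \<in> sets borel" for B
    using that unfolding D(2) by (subst emeasure_distr) (auto intro: measurable_count_space_extend)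
  show ?thesis
  proof (rule sigma_finite_measure.intro, intro exI conjI)
    let ?A = "insert (- D) ((\<lambda>y. {y}) ` D)"
    have "D \<in> sets borel" using D(1) by (rule sets.countable[rotated]) auto
    then have "- D \<in> sets borel" by (metis borel_comp)
    then show "?A \<subseteq> sets \<nu>" by (auto simp: sets_nu)
    show "countable ?A" using D(1) by simp
    show "\<Union> ?A = space \<nu>" by (auto simp: space_nu)
    show "\<forall>a\<in>?A. emeasure \<nu> a \<noteq> \<infinity>"
      using \<open>- D \<in> sets borel\<close> by (auto simp: em emeasure_count_space)
  qed
qed

lemma ef_density_nonneg: "0 \<le> ef_density T h \<psi> \<eta> y"
  by (simp add: ef_density_def h_nonneg)

lemma ef_density_measurable [measurable]: "ef_density T h \<psi> \<eta> \<in> borel_measurable borel"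
  unfolding ef_density_def using T_measurable h_measurable by measurable

lemma prob_space_PY:
  assumes "\<eta> \<in> H" shows "prob_space (P\<^sub>Y \<eta>)"
proof (rule prob_spaceI)
  have "emeasure (P\<^sub>Y \<eta>) (space (P\<^sub>Y \<eta>)) = (\<integral>\<^sup>+y. ennreal (ef_density T h \<psi> \<eta> y) \<partial>\<nu>)"
    by (subst emeasure_density) (auto simp: space_nu intro!: nn_integral_cong)
  then show "emeasure (P\<^sub>Y \<eta>) (space (P\<^sub>Y \<eta>)) = 1" using normalised[OF assms] by simp
qed

lemma T_integrable:
  assumes "\<eta> \<in> H" shows "integrable (P\<^sub>Y \<eta>) T"
proof -
  interpret P: prob_space "P\<^sub>Y \<eta>" by (rule prob_space_PY[OF assms])
  have T: "T \<in> borel_measurable (P\<^sub>Y \<eta>)" using T_measurable by measurable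
  have "integrable (P\<^sub>Y \<eta>) (\<lambda>y. norm (T y))"
    by (rule P.square_integrable_imp_integrable[OF _ T_square_integrable[OF assms]]) (use T in measurable)
  then show ?thesis using integrable_norm_iff[OF T] by simp
qed

text \<open>The gradient and the Hessian of \<open>\<psi>\<close> are the mean and the covariance of \<open>T\<close>, stated for the linear
  functionals \<open>T \<bullet> w\<close>.\<close>

lemma T_moments:
  assumes "\<eta> \<in> H"
  shows "integrable (P\<^sub>Y \<eta>) (\<lambda>y. (T y - grad \<psi> \<eta>) \<bullet> w)"
    and "(\<integral>y. (T y - grad \<psi> \<eta>) \<bullet> w \<partial>P\<^sub>Y \<eta>) = 0"
    and "integrable (P\<^sub>Y \<eta>) (\<lambda>y. ((T y - grad \<psi> \<eta>) \<bullet> w)\<^sup>2)"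
    and "(\<integral>y. ((T y - grad \<psi> \<eta>) \<bullet> w)\<^sup>2 \<partial>P\<^sub>Y \<eta>) = w \<bullet> (hessian \<psi> \<eta> *v w)"
proof -
  interpret P: prob_space "P\<^sub>Y \<eta>" by (rule prob_space_PY[OF assms])
  let ?U = "\<lambda>y. T y - grad \<psi> \<eta>"
  have T[measurable]: "T \<in> borel_measurable (P\<^sub>Y \<eta>)" using T_measurable by measurable
  have U: "integrable (P\<^sub>Y \<eta>) ?U" using T_integrable[OF assms] by simp
  then show "integrable (P\<^sub>Y \<eta>) (\<lambda>y. ?U y \<bullet> w)" by simp
  have "(\<integral>y. ?U y \<bullet> w \<partial>P\<^sub>Y \<eta>) = (\<integral>y. ?U y \<partial>P\<^sub>Y \<eta>) \<bullet> w" by (rule integral_inner_left[OF U])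
  also have "(\<integral>y. ?U y \<partial>P\<^sub>Y \<eta>) = 0"
    using T_integrable[OF assms] grad_psi[OF assms] by (simp add: P.prob_space[simplified])
  finally show "(\<integral>y. ?U y \<bullet> w \<partial>P\<^sub>Y \<eta>) = 0" by simp
  have U_sq: "integrable (P\<^sub>Y \<eta>) (\<lambda>y. (norm (?U y))\<^sup>2)"
  proof (rule Bochner_Integration.integrable_bound)
    show "integrable (P\<^sub>Y \<eta>) (\<lambda>y. 2 * (norm (T y))\<^sup>2 + 2 * (norm (grad \<psi> \<eta>))\<^sup>2)"
      using T_square_integrable[OF assms] by simp
    have "(norm (?U y))\<^sup>2 \<le> 2 * (norm (T y))\<^sup>2 + 2 * (norm (grad \<psi> \<eta>))\<^sup>2" for y
    proof -
      have "(norm (?U y))\<^sup>2 \<le> (norm (T y) + norm (grad \<psi> \<eta>))\<^sup>2"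
        by (intro power_mono norm_triangle_ineq4) simp
      also have "\<dots> \<le> 2 * (norm (T y))\<^sup>2 + 2 * (norm (grad \<psi> \<eta>))\<^sup>2"
        using sum_squares_bound[of "norm (T y)" "norm (grad \<psi> \<eta>)"] by (simp add: power2_sum)
      finally show ?thesis .
    qed
    then show "AE y in P\<^sub>Y \<eta>. norm ((norm (?U y))\<^sup>2) \<le> norm (2 * (norm (T y))\<^sup>2 + 2 * (norm (grad \<psi> \<eta>))\<^sup>2)"
      by (intro AE_I2) simp
  qed measurable
  have prod: "integrable (P\<^sub>Y \<eta>) (\<lambda>y. ?U y $ i * ?U y $ j)" for i j
  proof (rule Bochner_Integration.integrable_bound[OF U_sq])
    show "AE y in P\<^sub>Y \<eta>. norm (?U y $ i * ?U y $ j) \<le> norm ((norm (?U y))\<^sup>2)"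
    proof (rule AE_I2)
      fix y
      have "\<bar>?U y $ i\<bar> * \<bar>?U y $ j\<bar> \<le> norm (?U y) * norm (?U y)"
        by (intro mult_mono component_le_norm_cart) auto
      then show "norm (?U y $ i * ?U y $ j) \<le> norm ((norm (?U y))\<^sup>2)"
        by (simp only: real_norm_def abs_mult power2_eq_square abs_norm_cancel)
    qed
    have "(\<lambda>y. ?U y $ i) \<in> borel_measurable (P\<^sub>Y \<eta>)" for i
      by (rule measurable_continuous_on_compose[where S = UNIV and g = "\<lambda>v. v $ i"])
        (use T in \<open>auto intro!: continuous_intros\<close>)
    then show "(\<lambda>y. ?U y $ i * ?U y $ j) \<in> borel_measurable (P\<^sub>Y \<eta>)"
      by (intro borel_measurable_times)
  qed
  have expand: "(?U y \<bullet> w)\<^sup>2 = (\<Sum>i\<in>UNIV. \<Sum>j\<in>UNIV. (w $ i * w $ j) * (?U y $ i * ?U y $ j))" for y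
    unfolding power2_eq_square inner_vec_def sum_product
    by (intro sum.cong refl) (simp add: mult_ac)
  show "integrable (P\<^sub>Y \<eta>) (\<lambda>y. (?U y \<bullet> w)\<^sup>2)"
    unfolding expand by (intro Bochner_Integration.integrable_sum integrable_mult_right prod)
  have cov: "hessian \<psi> \<eta> $ i $ j = (\<integral>y. ?U y $ i * ?U y $ j \<partial>P\<^sub>Y \<eta>)" for i j
    unfolding hessian_psi[OF assms] covariance_matrix_def grad_psi[OF assms] by simp
  have "(\<integral>y. (?U y \<bullet> w)\<^sup>2 \<partial>P\<^sub>Y \<eta>) = (\<Sum>i\<in>UNIV. \<Sum>j\<in>UNIV. (w $ i * w $ j) * hessian \<psi> \<eta> $ i $ j)"
    unfolding expand cov
    by (simp only: prod Bochner_Integration.integral_sum Bochner_Integration.integrable_sum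
        integrable_mult_right integral_mult_right_zero)
  also have "\<dots> = w \<bullet> (hessian \<psi> \<eta> *v w)"
    by (simp add: inner_vec_def matrix_vector_mult_def sum_distrib_left mult_ac)
  finally show "(\<integral>y. (?U y \<bullet> w)\<^sup>2 \<partial>P\<^sub>Y \<eta>) = w \<bullet> (hessian \<psi> \<eta> *v w)" .
qed

lemma hessian_symmetric: "\<eta> \<in> H \<Longrightarrow> transpose (hessian \<psi> \<eta>) = hessian \<psi> \<eta>"
  by (simp add: hessian_psi covariance_matrix_def transpose_def mult.commute)

lemma hessian_nonneg: "\<eta> \<in> H \<Longrightarrow> 0 \<le> w \<bullet> (hessian \<psi> \<eta> *v w)"
  by (subst T_moments(4)[symmetric]) simp_all

lemma hessian_form_zero_imp:
  assumes "\<eta> \<in> H" "w \<bullet> (hessian \<psi> \<eta> *v w) = 0" shows "w = 0"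
proof -
  have "hessian \<psi> \<eta> *v w = 0"
    by (rule psd_form_zero_imp[OF hessian_symmetric hessian_nonneg]) (use assms in auto)
  moreover obtain B where "B ** hessian \<psi> \<eta> = mat 1"
    using hessian_psi_nonsingular[OF assms(1)] by (auto simp: invertible_def)
  ultimately show ?thesis
    by (metis matrix_vector_mul_assoc matrix_vector_mul_lid matrix_vector_mult_0_right)
qed

end

section \<open>Score and information in the model\<close>

lemma F_mat_continuous:
  fixes \<kappa> :: "'k1::finite \<Rightarrow> 'k::finite"
  shows "continuous_on UNIV (F_mat \<kappa> :: real^'p::finite \<Rightarrow> _)"
  unfolding F_mat_def
proof (intro continuous_on_vec_lambda)
  fix i :: 'k and c :: "'k + 'k1 \<times> 'p"
  show "continuous_on UNIV (\<lambda>x :: real^'p. case c of Inl i' \<Rightarrow> if i = i' then 1 else 0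
                             | Inr (a, l) \<Rightarrow> if i = \<kappa> a then x $ l else 0)"
    by (cases c; cases "\<exists>a l. c = Inr (a, l) \<and> i = \<kappa> a") (auto intro!: continuous_intros)
qed

context partial_rr_mglm
begin

text \<open>\<open>Q\<close> is the law of one observation.\<close>

abbreviation "Q \<equiv> distr M borel (\<lambda>\<omega>. (X \<omega>, Y \<omega>))"

lemma XY_measurable: "(\<lambda>\<omega>. (X \<omega>, Y \<omega>)) \<in> borel_measurable M"
  using X_measurable Y_measurable by (rule borel_measurable_Pair)

lemma eta_in_H:
  assumes "\<xi> \<in> Xi \<kappa> H2" shows "F_mat \<kappa> x *v \<xi> \<in> H"
proof -
  have "second_part \<kappa> (eta_at \<kappa> \<xi> x) = second_part \<kappa> (eta_bar \<xi>)"
    by (simp add: second_part_def eta_at_def vec_eq_iff)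
  then show ?thesis
    using assms by (simp add: F_mat_mult_param[OF inj_kappa] natural_parameter_space_eq Xi_def)
qed

lemma open_Xi: "open (Xi \<kappa> H2 :: ('k, 'k1, 'p) param set)"
proof -
  have "Xi \<kappa> H2 = (eta_bar :: ('k, 'k1, 'p) param \<Rightarrow> _) -` H"
    by (auto simp: Xi_def natural_parameter_space_eq)
  moreover have "continuous_on UNIV (eta_bar :: ('k, 'k1, 'p) param \<Rightarrow> _)"
    unfolding eta_bar_def by (intro continuous_on_vec_lambda continuous_intros)
  ultimately show ?thesis using open_H by (simp add: open_vimage)
qed

lemma convex_Xi: "convex (Xi \<kappa> H2 :: ('k, 'k1, 'p) param set)"
proof (rule convexI)
  fix x y :: "('k, 'k1, 'p) param" and u v :: real
  assume "x \<in> Xi \<kappa> H2" "y \<in> Xi \<kappa> H2" "0 \<le> u" "0 \<le> v" "u + v = 1"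
  moreover have "eta_bar (u *\<^sub>R x + v *\<^sub>R y) = u *\<^sub>R eta_bar x + v *\<^sub>R eta_bar y"
    by (simp add: eta_bar_def vec_eq_iff)
  moreover have "\<xi> \<in> Xi \<kappa> H2 \<longleftrightarrow> eta_bar \<xi> \<in> H" for \<xi> :: "('k, 'k1, 'p) param"
    by (simp add: Xi_def natural_parameter_space_eq)
  ultimately show "u *\<^sub>R x + v *\<^sub>R y \<in> Xi \<kappa> H2" using convex_H by (simp add: convex_def)
qed

lemma true_in_Xi: "\<xi>\<^sub>0 \<in> Xi \<kappa> H2"
  using true_parameter by (simp add: Xi_res_def)

text \<open>The score of one observation at the true parameter, that is the gradient of \<open>m_crit\<close> there, and the
  information matrix of one observation at \<open>\<xi>\<close>, the negative of the Hessian of \<open>m_crit\<close>, which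
  depends on \<open>x\<close> alone.\<close>

definition score :: "(real^'p) \<times> (real^'q) \<Rightarrow> ('k, 'k1, 'p) param" where
  "score z = (T (snd z) - grad \<psi> (F_mat \<kappa> (fst z) *v \<xi>\<^sub>0)) v* F_mat \<kappa> (fst z)"

definition info :: "('k, 'k1, 'p) param \<Rightarrow> real^'p \<Rightarrow> real ^ ('k + 'k1 \<times> 'p) ^ ('k + 'k1 \<times> 'p)" where
  "info \<xi> x = transpose (F_mat \<kappa> x) ** hessian \<psi> (F_mat \<kappa> x *v \<xi>) ** F_mat \<kappa> x"

lemma score_inner:
  "score z \<bullet> t = (T (snd z) - grad \<psi> (F_mat \<kappa> (fst z) *v \<xi>\<^sub>0)) \<bullet> (F_mat \<kappa> (fst z) *v t)"
  by (simp add: score_def dot_lmul_matrix)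

lemma info_form: "u \<bullet> (info \<xi> x *v v) = (F_mat \<kappa> x *v u) \<bullet> (hessian \<psi> (F_mat \<kappa> x *v \<xi>) *v (F_mat \<kappa> x *v v))"
proof -
  have "info \<xi> x *v v = (hessian \<psi> (F_mat \<kappa> x *v \<xi>) *v (F_mat \<kappa> x *v v)) v* F_mat \<kappa> x"
    by (simp add: info_def flip: matrix_vector_mul_assoc)
  then show ?thesis by (simp add: inner_commute[of u] dot_lmul_matrix) (simp add: inner_commute)
qed

lemma F_mat_measurable: "F_mat \<kappa> \<in> borel_measurable (borel :: (real^'p) measure)"
  using F_mat_continuous by (rule borel_measurable_continuous_onI)

lemma eta0_continuous: "continuous_on UNIV (\<lambda>x :: real^'p. F_mat \<kappa> x *v \<xi>)"
  by (intro continuous_intros F_mat_continuous)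

lemma grad_part_measurable:
  assumes "\<xi> \<in> Xi \<kappa> H2"
  shows "(\<lambda>x :: real^'p. grad \<psi> (F_mat \<kappa> x *v \<xi>)) \<in> borel_measurable borel"
  using eta0_continuous eta_in_H[OF assms]
  by (intro borel_measurable_continuous_onI continuous_on_compose2[OF grad_psi_continuous]) auto

lemma vector_matrix_mult_measurable:
  fixes f :: "'z \<Rightarrow> real^'m" and B :: "'z \<Rightarrow> real^'n^'m"
  assumes "f \<in> borel_measurable N" "B \<in> borel_measurable N"
  shows "(\<lambda>z. f z v* B z) \<in> borel_measurable N"
  by (rule borel_measurable_continuous_Pair[OF assms]) (intro continuous_intros)

lemma fst_snd_measurable:
  "fst \<in> borel_measurable (borel :: ((real^'p) \<times> (real^'q)) measure)"
  "snd \<in> borel_measurable (borel :: ((real^'p) \<times> (real^'q)) measure)"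
  by (auto intro!: borel_measurable_continuous_onI continuous_intros)

lemma score_measurable: "score \<in> borel_measurable borel"
  unfolding score_def
  by (intro vector_matrix_mult_measurable borel_measurable_diff
      measurable_compose[OF fst_snd_measurable(1)] measurable_compose[OF fst_snd_measurable(2)]
      T_measurable F_mat_measurable grad_part_measurable true_in_Xi)

lemma info_continuous: "continuous_on (Xi \<kappa> H2) (\<lambda>\<xi>. info \<xi> x)"
  unfolding info_def
  by (intro continuous_intros continuous_on_compose2[OF hessian_psi_continuous]) (auto intro: eta_in_H)

lemma info_measurable: "\<xi> \<in> Xi \<kappa> H2 \<Longrightarrow> info \<xi> \<in> borel_measurable borel"
  unfolding info_def
  by (intro borel_measurable_continuous_onI continuous_intros F_mat_continuous
      continuous_on_compose2[OF hessian_psi_continuous]) (auto intro: eta_in_H)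

lemma m_crit_continuous: "continuous_on (Xi \<kappa> H2) (\<lambda>\<xi>. m_crit T \<psi> \<kappa> \<xi> z)"
  unfolding m_crit_def case_prod_unfold
  by (intro continuous_intros continuous_on_compose2[OF psi_continuous]) (auto intro: eta_in_H)

lemma m_crit_measurable:
  fixes \<xi> :: "('k, 'k1, 'p) param"
  assumes "\<xi> \<in> Xi \<kappa> H2" shows "m_crit T \<psi> \<kappa> \<xi> \<in> borel_measurable borel"
proof -
  have "(\<lambda>x :: real^'p. \<psi> (F_mat \<kappa> x *v \<xi>)) \<in> borel_measurable borel"
    using eta0_continuous eta_in_H[OF assms]
    by (intro borel_measurable_continuous_onI continuous_on_compose2[OF psi_continuous]) auto
  then show ?thesis
    unfolding m_crit_def case_prod_unfold
    by (intro borel_measurable_diff borel_measurable_inner borel_measurable_const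
        vector_matrix_mult_measurable measurable_compose[OF fst_snd_measurable(1)]
        measurable_compose[OF fst_snd_measurable(2)] T_measurable F_mat_measurable)
qed

lemma m_crit_concave:
  assumes "x \<in> Xi \<kappa> H2" "y \<in> Xi \<kappa> H2" "0 \<le> t" "t \<le> 1"
  shows "(1 - t) * m_crit T \<psi> \<kappa> x z + t * m_crit T \<psi> \<kappa> y z \<le> m_crit T \<psi> \<kappa> ((1 - t) *\<^sub>R x + t *\<^sub>R y) z"
  using psi_convex[OF eta_in_H[OF assms(1)] eta_in_H[OF assms(2)] assms(3,4), of "fst z" "fst z"]
  by (simp add: m_crit_def case_prod_unfold inner_add_right matrix_vector_right_distrib
      matrix_vector_mult_scaleR algebra_simps)

lemma m_crit_Taylor:
  assumes "\<xi> \<in> Xi \<kappa> H2"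
  obtains s where "0 < s" "s < 1"
    "m_crit T \<psi> \<kappa> \<xi> z = m_crit T \<psi> \<kappa> \<xi>\<^sub>0 z + score z \<bullet> (\<xi> - \<xi>\<^sub>0)
       - ((\<xi> - \<xi>\<^sub>0) \<bullet> (info (\<xi>\<^sub>0 + s *\<^sub>R (\<xi> - \<xi>\<^sub>0)) (fst z) *v (\<xi> - \<xi>\<^sub>0))) / 2"
proof -
  let ?F = "F_mat \<kappa> (fst z)"
  have eq: "?F *v \<xi> = ?F *v \<xi>\<^sub>0 + ?F *v (\<xi> - \<xi>\<^sub>0)"
    by (simp add: matrix_vector_mult_diff_distrib)
  have seg: "?F *v \<xi>\<^sub>0 + s *\<^sub>R (?F *v (\<xi> - \<xi>\<^sub>0)) = ?F *v (\<xi>\<^sub>0 + s *\<^sub>R (\<xi> - \<xi>\<^sub>0))" for s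
    by (simp only: matrix_vector_right_distrib matrix_vector_mult_scaleR)
  obtain s where s: "0 < s" "s < 1" and
    "\<psi> (?F *v \<xi>\<^sub>0 + ?F *v (\<xi> - \<xi>\<^sub>0)) = \<psi> (?F *v \<xi>\<^sub>0) + grad \<psi> (?F *v \<xi>\<^sub>0) \<bullet> (?F *v (\<xi> - \<xi>\<^sub>0))
      + ((?F *v (\<xi> - \<xi>\<^sub>0)) \<bullet> (hessian \<psi> (?F *v \<xi>\<^sub>0 + s *\<^sub>R (?F *v (\<xi> - \<xi>\<^sub>0))) *v (?F *v (\<xi> - \<xi>\<^sub>0)))) / 2"
    using psi_Taylor[of "?F *v \<xi>\<^sub>0" "?F *v (\<xi> - \<xi>\<^sub>0)"] eta_in_H[OF assms] eta_in_H[OF true_in_Xi] eq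
    by metis
  then have psi: "\<psi> (?F *v \<xi>) = \<psi> (?F *v \<xi>\<^sub>0) + grad \<psi> (?F *v \<xi>\<^sub>0) \<bullet> (?F *v (\<xi> - \<xi>\<^sub>0))
      + ((\<xi> - \<xi>\<^sub>0) \<bullet> (info (\<xi>\<^sub>0 + s *\<^sub>R (\<xi> - \<xi>\<^sub>0)) (fst z) *v (\<xi> - \<xi>\<^sub>0))) / 2"
    by (simp only: eq[symmetric] seg info_form)
  have "(T (snd z) v* ?F) \<bullet> \<xi> = (T (snd z) v* ?F) \<bullet> \<xi>\<^sub>0 + T (snd z) \<bullet> (?F *v (\<xi> - \<xi>\<^sub>0))"
    by (simp add: dot_lmul_matrix inner_diff_right matrix_vector_mult_diff_distrib)
  then have "m_crit T \<psi> \<kappa> \<xi> z = m_crit T \<psi> \<kappa> \<xi>\<^sub>0 z + score z \<bullet> (\<xi> - \<xi>\<^sub>0)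
       - ((\<xi> - \<xi>\<^sub>0) \<bullet> (info (\<xi>\<^sub>0 + s *\<^sub>R (\<xi> - \<xi>\<^sub>0)) (fst z) *v (\<xi> - \<xi>\<^sub>0))) / 2"
    by (simp add: m_crit_def case_prod_unfold psi score_inner inner_diff_left)
  with s show ?thesis using that by blast
qed

text \<open>Integration with respect to the joint law, one variable at a time: first over \<open>y\<close> with respect to
  the conditional law given \<open>x\<close>, then over \<open>x\<close>.\<close>

lemma expectation_by_conditioning:
  fixes G :: "(real^'p) \<times> (real^'q) \<Rightarrow> real"
  assumes [measurable]: "G \<in> borel_measurable borel" and int: "integrable Q G"
  shows "integral\<^sup>L Q G = (\<integral>\<omega>. (\<integral>y. G (X \<omega>, y) \<partial>P\<^sub>Y (F_mat \<kappa> (X \<omega>) *v \<xi>\<^sub>0)) \<partial>M)"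
proof -
  let ?PX = "distr M borel X"
  let ?f = "\<lambda>z. ef_density T h \<psi> (eta_at \<kappa> \<xi>\<^sub>0 (fst z)) (snd z)"
  interpret PX: prob_space ?PX using X_measurable by (rule prob_space_distr)
  interpret nu: sigma_finite_measure \<nu> by (rule sigma_finite_nu)
  interpret pair_sigma_finite ?PX \<nu> by unfold_locales
  have sets_pair: "sets (?PX \<Otimes>\<^sub>M \<nu>) = sets borel"
  proof -
    have "sets (?PX \<Otimes>\<^sub>M \<nu>) = sets ((borel :: (real^'p) measure) \<Otimes>\<^sub>M (borel :: (real^'q) measure))"
      by (intro sets_pair_measure_cong sets_distr sets_nu)
    also have "\<dots> = sets borel" by (subst borel_prod) (rule refl)
    finally show ?thesis .
  qed
  have dens: "distr M (?PX \<Otimes>\<^sub>M \<nu>) (\<lambda>\<omega>. (X \<omega>, Y \<omega>)) = density (?PX \<Otimes>\<^sub>M \<nu>) (\<lambda>z. ennreal (?f z))"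
    using conditional_density unfolding distributed_def case_prod_unfold by blast
  have "Q = distr M (?PX \<Otimes>\<^sub>M \<nu>) (\<lambda>\<omega>. (X \<omega>, Y \<omega>))"
    by (rule distr_cong[OF refl sets_pair[symmetric] refl])
  with dens have Q: "Q = density (?PX \<Otimes>\<^sub>M \<nu>) (\<lambda>z. ennreal (?f z))" by simp
  have "eta_at \<kappa> \<xi>\<^sub>0 x = F_mat \<kappa> x *v \<xi>\<^sub>0" for x by (simp add: F_mat_mult_param[OF inj_kappa])
  then have eta: "eta_at \<kappa> \<xi>\<^sub>0 = (\<lambda>x. F_mat \<kappa> x *v \<xi>\<^sub>0)" by (rule ext)
  have "?f \<in> borel_measurable borel"
  proof -
    have "(\<lambda>z :: (real^'p) \<times> (real^'q). eta_at \<kappa> \<xi>\<^sub>0 (fst z)) \<in> borel_measurable borel"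
      unfolding eta
      by (intro measurable_compose[OF fst_snd_measurable(1)] borel_measurable_continuous_onI eta0_continuous)
    moreover have "(\<lambda>z :: (real^'p) \<times> (real^'q). \<psi> (eta_at \<kappa> \<xi>\<^sub>0 (fst z))) \<in> borel_measurable borel"
      unfolding eta
      by (rule measurable_compose[OF fst_snd_measurable(1)])
        (rule borel_measurable_continuous_onI, rule continuous_on_compose2[OF psi_continuous eta0_continuous],
          auto intro: eta_in_H[OF true_in_Xi])
    moreover have "(\<lambda>z :: (real^'p) \<times> (real^'q). T (snd z)) \<in> borel_measurable borel"
      by (rule measurable_compose[OF fst_snd_measurable(2) T_measurable])
    moreover have "(\<lambda>z :: (real^'p) \<times> (real^'q). h (snd z)) \<in> borel_measurable borel"
      by (rule measurable_compose[OF fst_snd_measurable(2) h_measurable])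
    ultimately show ?thesis unfolding ef_density_def by measurable
  qed
  then have f_meas: "?f \<in> borel_measurable (?PX \<Otimes>\<^sub>M \<nu>)" by (simp add: measurable_cong_sets[OF sets_pair refl])
  have G_meas: "G \<in> borel_measurable (?PX \<Otimes>\<^sub>M \<nu>)" by (simp add: measurable_cong_sets[OF sets_pair refl])
  have "integrable (?PX \<Otimes>\<^sub>M \<nu>) (\<lambda>z. ?f z *\<^sub>R G z)"
    using int unfolding Q by (subst (asm) integrable_density[OF G_meas f_meas]) (auto simp: ef_density_nonneg)
  then have int_pair: "integrable (?PX \<Otimes>\<^sub>M \<nu>) (\<lambda>z. ?f z * G z)" by simp
  have inner: "(\<integral>y. ?f (x, y) * G (x, y) \<partial>\<nu>) = (\<integral>y. G (x, y) \<partial>P\<^sub>Y (F_mat \<kappa> x *v \<xi>\<^sub>0))" for x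
  proof -
    have "(\<lambda>y. G (x, y)) \<in> borel_measurable \<nu>" "ef_density T h \<psi> (F_mat \<kappa> x *v \<xi>\<^sub>0) \<in> borel_measurable \<nu>"
      unfolding measurable_cong_sets[OF sets_nu refl] by measurable
    then show ?thesis by (subst integral_density) (auto simp: ef_density_nonneg eta)
  qed
  have "integral\<^sup>L Q G = (\<integral>z. ?f z * G z \<partial>(?PX \<Otimes>\<^sub>M \<nu>))"
    unfolding Q by (subst integral_density[OF G_meas f_meas]) (auto simp: ef_density_nonneg)
  also have "\<dots> = (\<integral>x. (\<integral>y. ?f (x, y) * G (x, y) \<partial>\<nu>) \<partial>?PX)"
    using integral_fst'[OF int_pair] by simp
  also have "\<dots> = (\<integral>x. (\<integral>y. G (x, y) \<partial>P\<^sub>Y (F_mat \<kappa> x *v \<xi>\<^sub>0)) \<partial>?PX)" by (simp only: inner)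
  also have "\<dots> = (\<integral>\<omega>. (\<integral>y. G (X \<omega>, y) \<partial>P\<^sub>Y (F_mat \<kappa> (X \<omega>) *v \<xi>\<^sub>0)) \<partial>M)"
  proof (rule integral_distr[OF X_measurable])
    have "(\<lambda>x. \<integral>y. ?f (x, y) * G (x, y) \<partial>\<nu>) \<in> borel_measurable ?PX"
      by (rule nu.borel_measurable_lebesgue_integral)
        (use f_meas G_meas in \<open>simp add: case_prod_unfold\<close>)
    then have "(\<lambda>x. \<integral>y. G (x, y) \<partial>P\<^sub>Y (F_mat \<kappa> x *v \<xi>\<^sub>0)) \<in> borel_measurable ?PX"
      by (simp only: inner)
    then show "(\<lambda>x. \<integral>y. G (x, y) \<partial>P\<^sub>Y (F_mat \<kappa> x *v \<xi>\<^sub>0)) \<in> borel_measurable borel"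
      by simp
  qed
  finally show ?thesis .
qed

end

section \<open>Modulus of continuity in mean\<close>

text \<open>If the supremum of a continuous random function over a ball is integrable, its oscillation around
  the centre is small in mean on small balls.  Suprema run over a countable dense set, which makes
  them measurable.\<close>

lemma small_oscillation_in_mean:
  fixes f :: "'x::euclidean_space \<Rightarrow> 'z \<Rightarrow> real"
  assumes meas: "\<And>\<xi>. \<xi> \<in> cball \<xi>\<^sub>0 r \<Longrightarrow> f \<xi> \<in> borel_measurable N"
    and cont: "\<And>z. continuous_on (cball \<xi>\<^sub>0 r) (\<lambda>\<xi>. f \<xi> z)"
    and nonneg: "\<And>\<xi> z. 0 \<le> f \<xi> z" and centre: "\<And>z. f \<xi>\<^sub>0 z = 0"
    and bound: "(\<integral>\<^sup>+z. (SUP \<xi>\<in>cball \<xi>\<^sub>0 r. ennreal (f \<xi> z)) \<partial>N) < \<infinity>"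
    and "r > 0" "\<delta> > 0"
  obtains e \<rho> where "0 < e" "e \<le> r" "integrable N \<rho>" "integral\<^sup>L N \<rho> < \<delta>"
    "\<And>\<xi> z. \<xi> \<in> ball \<xi>\<^sub>0 e \<Longrightarrow> f \<xi> z \<le> \<rho> z"
proof -
  obtain D :: "'x set" where D: "countable D" "\<And>U. open U \<Longrightarrow> U \<noteq> {} \<Longrightarrow> \<exists>d\<in>D. d \<in> U"
    using countable_dense_setE by blast
  define e where "e m = r / real (Suc m)" for m
  have e: "0 < e m" "e m \<le> r" for m using \<open>r > 0\<close> by (auto simp: e_def field_simps)
  define I where "I m = D \<inter> ball \<xi>\<^sub>0 (e m)" for m
  have I: "countable (I m)" "I m \<noteq> {}" "I m \<subseteq> cball \<xi>\<^sub>0 r" for m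
    using D(1) D(2)[of "ball \<xi>\<^sub>0 (e m)"] e[of m] by (auto simp: I_def)
  define \<rho> where "\<rho> m z = (SUP \<xi>\<in>I m. f \<xi> z)" for m z
  have bdd: "bdd_above ((\<lambda>\<xi>. f \<xi> z) ` I m)" for m z
  proof -
    have "compact ((\<lambda>\<xi>. f \<xi> z) ` cball \<xi>\<^sub>0 r)" by (rule compact_continuous_image[OF cont compact_cball])
    then have "bdd_above ((\<lambda>\<xi>. f \<xi> z) ` cball \<xi>\<^sub>0 r)"
      by (intro bounded_imp_bdd_above compact_imp_bounded)
    then show ?thesis by (rule bdd_above_mono) (use I(3)[of m] in blast)
  qed
  have \<rho>_meas [measurable]: "\<rho> m \<in> borel_measurable N" for m
    unfolding \<rho>_def
  proof (intro borel_measurable_cSUP I(1) bdd)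
    fix \<xi> assume "\<xi> \<in> I m"
    then show "f \<xi> \<in> borel_measurable N" using I(3)[of m] by (intro meas) blast
  qed
  have upper: "f \<xi> z \<le> \<rho> m z" if "\<xi> \<in> ball \<xi>\<^sub>0 (e m)" for \<xi> z m
  proof (rule ccontr)
    assume "\<not> f \<xi> z \<le> \<rho> m z"
    then have "\<rho> m z < f \<xi> z" by simp
    moreover have "continuous_on (ball \<xi>\<^sub>0 (e m)) (\<lambda>\<xi>. f \<xi> z)"
      by (rule continuous_on_subset[OF cont]) (use e(2)[of m] in auto)
    then have "open (ball \<xi>\<^sub>0 (e m) \<inter> (\<lambda>\<xi>. f \<xi> z) -` {\<rho> m z <..})"
      by (intro continuous_open_preimage) auto
    moreover from \<open>\<rho> m z < f \<xi> z\<close> that have "\<xi> \<in> ball \<xi>\<^sub>0 (e m) \<inter> (\<lambda>\<xi>. f \<xi> z) -` {\<rho> m z <..}" by simp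
    ultimately obtain d where "d \<in> D" "d \<in> ball \<xi>\<^sub>0 (e m)" "\<rho> m z < f d z"
      using D(2)[of "ball \<xi>\<^sub>0 (e m) \<inter> (\<lambda>\<xi>. f \<xi> z) -` {\<rho> m z <..}"] by blast
    moreover from this have "f d z \<le> \<rho> m z"
      unfolding \<rho>_def by (intro cSUP_upper bdd) (auto simp: I_def)
    ultimately show False by simp
  qed
  have \<rho>_nonneg: "0 \<le> \<rho> m z" for m z using upper[of \<xi>\<^sub>0 m z] centre e(1)[of m] by simp
  have "I m \<subseteq> I 0" for m using e[of m] by (auto simp: I_def e_def)
  then have \<rho>_mono: "\<rho> m z \<le> \<rho> 0 z" for m z
    unfolding \<rho>_def by (intro cSUP_subset_mono I bdd) auto
  have int0: "integrable N (\<rho> 0)"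
  proof (rule integrableI_nonneg)
    have "ennreal (\<rho> 0 z) \<le> (SUP \<xi>\<in>cball \<xi>\<^sub>0 r. ennreal (f \<xi> z))" for z
    proof -
      have "\<rho> 0 z \<le> enn2real (SUP \<xi>\<in>cball \<xi>\<^sub>0 r. ennreal (f \<xi> z))"
        if "(SUP \<xi>\<in>cball \<xi>\<^sub>0 r. ennreal (f \<xi> z)) < top"
        unfolding \<rho>_def
      proof (rule cSUP_least[OF I(2)])
        fix \<xi> assume "\<xi> \<in> I 0"
        then have "ennreal (f \<xi> z) \<le> (SUP \<xi>\<in>cball \<xi>\<^sub>0 r. ennreal (f \<xi> z))"
          using I(3)[of 0] by (intro SUP_upper) blast
        then show "f \<xi> z \<le> enn2real (SUP \<xi>\<in>cball \<xi>\<^sub>0 r. ennreal (f \<xi> z))"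
          using that nonneg[of \<xi> z] enn2real_mono by fastforce
      qed
      then have "ennreal (\<rho> 0 z) \<le> (SUP \<xi>\<in>cball \<xi>\<^sub>0 r. ennreal (f \<xi> z))"
        if "(SUP \<xi>\<in>cball \<xi>\<^sub>0 r. ennreal (f \<xi> z)) < top"
        using that ennreal_leI by fastforce
      then show ?thesis
        by (cases "(SUP \<xi>\<in>cball \<xi>\<^sub>0 r. ennreal (f \<xi> z)) = top") (simp_all only: top_greatest less_top)
    qed
    then have "(\<integral>\<^sup>+z. ennreal (\<rho> 0 z) \<partial>N) \<le> (\<integral>\<^sup>+z. (SUP \<xi>\<in>cball \<xi>\<^sub>0 r. ennreal (f \<xi> z)) \<partial>N)"
      by (intro nn_integral_mono)
    then show "(\<integral>\<^sup>+z. ennreal (\<rho> 0 z) \<partial>N) < \<infinity>" using bound by (rule le_less_trans)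
  qed (use \<rho>_nonneg in auto)
  have int: "integrable N (\<rho> m)" for m
    by (rule Bochner_Integration.integrable_bound[OF int0]) (use \<rho>_mono \<rho>_nonneg in auto)
  have pointwise: "(\<lambda>m. \<rho> m z) \<longlonglongrightarrow> 0" for z
  proof (rule LIMSEQ_I)
    fix a :: real assume "a > 0"
    have "\<xi>\<^sub>0 \<in> cball \<xi>\<^sub>0 r" using \<open>r > 0\<close> by simp
    then obtain b where b: "b > 0" "\<And>\<xi>. \<xi> \<in> cball \<xi>\<^sub>0 r \<Longrightarrow> dist \<xi> \<xi>\<^sub>0 < b \<Longrightarrow> dist (f \<xi> z) (f \<xi>\<^sub>0 z) < a / 2"
      using cont[of z] \<open>a > 0\<close> unfolding continuous_on_iff by (metis half_gt_zero)
    have "e \<longlonglongrightarrow> 0" unfolding e_def by (rule LIMSEQ_Suc[OF lim_const_over_n])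
    then obtain m0 where m0: "\<And>m. m \<ge> m0 \<Longrightarrow> e m < b"
      using order_tendstoD(2)[of e 0 sequentially b] b(1) by (auto simp: eventually_sequentially)
    have "\<rho> m z \<le> a / 2" if "m \<ge> m0" for m
      unfolding \<rho>_def
    proof (rule cSUP_least[OF I(2)])
      fix \<xi> assume \<xi>: "\<xi> \<in> I m"
      then have "dist \<xi> \<xi>\<^sub>0 < b" using m0[OF that] by (auto simp: I_def dist_commute)
      then have "dist (f \<xi> z) (f \<xi>\<^sub>0 z) < a / 2" using \<xi> I(3)[of m] by (intro b(2)) blast+
      then show "f \<xi> z \<le> a / 2" by (simp add: centre dist_real_def)
    qed
    then show "\<exists>m0. \<forall>m\<ge>m0. norm (\<rho> m z - 0) < a"
      using \<rho>_nonneg \<open>a > 0\<close> by (intro exI[of _ m0]) (force simp: abs_of_nonneg)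
  qed
  have "(\<lambda>m. integral\<^sup>L N (\<rho> m)) \<longlonglongrightarrow> integral\<^sup>L N (\<lambda>z. 0)"
    by (rule integral_dominated_convergence[OF _ \<rho>_meas int0])
      (use pointwise \<rho>_mono \<rho>_nonneg in auto)
  then obtain m where "integral\<^sup>L N (\<rho> m) < \<delta>"
    using order_tendstoD(2)[of _ 0 sequentially \<delta>] \<open>\<delta> > 0\<close> by (auto simp: eventually_sequentially)
  then show ?thesis using that[OF e(1)[of m] e(2)[of m] int] upper by blast
qed

lemma nn_integral_distr_le:
  assumes "f \<in> measurable M N"
  shows "(\<integral>\<^sup>+x. g x \<partial>distr M N f) \<le> (\<integral>\<^sup>+\<omega>. g (f \<omega>) \<partial>M)"
  unfolding nn_integral_def[of "distr M N f"]
proof (rule SUP_least)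
  fix s assume s: "s \<in> {s. simple_function (distr M N f) s \<and> s \<le> g}"
  then have "integral\<^sup>S (distr M N f) s = (\<integral>\<^sup>+x. s x \<partial>distr M N f)"
    by (simp add: nn_integral_eq_simple_integral)
  also have "\<dots> = (\<integral>\<^sup>+\<omega>. s (f \<omega>) \<partial>M)"
    using s by (intro nn_integral_distr assms) (auto dest: borel_measurable_simple_function)
  also have "\<dots> \<le> (\<integral>\<^sup>+\<omega>. g (f \<omega>) \<partial>M)"
    using s by (intro nn_integral_mono) (auto simp: le_fun_def)
  finally show "integral\<^sup>S (distr M N f) s \<le> (\<integral>\<^sup>+\<omega>. g (f \<omega>) \<partial>M)" .
qed

section \<open>The criterion of the reduced-rank model\<close>

locale partial_rr_mglm_sample = partial_rr_mglm M \<nu> T h \<psi> \<kappa> H2 \<rho> d \<xi>\<^sub>0 X Y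
  for M :: "'w measure"
    and \<nu> :: "(real^'q) measure"
    and T :: "real^'q \<Rightarrow> real^'k"
    and h :: "real^'q \<Rightarrow> real"
    and \<psi> :: "real^'k \<Rightarrow> real"
    and \<kappa> :: "'k1::finite \<Rightarrow> 'k"
    and H2 :: "(real^'k) set"
    and \<rho> :: "'r::finite \<Rightarrow> 'p::finite"
    and d :: nat
    and \<xi>\<^sub>0 :: "('k, 'k1, 'p) param"
    and X :: "'w \<Rightarrow> real^'p"
    and Y :: "'w \<Rightarrow> real^'q" +
  fixes Z :: "nat \<Rightarrow> 'w \<Rightarrow> (real^'p) \<times> (real^'q)"
  assumes R1: "R1 M \<kappa> H2 X"
    and R3: "\<And>K. compact K \<Longrightarrow> K \<subseteq> Xi \<kappa> H2 \<Longrightarrow> R3 M T \<psi> \<kappa> X Y K"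
    and R4: "\<And>K. compact K \<Longrightarrow> K \<subseteq> Xi \<kappa> H2 \<Longrightarrow> R4 M \<psi> \<kappa> X K"
    and Z_independent: "indep_vars (\<lambda>_. borel) Z UNIV"
    and Z_copies: "\<And>i. distr M borel (Z i) = distr M borel (\<lambda>\<omega>. (X \<omega>, Y \<omega>))"

sublocale partial_rr_mglm_sample \<subseteq> iid_copies M Z "distr M borel (\<lambda>\<omega>. (X \<omega>, Y \<omega>))"
  by unfold_locales (rule Z_independent Z_copies)+

context partial_rr_mglm_sample
begin

text \<open>\<open>A\<close> is the information matrix at the true parameter.\<close>

abbreviation "A \<equiv> W_inv M \<psi> \<kappa> X \<xi>\<^sub>0"

lemma info_X_measurable: "\<xi> \<in> Xi \<kappa> H2 \<Longrightarrow> (\<lambda>\<omega>. info \<xi> (X \<omega>)) \<in> borel_measurable M"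
  by (rule measurable_compose[OF X_measurable info_measurable])

lemma info_integrable: "integrable M (\<lambda>\<omega>. info \<xi>\<^sub>0 (X \<omega>))"
proof (rule integrableI_bounded[OF info_X_measurable[OF true_in_Xi]])
  show "(\<integral>\<^sup>+\<omega>. ennreal (norm (info \<xi>\<^sub>0 (X \<omega>))) \<partial>M) < \<infinity>"
    using R4[of "{\<xi>\<^sub>0}"] true_in_Xi by (simp add: R4_def info_def)
qed

lemma A_eq: "A = (\<integral>\<omega>. info \<xi>\<^sub>0 (X \<omega>) \<partial>M)"
  by (simp add: W_inv_def info_def)

lemma A_form: "u \<bullet> (A *v v) = (\<integral>\<omega>. u \<bullet> (info \<xi>\<^sub>0 (X \<omega>) *v v) \<partial>M)"
  unfolding A_eq by (rule integral_bounded_linear[OF bounded_linear_matrix_form info_integrable, symmetric])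

lemma info_form_integrable: "integrable M (\<lambda>\<omega>. u \<bullet> (info \<xi>\<^sub>0 (X \<omega>) *v v))"
  by (rule integrable_bounded_linear[OF bounded_linear_matrix_form info_integrable])

lemma A_sym: "transpose A = A"
proof (rule matrix_eq_by_forms)
  fix u v :: "('k, 'k1, 'p) param"
  have hess: "a \<bullet> (hessian \<psi> (F_mat \<kappa> x *v \<xi>\<^sub>0) *v b) = b \<bullet> (hessian \<psi> (F_mat \<kappa> x *v \<xi>\<^sub>0) *v a)" for a b x
    by (metis dot_lmul_matrix inner_commute hessian_symmetric[OF eta_in_H[OF true_in_Xi]] vector_transpose_matrix)
  have "u \<bullet> (transpose A *v v) = v \<bullet> (A *v u)" by (simp add: dot_lmul_matrix inner_commute[of u])
  also have "\<dots> = u \<bullet> (A *v v)" unfolding A_form info_form by (subst hess) (rule refl)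
  finally show "u \<bullet> (transpose A *v v) = u \<bullet> (A *v v)" .
qed

lemma A_nonneg: "0 \<le> u \<bullet> (A *v u)"
  unfolding A_form info_form
  by (intro Bochner_Integration.integral_nonneg hessian_nonneg eta_in_H true_in_Xi)

text \<open>Positive definiteness is where identifiability (\<open>R1\<close>) enters: a direction of zero
  information is one along which the natural parameter does not move.\<close>

lemma A_pos_def:
  assumes "v \<noteq> 0" shows "0 < v \<bullet> (A *v v)"
proof (rule ccontr)
  assume "\<not> ?thesis"
  then have zero: "v \<bullet> (A *v v) = 0" using A_nonneg[of v] by simp
  have "AE \<omega> in M. v \<bullet> (info \<xi>\<^sub>0 (X \<omega>) *v v) = 0"
  proof (subst integral_nonneg_eq_0_iff_AE[symmetric])
    show "AE \<omega> in M. 0 \<le> v \<bullet> (info \<xi>\<^sub>0 (X \<omega>) *v v)"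
      unfolding info_form by (intro AE_I2 hessian_nonneg eta_in_H true_in_Xi)
    show "(\<integral>\<omega>. v \<bullet> (info \<xi>\<^sub>0 (X \<omega>) *v v) \<partial>M) = 0" using zero by (simp add: A_form)
  qed (rule info_form_integrable)
  then have ae: "AE \<omega> in M. F_mat \<kappa> (X \<omega>) *v v = 0"
    by eventually_elim (auto simp: info_form intro: hessian_form_zero_imp[OF eta_in_H[OF true_in_Xi]])
  have eta_v: "F_mat \<kappa> x *v \<zeta> = eta_at \<kappa> \<zeta> x" for x and \<zeta> :: "('k, 'k1, 'p) param"
    by (rule F_mat_mult_param[OF inj_kappa])
  show False
  proof (cases "beta v = 0")
    case True
    have "F_mat \<kappa> x *v v = eta_bar v" for x by (simp add: eta_v eta_at_def True vec_eq_iff)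
    then have "AE \<omega> in M. eta_bar v = 0" using ae by simp
    then have "eta_bar v = 0" by simp
    have "v $ c = 0" for c
    proof (cases c)
      case (Inl i)
      then show ?thesis using \<open>eta_bar v = 0\<close> by (simp add: eta_bar_def vec_eq_iff)
    next
      case (Inr al)
      then show ?thesis using True by (cases al) (simp add: beta_def vec_eq_iff)
    qed
    then have "v = 0" by (simp add: vec_eq_iff)
    with assms show False by simp
  next
    case False
    \<comment> \<open>Replacing the intercept of \<open>v\<close> by an admissible one gives a parameter to which the condition applies.\<close>
    define \<zeta> :: "('k, 'k1, 'p) param" where "\<zeta> = (\<chi> c. case c of Inl i \<Rightarrow> eta_bar \<xi>\<^sub>0 $ i | Inr al \<Rightarrow> v $ Inr al)"
    have \<zeta>: "eta_bar \<zeta> = eta_bar \<xi>\<^sub>0" "beta \<zeta> = beta v"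
      by (simp_all add: \<zeta>_def eta_bar_def beta_def vec_eq_iff)
    have "\<zeta> \<in> Xi \<kappa> H2" using true_in_Xi by (simp add: Xi_def \<zeta>)
    then have "measure M {\<omega> \<in> space M. F_mat \<kappa> (X \<omega>) *v \<zeta> = eta_bar \<xi>\<^sub>0 - eta_bar v} < 1"
      using R1 False by (auto simp: R1_def \<zeta>)
    moreover have "AE \<omega> in M. F_mat \<kappa> (X \<omega>) *v \<zeta> = eta_bar \<xi>\<^sub>0 - eta_bar v"
      using ae
    proof eventually_elim
      case (elim \<omega>)
      have "F_mat \<kappa> (X \<omega>) *v \<zeta> = F_mat \<kappa> (X \<omega>) *v v + (eta_bar \<xi>\<^sub>0 - eta_bar v)"
        by (simp add: eta_v eta_at_def \<zeta> vec_eq_iff)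
      with elim show ?case by simp
    qed
    moreover have "(\<lambda>\<omega>. F_mat \<kappa> (X \<omega>) *v \<zeta>) \<in> borel_measurable M"
      by (rule measurable_compose[OF X_measurable borel_measurable_continuous_onI[OF eta0_continuous]])
    then have "{\<omega> \<in> space M. F_mat \<kappa> (X \<omega>) *v \<zeta> = eta_bar \<xi>\<^sub>0 - eta_bar v} \<in> events" by measurable
    ultimately show False using prob_Collect_eq_1 by fastforce
  qed
qed

lemma A_invertible: "invertible A"
proof -
  have "v = 0" if "A *v v = 0" for v using A_pos_def[of v] that by fastforce
  then have "\<exists>B. B ** A = mat 1" by (simp add: matrix_left_invertible_ker)
  then show ?thesis by (metis invertible_def matrix_left_right_inverse)
qed

subsection \<open>The score\<close>

lemma score_square_integrable: "integrable Q (\<lambda>z. (norm (score z))\<^sup>2)"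
proof -
  let ?a = "\<lambda>\<omega>. T (Y \<omega>) v* F_mat \<kappa> (X \<omega>)"
  let ?b = "\<lambda>\<omega>. grad \<psi> (F_mat \<kappa> (X \<omega>) *v \<xi>\<^sub>0) v* F_mat \<kappa> (X \<omega>)"
  have a_meas [measurable]: "?a \<in> borel_measurable M"
    by (intro vector_matrix_mult_measurable measurable_compose[OF Y_measurable T_measurable]
        measurable_compose[OF X_measurable F_mat_measurable])
  have b_meas [measurable]: "?b \<in> borel_measurable M"
    by (intro vector_matrix_mult_measurable measurable_compose[OF X_measurable F_mat_measurable]
        measurable_compose[OF X_measurable grad_part_measurable] true_in_Xi)
  have "R3 M T \<psi> \<kappa> X Y {\<xi>\<^sub>0}" using true_in_Xi by (intro R3) auto
  then have "(\<integral>\<^sup>+\<omega>. ennreal ((norm (?a \<omega>))\<^sup>2) \<partial>M) < \<infinity>" "(\<integral>\<^sup>+\<omega>. ennreal ((norm (?b \<omega>))\<^sup>2) \<partial>M) < \<infinity>"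
    by (simp_all add: R3_def)
  then have int: "integrable M (\<lambda>\<omega>. (norm (?a \<omega>))\<^sup>2)" "integrable M (\<lambda>\<omega>. (norm (?b \<omega>))\<^sup>2)"
    by (auto intro!: integrableI_nonneg)
  have "integrable M (\<lambda>\<omega>. (norm (score (X \<omega>, Y \<omega>)))\<^sup>2)"
  proof (rule Bochner_Integration.integrable_bound)
    show "integrable M (\<lambda>\<omega>. 2 * (norm (?a \<omega>))\<^sup>2 + 2 * (norm (?b \<omega>))\<^sup>2)" using int by simp
    show "(\<lambda>\<omega>. (norm (score (X \<omega>, Y \<omega>)))\<^sup>2) \<in> borel_measurable M"
      using measurable_compose[OF XY_measurable score_measurable] by measurable
    have "(norm (score (X \<omega>, Y \<omega>)))\<^sup>2 \<le> 2 * (norm (?a \<omega>))\<^sup>2 + 2 * (norm (?b \<omega>))\<^sup>2" for \<omega>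
    proof -
      have "score (X \<omega>, Y \<omega>) = ?a \<omega> - ?b \<omega>" by (simp add: score_def vector_matrix_mult_diff_distrib)
      then have "(norm (score (X \<omega>, Y \<omega>)))\<^sup>2 \<le> (norm (?a \<omega>) + norm (?b \<omega>))\<^sup>2"
        by (simp add: power_mono norm_triangle_ineq4)
      also have "\<dots> \<le> 2 * (norm (?a \<omega>))\<^sup>2 + 2 * (norm (?b \<omega>))\<^sup>2"
        using sum_squares_bound[of "norm (?a \<omega>)" "norm (?b \<omega>)"] by (simp add: power2_sum)
      finally show ?thesis .
    qed
    then show "AE \<omega> in M. norm ((norm (score (X \<omega>, Y \<omega>)))\<^sup>2) \<le> norm (2 * (norm (?a \<omega>))\<^sup>2 + 2 * (norm (?b \<omega>))\<^sup>2)"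
      by (intro AE_I2) simp
  qed
  moreover have "(\<lambda>z. (norm (score z))\<^sup>2) \<in> borel_measurable borel"
    using score_measurable by measurable
  ultimately show ?thesis by (simp add: integrable_distr_eq[OF XY_measurable])
qed

lemma score_component_measurable: "(\<lambda>z. score z \<bullet> t) \<in> borel_measurable borel"
  using score_measurable by measurable

lemma score_component_square_integrable: "integrable Q (\<lambda>z. (score z \<bullet> t)\<^sup>2)"
proof (rule Bochner_Integration.integrable_bound)
  show "integrable Q (\<lambda>z. (norm t)\<^sup>2 * (norm (score z))\<^sup>2)" using score_square_integrable by simp
  show "(\<lambda>z. (score z \<bullet> t)\<^sup>2) \<in> borel_measurable Q"
    using score_component_measurable by (simp add: measurable_cong_sets[OF sets_distr refl])
  have "(score z \<bullet> t)\<^sup>2 \<le> (norm t)\<^sup>2 * (norm (score z))\<^sup>2" for z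
    using Cauchy_Schwarz_ineq[of "score z" t] by (simp add: power2_norm_eq_inner mult.commute)
  then show "AE z in Q. norm ((score z \<bullet> t)\<^sup>2) \<le> norm ((norm t)\<^sup>2 * (norm (score z))\<^sup>2)"
    by (intro AE_I2) simp
qed

lemma score_mean: "(\<integral>z. score z \<bullet> t \<partial>Q) = 0"
proof -
  interpret Q: prob_space Q by (rule prob_space_Q)
  have "(\<lambda>z. score z \<bullet> t) \<in> borel_measurable Q"
    using score_component_measurable by (simp add: measurable_cong_sets[OF sets_distr refl])
  then have "integrable Q (\<lambda>z. score z \<bullet> t)"
    by (rule Q.square_integrable_imp_integrable[OF _ score_component_square_integrable])
  then have "(\<integral>z. score z \<bullet> t \<partial>Q) = (\<integral>\<omega>. (\<integral>y. score (X \<omega>, y) \<bullet> t \<partial>P\<^sub>Y (F_mat \<kappa> (X \<omega>) *v \<xi>\<^sub>0)) \<partial>M)"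
    by (rule expectation_by_conditioning[OF score_component_measurable])
  also have "\<dots> = 0"
    by (simp add: score_inner T_moments(2)[OF eta_in_H[OF true_in_Xi]])
  finally show ?thesis .
qed

lemma score_variance: "(\<integral>z. (score z \<bullet> t)\<^sup>2 \<partial>Q) = t \<bullet> (A *v t)"
proof -
  have "(\<lambda>z. (score z \<bullet> t)\<^sup>2) \<in> borel_measurable borel"
    by (intro borel_measurable_power score_component_measurable)
  then have "(\<integral>z. (score z \<bullet> t)\<^sup>2 \<partial>Q) = (\<integral>\<omega>. (\<integral>y. (score (X \<omega>, y) \<bullet> t)\<^sup>2 \<partial>P\<^sub>Y (F_mat \<kappa> (X \<omega>) *v \<xi>\<^sub>0)) \<partial>M)"
    by (rule expectation_by_conditioning[OF _ score_component_square_integrable])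
  also have "\<dots> = t \<bullet> (A *v t)"
    by (simp add: score_inner T_moments(4)[OF eta_in_H[OF true_in_Xi]] A_form info_form)
  finally show ?thesis .
qed

text \<open>The sum of the scores of \<open>n\<close> observations, divided by \<open>\<surd>n\<close>.\<close>

definition scaled_score :: "nat \<Rightarrow> 'w \<Rightarrow> ('k, 'k1, 'p) param" where
  "scaled_score n \<omega> = (\<Sum>i<n. score (Z i \<omega>)) /\<^sub>R sqrt (real n)"

lemma score_Z_measurable: "(\<lambda>\<omega>. score (Z i \<omega>)) \<in> borel_measurable M"
  by (rule measurable_compose[OF Z_measurable score_measurable])

lemma scaled_score_measurable: "scaled_score n \<in> borel_measurable M"
  unfolding scaled_score_def
  by (intro borel_measurable_scaleR borel_measurable_sum score_Z_measurable borel_measurable_const)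

lemma scaled_score_inner: "t \<bullet> scaled_score n \<omega> = (\<Sum>i<n. score (Z i \<omega>) \<bullet> t) / sqrt (real n)"
  by (simp add: scaled_score_def inner_sum_right inner_commute[of t] divide_inverse mult.commute inner_sum_left)

lemma scaled_score_tight:
  assumes "\<epsilon> > 0"
  shows "\<exists>K>0. \<forall>n>0. prob {\<omega> \<in> space M. norm (scaled_score n \<omega>) > K} \<le> \<epsilon>"
proof -
  define c where "c = (\<Sum>b\<in>(Basis :: ('k, 'k1, 'p) param set). b \<bullet> (A *v b))"
  have "c \<ge> 0" unfolding c_def by (intro sum_nonneg A_nonneg)
  \<comment> \<open>\<open>c\<close> is the trace of \<open>A\<close>, the second moment of the scaled score; \<open>K\<close> makes Markov's inequality
    give at most \<open>\<epsilon>\<close>.\<close>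
  define K where "K = sqrt ((c + 1) / \<epsilon>)"
  have "K > 0" using \<open>c \<ge> 0\<close> \<open>\<epsilon> > 0\<close> by (simp add: K_def)
  have K2: "K\<^sup>2 = (c + 1) / \<epsilon>" using \<open>c \<ge> 0\<close> \<open>\<epsilon> > 0\<close> by (simp add: K_def)
  have "prob {\<omega> \<in> space M. norm (scaled_score n \<omega>) > K} \<le> \<epsilon>" if "n > 0" for n
  proof -
    have sq: "(norm (scaled_score n \<omega>))\<^sup>2 = (\<Sum>b\<in>Basis. (\<Sum>i<n. score (Z i \<omega>) \<bullet> b)\<^sup>2 / real n)" for \<omega>
    proof -
      have "(norm (scaled_score n \<omega>))\<^sup>2 = (\<Sum>b\<in>Basis. (b \<bullet> scaled_score n \<omega>)\<^sup>2)"
        unfolding power2_norm_eq_inner by (subst euclidean_inner) (simp add: power2_eq_square inner_commute)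
      then show ?thesis by (simp add: scaled_score_inner power_divide)
    qed
    have int: "integrable M (\<lambda>\<omega>. (\<Sum>i<n. score (Z i \<omega>) \<bullet> b)\<^sup>2 / real n)"
      and val: "(\<integral>\<omega>. (\<Sum>i<n. score (Z i \<omega>) \<bullet> b)\<^sup>2 / real n \<partial>M) = b \<bullet> (A *v b)" for b
      using second_moment_sum[where f = "\<lambda>z. score z \<bullet> b" and n = n,
          OF score_component_measurable score_component_square_integrable score_mean] that
      by (auto simp: score_variance)
    have "{\<omega> \<in> space M. norm (scaled_score n \<omega>) > K} \<subseteq> {\<omega> \<in> space M. (norm (scaled_score n \<omega>))\<^sup>2 \<ge> K\<^sup>2}"
      using \<open>K > 0\<close> by (auto intro!: power_mono)
    moreover have "{\<omega> \<in> space M. (norm (scaled_score n \<omega>))\<^sup>2 \<ge> K\<^sup>2} \<in> events"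
      using scaled_score_measurable[of n] by measurable
    ultimately have "prob {\<omega> \<in> space M. norm (scaled_score n \<omega>) > K} \<le> prob {\<omega> \<in> space M. (norm (scaled_score n \<omega>))\<^sup>2 \<ge> K\<^sup>2}"
      by (intro finite_measure_mono)
    also have "\<dots> \<le> (\<integral>\<omega>. (norm (scaled_score n \<omega>))\<^sup>2 \<partial>M) / K\<^sup>2"
    proof (rule integral_Markov_inequality_measure[where A = "{}"])
      show "integrable M (\<lambda>\<omega>. (norm (scaled_score n \<omega>))\<^sup>2)"
        unfolding sq by (intro Bochner_Integration.integrable_sum int)
    qed (use \<open>K > 0\<close> in auto)
    also have "(\<integral>\<omega>. (norm (scaled_score n \<omega>))\<^sup>2 \<partial>M) = c"
      unfolding sq c_def by (subst Bochner_Integration.integral_sum[OF int]) (simp only: val)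
    also have "c / K\<^sup>2 \<le> \<epsilon>"
      using \<open>c \<ge> 0\<close> \<open>\<epsilon> > 0\<close> unfolding K2 by (simp add: field_simps)
    finally show ?thesis .
  qed
  then show ?thesis using \<open>K > 0\<close> by blast
qed

text \<open>The central limit theorem for the real random variables \<open>score \<bullet> t\<close>, read at the point \<open>\<sigma>\<close> of the
  characteristic function after standardisation.\<close>

lemma scaled_score_characteristic_function:
  "(\<lambda>n. CLINT \<omega>|M. iexp (t \<bullet> scaled_score n \<omega>)) \<longlonglongrightarrow> of_real (exp (- (t \<bullet> (A *v t)) / 2))"
proof (cases "t = 0")
  case True
  then show ?thesis by (simp add: prob_space)
next
  case False
  define \<sigma> where "\<sigma> = sqrt (t \<bullet> (A *v t))"
  have \<sigma>: "\<sigma> > 0" "\<sigma>\<^sup>2 = t \<bullet> (A *v t)" using A_pos_def[OF False] by (auto simp: \<sigma>_def)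
  let ?S = "\<lambda>n \<omega>. \<Sum>i<n. score (Z i \<omega>) \<bullet> t"
  let ?D = "\<lambda>n. distr M borel (\<lambda>\<omega>. ?S n \<omega> / sqrt (real n * \<sigma>\<^sup>2))"
  have mean: "expectation (\<lambda>\<omega>. score (Z i \<omega>) \<bullet> t) = 0" for i
    by (subst integral_Z_eq[OF score_component_measurable]) (rule score_mean)
  have S_meas [measurable]: "(\<lambda>\<omega>. ?S n \<omega> / sqrt (real n * \<sigma>\<^sup>2)) \<in> borel_measurable M" for n
    by (intro borel_measurable_divide borel_measurable_sum borel_measurable_const
        measurable_compose[OF Z_measurable score_component_measurable])
  have "weak_conv_m ?D std_normal_distribution"
  proof (rule central_limit_theorem_zero_mean)
    show "indep_vars (\<lambda>i. borel) (\<lambda>i \<omega>. score (Z i \<omega>) \<bullet> t) UNIV"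
      by (rule indep_compose[OF score_component_measurable])
    show "integrable M (\<lambda>\<omega>. (score (Z n \<omega>) \<bullet> t)\<^sup>2)" for n
      using integrable_Z_iff[of "\<lambda>z. (score z \<bullet> t)\<^sup>2" n] score_component_square_integrable
        score_component_measurable by simp
    show "variance (\<lambda>\<omega>. score (Z n \<omega>) \<bullet> t) = \<sigma>\<^sup>2" for n
      using integral_Z_eq[of "\<lambda>z. (score z \<bullet> t)\<^sup>2" n] score_component_measurable
      by (simp add: mean score_variance \<sigma>(2))
    show "distr M borel (\<lambda>\<omega>. score (Z n \<omega>) \<bullet> t) = distr Q borel (\<lambda>z. score z \<bullet> t)" for n
      by (rule distr_Z_compose[OF score_component_measurable])
  qed (use mean \<sigma>(1) in auto)
  then have "(\<lambda>n. char (?D n) \<sigma>) \<longlonglongrightarrow> char std_normal_distribution \<sigma>"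
    by (intro levy_continuity1 real_distribution_distr real_dist_normal_dist S_meas)
  moreover have "char (?D n) \<sigma> = (CLINT \<omega>|M. iexp (t \<bullet> scaled_score n \<omega>))" for n
  proof -
    have "char (?D n) \<sigma> = (CLINT \<omega>|M. iexp (\<sigma> * (?S n \<omega> / sqrt (real n * \<sigma>\<^sup>2))))"
      unfolding char_def by (rule integral_distr[OF S_meas]) measurable
    moreover have "\<sigma> * (?S n \<omega> / sqrt (real n * \<sigma>\<^sup>2)) = t \<bullet> scaled_score n \<omega>" for \<omega>
      using \<sigma>(1) by (simp add: scaled_score_inner real_sqrt_mult)
    ultimately show ?thesis by (simp only:)
  qed
  ultimately show ?thesis by (simp add: char_std_normal_distribution \<sigma>(2))
qed

end

text \<open>For functions that need not be measurable, such as uncountable suprema, the upper bound of the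
  change of variables formula remains true.\<close>

context partial_rr_mglm_sample
begin

subsection \<open>Uniform quadratic expansion\<close>

text \<open>The oscillation \<open>2 \<rho>'\<close> of the information around \<open>\<xi>\<^sub>0\<close> has small mean on small balls.\<close>

lemma small_information_oscillation:
  assumes "\<delta> > 0"
  obtains e \<rho>' where "e > 0" "cball \<xi>\<^sub>0 e \<subseteq> Xi \<kappa> H2" "\<rho>' \<in> borel_measurable borel"
    "integrable Q (\<lambda>z. \<rho>' (fst z))" "(\<integral>z. \<rho>' (fst z) \<partial>Q) < \<delta>"
    "\<And>\<xi> x. \<xi> \<in> ball \<xi>\<^sub>0 e \<Longrightarrow> norm (info \<xi> x - info \<xi>\<^sub>0 x) \<le> 2 * \<rho>' x"
proof -
  let ?PX = "distr M borel X"
  obtain r where r: "r > 0" "cball \<xi>\<^sub>0 r \<subseteq> Xi \<kappa> H2"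
    using open_Xi true_in_Xi open_contains_cball by blast
  \<comment> \<open>The factor \<open>1 / 2\<close> makes the oscillation at most the supremum of the information itself.\<close>
  define f where "f \<xi> x = norm (info \<xi> x - info \<xi>\<^sub>0 x) / 2" for \<xi> and x :: "real^'p"
  have bound: "(\<integral>\<^sup>+x. (SUP \<xi>\<in>cball \<xi>\<^sub>0 r. ennreal (f \<xi> x)) \<partial>?PX) < \<infinity>"
  proof -
    have "(SUP \<xi>\<in>cball \<xi>\<^sub>0 r. ennreal (f \<xi> x)) \<le> (SUP \<xi>\<in>cball \<xi>\<^sub>0 r. ennreal (norm (info \<xi> x)))" for x
    proof (rule SUP_least)
      fix \<xi> assume \<xi>: "\<xi> \<in> cball \<xi>\<^sub>0 r"
      have "f \<xi> x \<le> max (norm (info \<xi> x)) (norm (info \<xi>\<^sub>0 x))"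
        using norm_triangle_ineq4[of "info \<xi> x" "info \<xi>\<^sub>0 x"] by (simp add: f_def max_def field_simps)
      then have "ennreal (f \<xi> x) \<le> ennreal (norm (info \<xi> x)) \<or> ennreal (f \<xi> x) \<le> ennreal (norm (info \<xi>\<^sub>0 x))"
        by (auto simp: max_def intro: ennreal_leI split: if_splits)
      then show "ennreal (f \<xi> x) \<le> (SUP \<xi>\<in>cball \<xi>\<^sub>0 r. ennreal (norm (info \<xi> x)))"
      proof
        assume "ennreal (f \<xi> x) \<le> ennreal (norm (info \<xi> x))"
        with \<xi> show ?thesis by (rule SUP_upper2)
      next
        assume "ennreal (f \<xi> x) \<le> ennreal (norm (info \<xi>\<^sub>0 x))"
        moreover have "\<xi>\<^sub>0 \<in> cball \<xi>\<^sub>0 r" using r(1) by simp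
        ultimately show ?thesis by (rule SUP_upper2[rotated])
      qed
    qed
    then have "(\<integral>\<^sup>+x. (SUP \<xi>\<in>cball \<xi>\<^sub>0 r. ennreal (f \<xi> x)) \<partial>?PX)
        \<le> (\<integral>\<^sup>+x. (SUP \<xi>\<in>cball \<xi>\<^sub>0 r. ennreal (norm (info \<xi> x))) \<partial>?PX)"
      by (intro nn_integral_mono)
    also have "\<dots> \<le> (\<integral>\<^sup>+\<omega>. (SUP \<xi>\<in>cball \<xi>\<^sub>0 r. ennreal (norm (info \<xi> (X \<omega>)))) \<partial>M)"
      by (rule nn_integral_distr_le[OF X_measurable])
    also have "\<dots> < \<infinity>"
      using R4[OF compact_cball r(2)] by (simp add: R4_def info_def)
    finally show ?thesis .
  qed
  obtain e \<rho>' where e: "0 < e" "e \<le> r" and \<rho>': "integrable ?PX \<rho>'" "integral\<^sup>L ?PX \<rho>' < \<delta>"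
    and dom: "\<And>\<xi> x. \<xi> \<in> ball \<xi>\<^sub>0 e \<Longrightarrow> f \<xi> x \<le> \<rho>' x"
  proof (rule small_oscillation_in_mean[of \<xi>\<^sub>0 r f ?PX \<delta>])
    show "f \<xi> \<in> borel_measurable ?PX" if "\<xi> \<in> cball \<xi>\<^sub>0 r" for \<xi>
    proof -
      have "\<xi> \<in> Xi \<kappa> H2" using that r(2) by blast
      from info_measurable[OF this] info_measurable[OF true_in_Xi] show ?thesis
        unfolding f_def by (simp add: measurable_cong_sets[OF sets_distr refl])
    qed
    show "continuous_on (cball \<xi>\<^sub>0 r) (\<lambda>\<xi>. f \<xi> x)" for x
      unfolding f_def by (intro continuous_intros continuous_on_subset[OF info_continuous r(2)]) simp
  qed (use bound r(1) \<open>\<delta> > 0\<close> in \<open>auto simp: f_def\<close>)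
  have \<rho>'_meas: "\<rho>' \<in> borel_measurable borel"
    using borel_measurable_integrable[OF \<rho>'(1)] by simp
  have meas: "(\<lambda>z :: (real^'p) \<times> (real^'q). \<rho>' (fst z)) \<in> borel_measurable borel"
    by (rule measurable_compose[OF fst_snd_measurable(1) \<rho>'_meas])
  show ?thesis
  proof (rule that[OF e(1) _ \<rho>'_meas])
    show "cball \<xi>\<^sub>0 e \<subseteq> Xi \<kappa> H2" using e(2) r(2) by auto
    show "integrable Q (\<lambda>z. \<rho>' (fst z))"
      using \<rho>'(1) by (simp add: integrable_distr_eq[OF XY_measurable meas] integrable_distr_eq[OF X_measurable \<rho>'_meas])
    show "(\<integral>z. \<rho>' (fst z) \<partial>Q) < \<delta>"
      using \<rho>'(2) by (simp add: integral_distr[OF XY_measurable meas] integral_distr[OF X_measurable \<rho>'_meas])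
    show "norm (info \<xi> x - info \<xi>\<^sub>0 x) \<le> 2 * \<rho>' x" if "\<xi> \<in> ball \<xi>\<^sub>0 e" for \<xi> x
      using dom[OF that, of x] by (simp add: f_def)
  qed
qed

lemma M_crit_sample:
  "M_crit T \<psi> \<kappa> n \<xi> (sample n Z \<omega>) = (\<Sum>i<n. m_crit T \<psi> \<kappa> \<xi> (Z i \<omega>)) / real n"
  by (simp add: M_crit_def sample_def)

lemma criterion_expansion:
  assumes "\<delta> > 0"
  shows "\<exists>e>0. cball \<xi>\<^sub>0 e \<subseteq> Xi \<kappa> H2 \<and> whp M (\<lambda>n \<omega>. \<forall>\<xi>\<in>cball \<xi>\<^sub>0 e.
    \<bar>quad_remainder A \<xi>\<^sub>0 n (scaled_score n \<omega>) (\<lambda>\<xi>. M_crit T \<psi> \<kappa> n \<xi> (sample n Z \<omega>)) \<xi>\<bar>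
      \<le> \<delta> * (norm (\<xi> - \<xi>\<^sub>0))\<^sup>2)"
proof -
  obtain K where K: "K > 0" "\<And>(B :: real ^ ('k + 'k1 \<times> 'p) ^ ('k + 'k1 \<times> 'p)) u v.
      \<bar>u \<bullet> (B *v v)\<bar> \<le> K * norm B * (norm u * norm v)"
    by (rule matrix_form_bound) blast
  \<comment> \<open>Half of the error \<open>\<delta>\<close> is for the oscillation of the information, half for its deviation from \<open>A\<close>.\<close>
  define \<delta>' where "\<delta>' = \<delta> / (4 * K)"
  have "\<delta>' > 0" using assms K(1) by (simp add: \<delta>'_def)
  obtain e0 \<rho>' where e0: "e0 > 0" "cball \<xi>\<^sub>0 e0 \<subseteq> Xi \<kappa> H2" and \<rho>'_meas: "\<rho>' \<in> borel_measurable borel"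
    and \<rho>'_int: "integrable Q (\<lambda>z. \<rho>' (fst z))" "(\<integral>z. \<rho>' (fst z) \<partial>Q) < \<delta>'"
    and dom: "\<And>\<xi> x. \<xi> \<in> ball \<xi>\<^sub>0 e0 \<Longrightarrow> norm (info \<xi> x - info \<xi>\<^sub>0 x) \<le> 2 * \<rho>' x"
    by (rule small_information_oscillation[OF \<open>\<delta>' > 0\<close>]) blast
  define e where "e = e0 / 2"
  have e: "e > 0" "e < e0" "cball \<xi>\<^sub>0 e \<subseteq> Xi \<kappa> H2" using e0 by (auto simp: e_def)
  define Rn where "Rn n \<omega> = (\<Sum>i<n. \<rho>' (fst (Z i \<omega>))) / real n" for n \<omega>
  define In where "In n \<omega> = (\<Sum>i<n. info \<xi>\<^sub>0 (fst (Z i \<omega>))) /\<^sub>R real n" for n \<omega>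
  have \<rho>'_fst: "(\<lambda>z :: (real^'p) \<times> (real^'q). \<rho>' (fst z)) \<in> borel_measurable borel"
    by (rule measurable_compose[OF fst_snd_measurable(1) \<rho>'_meas])
  have info_fst: "(\<lambda>z :: (real^'p) \<times> (real^'q). info \<xi>\<^sub>0 (fst z)) \<in> borel_measurable borel"
    by (rule measurable_compose[OF fst_snd_measurable(1) info_measurable[OF true_in_Xi]])
  have "whp M (\<lambda>n \<omega>. dist (Rn n \<omega>) (\<integral>z. \<rho>' (fst z) \<partial>Q) \<le> \<delta>')"
  proof (rule whp_conv_in_prob[OF _ _ \<open>\<delta>' > 0\<close>])
    show "conv_in_prob M Rn (\<integral>z. \<rho>' (fst z) \<partial>Q)"
      unfolding Rn_def by (rule weak_law_real[OF \<rho>'_fst \<rho>'_int(1)])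
    show "Rn n \<in> borel_measurable M" for n
      unfolding Rn_def
      by (intro borel_measurable_divide borel_measurable_sum borel_measurable_const
          measurable_compose[OF Z_measurable \<rho>'_fst])
  qed
  then have osc: "whp M (\<lambda>n \<omega>. Rn n \<omega> \<le> 2 * \<delta>')"
    by (rule whp_mono) (use \<rho>'_int(2) in \<open>auto simp: dist_real_def intro!: always_eventually\<close>)
  have "4 * \<delta>' > 0" using \<open>\<delta>' > 0\<close> by simp
  have law: "whp M (\<lambda>n \<omega>. dist (In n \<omega>) A \<le> 4 * \<delta>')"
  proof (rule whp_conv_in_prob[OF _ _ \<open>4 * \<delta>' > 0\<close>])
    have "integrable Q (\<lambda>z. info \<xi>\<^sub>0 (fst z))" "(\<integral>z. info \<xi>\<^sub>0 (fst z) \<partial>Q) = A"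
      using info_integrable by (simp_all add: integrable_distr_eq[OF XY_measurable info_fst]
          integral_distr[OF XY_measurable info_fst] A_eq)
    then show "conv_in_prob M In A"
      unfolding In_def using weak_law[OF info_fst] by simp
    show "In n \<in> borel_measurable M" for n
      unfolding In_def
      by (intro borel_measurable_scaleR borel_measurable_sum borel_measurable_const
          measurable_compose[OF Z_measurable info_fst])
  qed
  have "whp M (\<lambda>n \<omega>. \<forall>\<xi>\<in>cball \<xi>\<^sub>0 e.
    \<bar>quad_remainder A \<xi>\<^sub>0 n (scaled_score n \<omega>) (\<lambda>\<xi>. M_crit T \<psi> \<kappa> n \<xi> (sample n Z \<omega>)) \<xi>\<bar>
      \<le> \<delta> * (norm (\<xi> - \<xi>\<^sub>0))\<^sup>2)"
  proof (rule whp_mono[OF whp_conj[OF osc law]], rule eventually_mono[OF eventually_gt_at_top[of 0]],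
      intro ballI impI)
    fix n :: nat and \<omega> and \<xi> :: "('k, 'k1, 'p) param"
    assume n: "0 < n" and \<omega>: "\<omega> \<in> space M" and small: "Rn n \<omega> \<le> 2 * \<delta>' \<and> dist (In n \<omega>) A \<le> 4 * \<delta>'"
      and \<xi>: "\<xi> \<in> cball \<xi>\<^sub>0 e"
    define u where "u = \<xi> - \<xi>\<^sub>0"
    have one: "\<bar>m_crit T \<psi> \<kappa> \<xi> z - m_crit T \<psi> \<kappa> \<xi>\<^sub>0 z - score z \<bullet> u + (u \<bullet> (info \<xi>\<^sub>0 (fst z) *v u)) / 2\<bar>
        \<le> K * \<rho>' (fst z) * (norm u)\<^sup>2" for z
    proof -
      have "\<xi> \<in> Xi \<kappa> H2" using \<xi> e(3) by blast
      then obtain s where s: "0 < s" "s < 1" and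
        eq: "m_crit T \<psi> \<kappa> \<xi> z = m_crit T \<psi> \<kappa> \<xi>\<^sub>0 z + score z \<bullet> u - (u \<bullet> (info (\<xi>\<^sub>0 + s *\<^sub>R u) (fst z) *v u)) / 2"
        using m_crit_Taylor[of \<xi> z] unfolding u_def by blast
      have "s * norm u \<le> norm u" using s by (simp add: mult_left_le_one_le)
      also have "norm u < e0" using \<xi> e(2) by (simp add: u_def dist_norm norm_minus_commute)
      finally have near: "\<xi>\<^sub>0 + s *\<^sub>R u \<in> ball \<xi>\<^sub>0 e0" using s by (simp add: dist_norm)
      let ?\<Delta> = "info (\<xi>\<^sub>0 + s *\<^sub>R u) (fst z) - info \<xi>\<^sub>0 (fst z)"
      have "m_crit T \<psi> \<kappa> \<xi> z - m_crit T \<psi> \<kappa> \<xi>\<^sub>0 z - score z \<bullet> u + (u \<bullet> (info \<xi>\<^sub>0 (fst z) *v u)) / 2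
          = - (u \<bullet> (?\<Delta> *v u)) / 2"
        by (simp add: eq matrix_vector_mult_diff_rdistrib inner_diff_right diff_divide_distrib)
      then have "\<bar>m_crit T \<psi> \<kappa> \<xi> z - m_crit T \<psi> \<kappa> \<xi>\<^sub>0 z - score z \<bullet> u + (u \<bullet> (info \<xi>\<^sub>0 (fst z) *v u)) / 2\<bar>
          = \<bar>u \<bullet> (?\<Delta> *v u)\<bar> / 2" by simp
      also have "\<dots> \<le> K * norm ?\<Delta> * (norm u * norm u) / 2" by (intro divide_right_mono K(2)) simp
      also have "\<dots> \<le> K * (2 * \<rho>' (fst z)) * (norm u * norm u) / 2"
        using K(1) by (intro divide_right_mono mult_right_mono mult_left_mono dom[OF near]) auto
      finally show ?thesis by (simp add: power2_eq_square)
    qed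
    define \<Delta> where "\<Delta> = M_crit T \<psi> \<kappa> n \<xi> (sample n Z \<omega>) - M_crit T \<psi> \<kappa> n \<xi>\<^sub>0 (sample n Z \<omega>)
          - (scaled_score n \<omega> \<bullet> u) / sqrt (real n)"
    have sum: "(\<Sum>i<n. m_crit T \<psi> \<kappa> \<xi> (Z i \<omega>) - m_crit T \<psi> \<kappa> \<xi>\<^sub>0 (Z i \<omega>) - score (Z i \<omega>) \<bullet> u
          + (u \<bullet> (info \<xi>\<^sub>0 (fst (Z i \<omega>)) *v u)) / 2) / real n
        = \<Delta> + (u \<bullet> (In n \<omega> *v u)) / 2"
    proof -
      have 1: "(scaled_score n \<omega> \<bullet> u) / sqrt (real n) = (\<Sum>i<n. score (Z i \<omega>) \<bullet> u) / real n"
        using n by (simp add: inner_commute[of _ u] scaled_score_inner)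
      have 2: "u \<bullet> (In n \<omega> *v u) = (\<Sum>i<n. u \<bullet> (info \<xi>\<^sub>0 (fst (Z i \<omega>)) *v u)) / real n"
      proof -
        interpret L: bounded_linear "\<lambda>B :: real ^ ('k + 'k1 \<times> 'p) ^ ('k + 'k1 \<times> 'p). u \<bullet> (B *v u)"
          by (rule bounded_linear_matrix_form)
        show ?thesis by (simp add: In_def L.sum L.scaleR divide_inverse mult.commute)
      qed
      show ?thesis
        by (simp only: \<Delta>_def 1 2 M_crit_sample sum.distrib sum_subtractf sum_divide_distrib[symmetric]
            add_divide_distrib diff_divide_distrib) simp
    qed
    have "\<bar>\<Delta> + (u \<bullet> (In n \<omega> *v u)) / 2\<bar>
        \<le> (\<Sum>i<n. K * \<rho>' (fst (Z i \<omega>)) * (norm u)\<^sup>2) / real n"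
      unfolding sum[symmetric] abs_divide abs_of_nat
      by (intro divide_right_mono order_trans[OF sum_abs] sum_mono one) simp
    also have "\<dots> = K * Rn n \<omega> * (norm u)\<^sup>2"
      by (simp add: Rn_def sum_distrib_left sum_distrib_right mult.assoc sum_divide_distrib)
    also have "\<dots> \<le> K * (2 * \<delta>') * (norm u)\<^sup>2"
      using small K(1) by (intro mult_right_mono mult_left_mono) auto
    also have "\<dots> = \<delta> / 2 * (norm u)\<^sup>2" using K(1) by (simp add: \<delta>'_def)
    finally have first: "\<bar>\<Delta> + (u \<bullet> (In n \<omega> *v u)) / 2\<bar> \<le> \<delta> / 2 * (norm u)\<^sup>2" .
    have "\<bar>u \<bullet> ((In n \<omega> - A) *v u)\<bar> \<le> K * norm (In n \<omega> - A) * (norm u * norm u)" by (rule K(2))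
    also have "\<dots> \<le> K * (4 * \<delta>') * (norm u * norm u)"
      using small K(1) by (intro mult_right_mono mult_left_mono) (auto simp: dist_norm)
    also have "\<dots> = \<delta> * (norm u)\<^sup>2" using K(1) by (simp add: \<delta>'_def power2_eq_square)
    finally have second: "\<bar>u \<bullet> (In n \<omega> *v u) - u \<bullet> (A *v u)\<bar> \<le> \<delta> * (norm u)\<^sup>2"
      by (simp add: matrix_vector_mult_diff_rdistrib inner_diff_right)
    have combine: "\<bar>a + c / 2\<bar> \<le> \<delta> * w" if "\<bar>a + b / 2\<bar> \<le> \<delta> / 2 * w" "\<bar>b - c\<bar> \<le> \<delta> * w" for a b c w :: real
      using that by (simp add: abs_le_iff field_simps)
    show "\<bar>quad_remainder A \<xi>\<^sub>0 n (scaled_score n \<omega>) (\<lambda>\<xi>. M_crit T \<psi> \<kappa> n \<xi> (sample n Z \<omega>)) \<xi>\<bar>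
      \<le> \<delta> * (norm (\<xi> - \<xi>\<^sub>0))\<^sup>2"
      unfolding quad_remainder_def u_def[symmetric] \<Delta>_def[symmetric] by (rule combine[OF first second])
  qed
  with e show ?thesis by blast
qed

lemma M_crit_continuous: "continuous_on (Xi \<kappa> H2) (\<lambda>\<xi>. M_crit T \<psi> \<kappa> n \<xi> z)"
  unfolding M_crit_def by (intro continuous_intros m_crit_continuous)

lemma M_crit_measurable:
  fixes \<xi> :: "('k, 'k1, 'p) param"
  assumes "\<xi> \<in> Xi \<kappa> H2"
  shows "M_crit T \<psi> \<kappa> n \<xi> \<in> borel_measurable (PiM {..<n} (\<lambda>_. borel))"
proof -
  have "(\<lambda>z. m_crit T \<psi> \<kappa> \<xi> (z i)) \<in> borel_measurable (PiM {..<n} (\<lambda>_. borel))" if "i < n" for i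
  proof (rule measurable_compose[OF _ m_crit_measurable[OF assms]])
    show "(\<lambda>z. z i) \<in> measurable (PiM {..<n} (\<lambda>_. borel)) borel"
      using that by (intro measurable_component_singleton) simp
  qed
  then show ?thesis
    unfolding M_crit_def by (intro borel_measurable_times borel_measurable_const borel_measurable_sum) simp
qed

lemma M_crit_concave:
  assumes "x \<in> Xi \<kappa> H2" "y \<in> Xi \<kappa> H2" "0 \<le> t" "t \<le> 1"
  shows "(1 - t) * M_crit T \<psi> \<kappa> n x z + t * M_crit T \<psi> \<kappa> n y z \<le> M_crit T \<psi> \<kappa> n ((1 - t) *\<^sub>R x + t *\<^sub>R y) z"
proof -
  have "(\<Sum>i<n. (1 - t) * m_crit T \<psi> \<kappa> x (z i) + t * m_crit T \<psi> \<kappa> y (z i))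
      \<le> (\<Sum>i<n. m_crit T \<psi> \<kappa> ((1 - t) *\<^sub>R x + t *\<^sub>R y) (z i))"
    by (intro sum_mono m_crit_concave assms)
  then have "(\<Sum>i<n. (1 - t) * m_crit T \<psi> \<kappa> x (z i) + t * m_crit T \<psi> \<kappa> y (z i)) / real n
      \<le> (\<Sum>i<n. m_crit T \<psi> \<kappa> ((1 - t) *\<^sub>R x + t *\<^sub>R y) (z i)) / real n"
    by (rule divide_right_mono) simp
  then show ?thesis
    by (simp add: M_crit_def sum.distrib sum_distrib_left[symmetric] add_divide_distrib)
qed

end

section \<open>Reduced-rank M-estimators\<close>

sublocale partial_rr_mglm_sample \<subseteq> criterion: locally_quadratic_criterion M
  "\<lambda>n \<xi> \<omega>. M_crit T \<psi> \<kappa> n \<xi> (sample n Z \<omega>)" "Xi \<kappa> H2" \<xi>\<^sub>0 scaled_score "W_inv M \<psi> \<kappa> X \<xi>\<^sub>0"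
  by unfold_locales
    (auto intro: convex_Xi true_in_Xi M_crit_concave M_crit_continuous A_sym A_pos_def
      scaled_score_measurable scaled_score_tight criterion_expansion)

theorem theorem3p3:
  fixes M :: "'w measure"
    and \<nu> :: "(real^'q) measure"
    and T :: "real^'q \<Rightarrow> real^'k"
    and h :: "real^'q \<Rightarrow> real"
    and \<psi> :: "real^'k \<Rightarrow> real"
    and \<kappa> :: "'k1::finite \<Rightarrow> 'k"
    and H2 :: "(real^'k) set"
    and \<rho> :: "'r::finite \<Rightarrow> 'p::finite"
    and \<xi>\<^sub>0 :: "('k, 'k1, 'p) param"
    and X :: "'w \<Rightarrow> real^'p"
    and Y :: "'w \<Rightarrow> real^'q"
    and Z :: "nat \<Rightarrow> 'w \<Rightarrow> (real^'p) \<times> (real^'q)"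
  assumes model: "partial_rr_mglm M \<nu> T h \<psi> \<kappa> H2 \<rho> CARD('d::finite) \<xi>\<^sub>0 X Y"
    and R1: "R1 M \<kappa> H2 X"
    and R2: "\<And>K. compact K \<Longrightarrow> K \<subseteq> Xi \<kappa> H2 \<Longrightarrow> R2 M T \<psi> \<kappa> X Y K"
    and R3: "\<And>K. compact K \<Longrightarrow> K \<subseteq> Xi \<kappa> H2 \<Longrightarrow> R3 M T \<psi> \<kappa> X Y K"
    and R4: "\<And>K. compact K \<Longrightarrow> K \<subseteq> Xi \<kappa> H2 \<Longrightarrow> R4 M \<psi> \<kappa> X K"
    and Z_independent: "prob_space.indep_vars M (\<lambda>_. borel) Z UNIV"
    and Z_copies: "\<And>i. distr M borel (Z i) = distr M borel (\<lambda>\<omega>. (X \<omega>, Y \<omega>))"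
  shows "(\<exists>est. strong_M_estimator M Z (M_crit T \<psi> \<kappa>) (Xi_res \<kappa> H2 \<rho> CARD('d)) est) \<and>
    (\<forall>est. weak_M_estimator M Z (M_crit T \<psi> \<kappa>) (Xi_res \<kappa> H2 \<rho> CARD('d)) est \<longrightarrow>
       conv_in_prob M (\<lambda>n \<omega>. est n (sample n Z \<omega>)) \<xi>\<^sub>0) \<and>
    invertible (W_inv M \<psi> \<kappa> X \<xi>\<^sub>0) \<and>
    (\<forall>est. strong_M_estimator M Z (M_crit T \<psi> \<kappa>) (Xi_res \<kappa> H2 \<rho> CARD('d)) est \<longrightarrow>
       (\<forall>\<theta>\<^sub>0 :: ('k, 'k1, 'd, 'r, 'p) theta. \<theta>\<^sub>0 \<in> Theta \<kappa> H2 \<rho> \<and> g_map \<rho> \<theta>\<^sub>0 = \<xi>\<^sub>0 \<longrightarrow>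
         (let D = jacobian (g_map \<rho>) (at \<theta>\<^sub>0);
              A = W_inv M \<psi> \<kappa> X \<xi>\<^sub>0;
              W = matrix_inv A
          in \<forall>G. generalised_inverse (transpose D ** A ** D) G \<longrightarrow>
               asymptotically_normal M (\<lambda>n \<omega>. sqrt (real n) *\<^sub>R (est n (sample n Z \<omega>) - \<xi>\<^sub>0)) 0
                 (projection_matrix D G A ** W))))"
proof -
  interpret partial_rr_mglm_sample M \<nu> T h \<psi> \<kappa> H2 \<rho> "CARD('d)" \<xi>\<^sub>0 X Y Z
  proof -
    interpret partial_rr_mglm M \<nu> T h \<psi> \<kappa> H2 \<rho> "CARD('d)" \<xi>\<^sub>0 X Y by (rule model)
    show "partial_rr_mglm_sample M \<nu> T h \<psi> \<kappa> H2 \<rho> CARD('d) \<xi>\<^sub>0 X Y Z"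
      by unfold_locales (fact R1 R3 R4 Z_independent Z_copies)+
  qed
  let ?Mn = "M_crit T \<psi> \<kappa> :: nat \<Rightarrow> ('k, 'k1, 'p) param \<Rightarrow> _"
  let ?\<Xi> = "Xi \<kappa> H2 :: ('k, 'k1, 'p) param set"
  let ?\<Xi>r = "Xi_res \<kappa> H2 \<rho> CARD('d) :: ('k, 'k1, 'p) param set"
  have sub: "?\<Xi>r \<subseteq> ?\<Xi>" by (auto simp: Xi_res_def)
  have centre: "\<xi>\<^sub>0 \<in> ?\<Xi>r" by (rule true_parameter)
  have "\<exists>est. strong_M_estimator M Z ?Mn ?\<Xi>r est"
  proof (rule strong_M_estimator_exists)
    show "?\<Xi>r \<noteq> {}" using centre by auto
    show "continuous_on ?\<Xi>r (\<lambda>\<xi>. ?Mn n \<xi> z)" for n z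
      by (rule continuous_on_subset[OF M_crit_continuous sub])
    show "?Mn n \<xi> \<in> borel_measurable (PiM {..<n} (\<lambda>_. borel))" if "\<xi> \<in> ?\<Xi>r" for n \<xi>
      using that sub by (intro M_crit_measurable) auto
    show "whp M (\<lambda>n \<omega>. bdd_above ((\<lambda>\<xi>. ?Mn n \<xi> (sample n Z \<omega>)) ` ?\<Xi>r))"
      by (rule whp_mono[OF criterion.whp_bdd_above], intro always_eventually allI ballI impI)
        (erule bdd_above_mono, use sub in auto)
  qed (rule Z_measurable)
  moreover have "conv_in_prob M (\<lambda>n \<omega>. est n (sample n Z \<omega>)) \<xi>\<^sub>0"
    if weak: "weak_M_estimator M Z ?Mn ?\<Xi>r est" for est
  proof -
    have est: "M_estimator M Z ?Mn ?\<Xi>r (\<lambda>n. 1) est" using weak by (simp add: weak_M_estimator_def)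
    have near: "whp M (\<lambda>n \<omega>. ?Mn n \<xi>\<^sub>0 (sample n Z \<omega>) \<le> ?Mn n (est n (sample n Z \<omega>)) (sample n Z \<omega>) + \<delta>)"
      if "\<delta> > 0" for \<delta>
      by (rule whp_mono[OF M_estimator_near_max[OF est that]])
        (use centre in \<open>auto intro!: always_eventually\<close>)
    have "whp M (\<lambda>n \<omega>. norm (est n (sample n Z \<omega>) - \<xi>\<^sub>0) \<le> r)" if "r > 0" for r
      by (rule criterion.consistent[OF _ near that])
        (use M_estimator_measurable(2)[OF est Z_measurable] sub in blast)
    from whpD[OF this] show ?thesis by (simp add: conv_in_prob_def dist_norm not_le)
  qed
  moreover have "asymptotically_normal M (\<lambda>n \<omega>. sqrt (real n) *\<^sub>R (est n (sample n Z \<omega>) - \<xi>\<^sub>0)) 0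
      (projection_matrix (jacobian (g_map \<rho>) (at \<theta>\<^sub>0)) G A ** matrix_inv A)"
    if strong: "strong_M_estimator M Z ?Mn ?\<Xi>r est"
      and \<theta>\<^sub>0: "\<theta>\<^sub>0 \<in> Theta \<kappa> H2 \<rho>" "g_map \<rho> \<theta>\<^sub>0 = \<xi>\<^sub>0"
      and G: "generalised_inverse (transpose (jacobian (g_map \<rho>) (at \<theta>\<^sub>0)) ** A ** jacobian (g_map \<rho>) (at \<theta>\<^sub>0)) G"
    for est and \<theta>\<^sub>0 :: "('k, 'k1, 'd, 'r, 'p) theta" and G
  proof -
    define D where "D = jacobian (g_map \<rho>) (at \<theta>\<^sub>0)"
    define B where "B = D ** G ** transpose D"
    have D: "D *v s = g_linear \<rho> \<theta>\<^sub>0 s" for s unfolding D_def by (rule jacobian_g_map)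
    have G: "generalised_inverse (transpose D ** A ** D) G" using G by (simp add: D_def)
    have est: "M_estimator M Z ?Mn ?\<Xi>r (\<lambda>n. 1 / real n) est" using strong by (simp add: strong_M_estimator_def)
    obtain C where C: "C > 0" "\<And>s :: ('k, 'k1, 'd, 'r, 'p) theta. norm (g_quadratic \<rho> s) \<le> C * (norm s)\<^sup>2"
      using g_quadratic_bound[of \<rho>] by blast
    have expand: "g_map \<rho> (\<theta>\<^sub>0 + s) - \<xi>\<^sub>0 - D *v s = g_quadratic \<rho> s" for s
      by (simp add: g_map_expansion D \<theta>\<^sub>0(2))
    obtain C' e1 where C': "C' > 0" "e1 > 0" and lift: "\<And>\<xi>. rank (beta1 \<rho> \<xi>) = CARD('d) \<Longrightarrow> norm (\<xi> - \<xi>\<^sub>0) < e1 \<Longrightarrow>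
        \<exists>s. \<xi> = g_map \<rho> (\<theta>\<^sub>0 + s) \<and> norm s \<le> C' * norm (\<xi> - \<xi>\<^sub>0)"
      using g_map_Lipschitz_section[OF inj_rho \<theta>\<^sub>0(1)] unfolding \<theta>\<^sub>0(2) by blast
    \<comment> \<open>The constraint set and its tangent space agree to second order at \<open>\<xi>\<^sub>0\<close>, in both directions.\<close>
    have tangent: "\<exists>s. norm (\<xi> - \<xi>\<^sub>0 - D *v s) \<le> (C * C'\<^sup>2) * (norm (\<xi> - \<xi>\<^sub>0))\<^sup>2"
      if \<xi>: "\<xi> \<in> ?\<Xi>r" and near: "norm (\<xi> - \<xi>\<^sub>0) < e1" for \<xi>
    proof -
      obtain s where s: "\<xi> = g_map \<rho> (\<theta>\<^sub>0 + s)" "norm s \<le> C' * norm (\<xi> - \<xi>\<^sub>0)"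
        using lift[OF _ near] \<xi> by (auto simp: Xi_res_def)
      have "norm (\<xi> - \<xi>\<^sub>0 - D *v s) \<le> C * (norm s)\<^sup>2" unfolding s(1) expand by (rule C(2))
      also have "\<dots> \<le> C * (C' * norm (\<xi> - \<xi>\<^sub>0))\<^sup>2" using C(1) s(2) by (intro mult_left_mono power_mono) auto
      finally show ?thesis by (auto simp: power_mult_distrib mult.assoc)
    qed
    obtain e2 where e2: "e2 > 0" "\<And>s. norm s < e2 \<Longrightarrow> g_map \<rho> (\<theta>\<^sub>0 + s) \<in> ?\<Xi>r"
      by (rule g_map_near_in_Xi_res[OF inj_rho \<theta>\<^sub>0(1) H2_open]) blast
    have curve: "\<exists>\<xi>\<in>?\<Xi>r. norm (\<xi> - \<xi>\<^sub>0 - D *v s) \<le> C * (norm s)\<^sup>2" if "norm s < e2" for s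
      by (rule bexI[OF _ e2(2)[OF that]]) (simp add: expand C(2))
    have "C * C'\<^sup>2 > 0" using C(1) C'(1) by simp
    note linear = criterion.asymptotically_linear[OF G sub centre this C'(2) tangent C(1) e2(1) curve]
    have "asymptotically_normal M (\<lambda>n \<omega>. sqrt (real n) *\<^sub>R (est n (sample n Z \<omega>) - \<xi>\<^sub>0)) 0 B"
    proof (rule asymptotically_normal_linear_image[where G = scaled_score and A = A])
      show "(\<lambda>\<omega>. sqrt (real n) *\<^sub>R (est n (sample n Z \<omega>) - \<xi>\<^sub>0)) \<in> borel_measurable M" for n
        using M_estimator_measurable(1)[OF est Z_measurable] by measurable
      show "transpose B = B" "B ** A ** B = B"
        unfolding B_def using generalised_inverse_projection[OF A_sym A_pos_def G] by auto
      fix K \<epsilon> :: real assume "K > 0" "\<epsilon> > 0"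
      show "whp M (\<lambda>n \<omega>. norm (scaled_score n \<omega>) \<le> K \<longrightarrow>
          norm (sqrt (real n) *\<^sub>R (est n (sample n Z \<omega>) - \<xi>\<^sub>0) - B *v scaled_score n \<omega>) \<le> \<epsilon>)"
        unfolding B_def
      proof (rule linear[OF _ _ _ _ _ \<open>K > 0\<close> \<open>\<epsilon> > 0\<close>])
        show "est n (sample n Z \<omega>) \<in> ?\<Xi>r" if "\<omega> \<in> space M" for n \<omega>
          by (rule M_estimator_measurable(2)[OF est Z_measurable that])
        show "whp M (\<lambda>n \<omega>. \<forall>\<xi>\<in>?\<Xi>r. ?Mn n \<xi> (sample n Z \<omega>) \<le> ?Mn n (est n (sample n Z \<omega>)) (sample n Z \<omega>) + \<delta> / real n)"
          if "\<delta> > 0" for \<delta>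
          using M_estimator_near_max[OF est that] by simp
      qed
    qed (rule scaled_score_measurable scaled_score_tight scaled_score_characteristic_function A_nonneg
        | assumption)+
    moreover have "projection_matrix D G A ** matrix_inv A = B"
    proof -
      have "A ** matrix_inv A = mat 1" 
        using A_invertible unfolding invertible_def matrix_inv_def by (rule someI2_ex) simp
      then show ?thesis by (simp add: projection_matrix_def B_def flip: matrix_mul_assoc)
    qed
    ultimately show ?thesis by (simp add: D_def)
  qed
  ultimately show ?thesis using A_invertible by (simp add: Let_def)
qed

end
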